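(* Let $x$ be a critical point of the Lagrangian system $\mathcal F(x)=\int_0^T L(t,x,\dot x)\,dt$, where $L\in C^2([0,T]\times\mathbf R^{2n},\mathbf R)$ satisfies the Legendre convexity condition, let $\gamma$ be the fundamental solution of the associated linear Hamiltonian system along $x$, and let $\Lambda_0$ be any Lagrangian subspace of $(\mathbf C^{2n}\oplus\mathbf C^{2n},-\omega\oplus\omega)$. Then the Morse indices $m^-(\Lambda_0)$ and $m^-(\Lambda_D)$ satisfy $$m^-(\Lambda_0)-m^-(\Lambda_D)=i\big(Gr(\gamma(T)),\Lambda_0,\Lambda_D\big),$$ where $i$ is the triple index in $(\mathbf C^{2n}\oplus\mathbf C^{2n},-\omega\oplus\omega)$.
   Context: **Lagrangian system.** $\mathcal F$ is considered on $W^{1,2}([0,T],\mathbf R^n)$. The Legendre convexity condition is $(D^2_{vv}L(t,u,v)w,w)>0$ for all $t\in[0,T]$, $(u,v)\in\mathbf R^n\oplus\mathbf R^n$, $w\in\mathbf R^n\setminus\{0\}$. A critical (stationary) point is a solution $x$ of the Euler-Lagrange equation $\frac{d}{dt}\frac{\partial L}{\partial\dot x}(t,x,\dot x)-\frac{\partial L}{\partial x}(t,x,\dot x)=0$. Along $x$ put $P(t)=\frac{\partial^2L}{\partial\dot x^2}$, $Q(t)=\frac{\partial^2L}{\partial x\partial\dot x}$ (entries $Q_{ij}=\partial^2L/\partial\dot x_i\partial x_j$), $R(t)=\frac{\partial^2L}{\partial x^2}$. The linearization along $x$ is given by $\mathcal A\xi=-\frac{d}{dt}(P\dot \xi+Q\xi)+Q^T\dot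 \xi+R\xi$. **Symplectic notation.** $\langle\cdot,\cdot\rangle$ is the standard Hermitian inner product, $J=\begin{bmatrix}0&-I_n\\ I_n&0\end{bmatrix}$, $\omega(a,b)=\langle Ja,b\rangle$ on $\mathbf C^{2n}$. A complex subspace of a complex symplectic space is Lagrangian if the symplectic form vanishes on it and it has half the dimension. **Boundary conditions and Morse index.** For a function $\xi$ put $y=P\dot\xi+Q\xi$ and $z=(y,\xi)^T\in\mathbf C^{2n}$. For a Lagrangian subspace $\Lambda_0$ of $(\mathbf C^{2n}\oplus\mathbf C^{2n},-\omega\oplus\omega)$, $\mathcal A$ is regarded as a self-adjoint operator on $L^2([0,T],\mathbf C^n)$ with domain $E_{\Lambda_0}(0,T)=\{\xi\in W^{2,2}([0,T],\mathbf C^n): (z(0),z(T))\in\Lambda_0\}$. The Morse index $m^-(\Lambda_0)$ is the total number of negative eigenvalues of this operator. $\Lambda^n_D=\mathbf C^n\oplus\{0\}\subset\mathbf C^{2n}$ (i.e. $\xi$-component zero), and $\Lambda_D=\Lambda_D^n\oplus\Lambda_D^n$ is the Dirichlet condition $\xi(0)=\xi(T)=0$. **Fundamental solution.** $\gamma$ solves $\dot\gamma=J\mathcal B\gamma$, $\gamma(0)=I_{2n}$, with $\mathcal B=\begin{bmatrix}P^{-1}&-P^{-1}Q\\ -Q^TP^{-1}&Q^TP^{-1}Q-R\end{bmatrix}$. For a matrix $M\in L(\mathbf C^m)$, $Gr(M)=\{(v,Mv): v\in\mathbf C^m\}$. **Triple index.** For Lagrangian subspaces $\alpha,\beta,\kappa$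 of a complex symplectic space $(V,\omega_V)$, let $\mathfrak Q(\alpha,\beta;\kappa)$ be the Hermitian form on $\alpha\cap(\beta+\kappa)$ given by $\mathfrak Q(x_1,x_2)=\omega_V(y_1,z_2)$, where $x_j=y_j+z_j$, $y_j\in\beta$, $z_j\in\kappa$. Then $i(\alpha,\beta,\kappa)=m^+(\mathfrak Q(\alpha,\beta;\kappa))+\dim(\alpha\cap\kappa)-\dim(\alpha\cap\beta\cap\kappa)$, where $m^+$ is the dimension of a maximal positive definite subspace.
   Formalization: The domain of A is taken as {ξ in W^{1,2} : Pξ'+Qξ in W^{1,2}, (z(0),z(T)) in Λ_0} instead of W^{2,2}; the two agree when P, Q are C^1, and for L merely C^2 the W^{2,2} domain does not make A self-adjoint and the formula fails. *)

theory Defs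
  imports "HOL-Analysis.Analysis" "HOL-Library.Function_Algebras"
begin

section \<open>Complex symplectic linear algebra\<close>

text \<open>
  \<open>\<complex>\<^sup>m \<oplus> \<complex>\<^sup>n\<close> is \<open>complex^('m + 'n)\<close>; so \<open>\<complex>\<^sup>2\<^sup>n\<close> is \<open>complex^('n + 'n)\<close> and
  \<open>\<complex>\<^sup>2\<^sup>n \<oplus> \<complex>\<^sup>2\<^sup>n\<close> is \<open>complex^(('n + 'n) + ('n + 'n))\<close>. Complex subspaces and complex dimension
  are \<open>vec.subspace\<close> and \<open>vec.dim\<close>.
\<close>

definition vjoin :: "'a^'m \<Rightarrow> 'a^'n \<Rightarrow> 'a^('m::finite + 'n::finite)" where
  "vjoin a b = (\<chi> k. case k of Inl i \<Rightarrow> a $ i | Inr j \<Rightarrow> b $ j)"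

definition vfst :: "'a^('m::finite + 'n::finite) \<Rightarrow> 'a^'m" where
  "vfst v = (\<chi> i. v $ Inl i)"

definition vsnd :: "'a^('m::finite + 'n::finite) \<Rightarrow> 'a^'n" where
  "vsnd v = (\<chi> j. v $ Inr j)"

definition block_mat ::
  "'a^'n^'m \<Rightarrow> 'a^'p^'m \<Rightarrow> 'a^'n^'q \<Rightarrow> 'a^'p^'q
    \<Rightarrow> 'a^('n::finite + 'p::finite)^('m::finite + 'q::finite)" where
  "block_mat A B C D = (\<chi> k l. case k of
      Inl i \<Rightarrow> (case l of Inl j \<Rightarrow> A $ i $ j | Inr j \<Rightarrow> B $ i $ j)
    | Inr i \<Rightarrow> (case l of Inl j \<Rightarrow> C $ i $ j | Inr j \<Rightarrow> D $ i $ j))"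

definition cmat :: "real^'n^'m \<Rightarrow> complex^'n^'m" where
  "cmat A = (\<chi> i j. complex_of_real (A $ i $ j))"

definition hinner :: "complex^'n \<Rightarrow> complex^'n \<Rightarrow> complex" where
  "hinner a b = (\<Sum>i\<in>UNIV. a $ i * cnj (b $ i))"

definition J_mat :: "complex^('n::finite + 'n)^('n + 'n)" where
  "J_mat = block_mat 0 (- mat 1) (mat 1) 0"

definition omega :: "complex^('n::finite + 'n) \<Rightarrow> complex^('n + 'n) \<Rightarrow> complex" where
  "omega a b = hinner (J_mat *v a) b"

text \<open>The form \<open>-\<omega> \<oplus> \<omega>\<close> on \<open>\<complex>\<^sup>2\<^sup>n \<oplus> \<complex>\<^sup>2\<^sup>n\<close>.\<close>

definition omega2 ::
  "complex^(('n::finite + 'n) + ('n + 'n)) \<Rightarrow> complex^(('n + 'n) + ('n + 'n)) \<Rightarrow> complex" where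
  "omega2 a b = - omega (vfst a) (vfst b) + omega (vsnd a) (vsnd b)"

definition lagrangian :: "(complex^'m \<Rightarrow> complex^'m \<Rightarrow> complex) \<Rightarrow> (complex^'m) set \<Rightarrow> bool" where
  "lagrangian w S \<longleftrightarrow>
     vec.subspace S \<and> (\<forall>a\<in>S. \<forall>b\<in>S. w a b = 0) \<and> 2 * vec.dim S = CARD('m)"

definition Gr :: "complex^'m^'m \<Rightarrow> (complex^('m::finite + 'm)) set" where
  "Gr M = {vjoin v (M *v v) | v. True}"

definition Lambda_Dn :: "(complex^('n::finite + 'n)) set" where
  "Lambda_Dn = {vjoin y 0 | y. True}"

definition Lambda_D :: "(complex^(('n::finite + 'n) + ('n + 'n))) set" where
  "Lambda_D = {vjoin a b | a b. a \<in> Lambda_Dn \<and> b \<in> Lambda_Dn}"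

section \<open>Triple index\<close>

definition plus_set :: "(complex^'m) set \<Rightarrow> (complex^'m) set \<Rightarrow> (complex^'m) set" where
  "plus_set S K = {y + z | y z. y \<in> S \<and> z \<in> K}"

text \<open>
  The value does not depend on the decompositions chosen when \<open>\<beta>\<close> and \<open>\<kappa>\<close> are isotropic subspaces,
  which is what justifies the definite description.
\<close>

definition triple_form ::
  "(complex^'m \<Rightarrow> complex^'m \<Rightarrow> complex) \<Rightarrow> (complex^'m) set \<Rightarrow> (complex^'m) set
    \<Rightarrow> complex^'m \<Rightarrow> complex^'m \<Rightarrow> complex" where
  "triple_form w \<beta> \<kappa> x1 x2 =
     (THE c. \<exists>y1\<in>\<beta>. \<exists>z1\<in>\<kappa>. \<exists>y2\<in>\<beta>. \<exists>z2\<in>\<kappa>. x1 = y1 + z1 \<and> x2 = y2 + z2 \<and> c = w y1 z2)"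

lemma triple_form_eq:
  fixes \<beta> \<kappa> :: "(complex^(('n::finite + 'n) + ('n + 'n))) set"
  assumes "vec.subspace \<beta>" "vec.subspace \<kappa>"
    and "\<And>a b. a \<in> \<beta> \<Longrightarrow> b \<in> \<beta> \<Longrightarrow> omega2 a b = 0"
    and "\<And>a b. a \<in> \<kappa> \<Longrightarrow> b \<in> \<kappa> \<Longrightarrow> omega2 a b = 0"
    and "y1 \<in> \<beta>" "z1 \<in> \<kappa>" "y2 \<in> \<beta>" "z2 \<in> \<kappa>"
  shows "triple_form omega2 \<beta> \<kappa> (y1 + z1) (y2 + z2) = omega2 y1 z2"
proof -
  have add1: "omega2 (a + b) c = omega2 a c + omega2 b c"
    for a b c :: "complex^(('n + 'n) + ('n + 'n))"
    by (simp add: omega2_def omega_def hinner_def vfst_def vsnd_def matrix_vector_mult_def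
        sum.distrib algebra_simps)
  have add2: "omega2 a (b + c) = omega2 a b + omega2 a c"
    for a b c :: "complex^(('n + 'n) + ('n + 'n))"
    by (simp add: omega2_def omega_def hinner_def vfst_def vsnd_def sum.distrib algebra_simps)
  have "omega2 u1 v2 = omega2 y1 z2"
    if "u1 \<in> \<beta>" "v1 \<in> \<kappa>" "u2 \<in> \<beta>" "v2 \<in> \<kappa>" "y1 + z1 = u1 + v1" "y2 + z2 = u2 + v2"
    for u1 v1 u2 v2
  proof -
    have e1: "y1 - u1 = v1 - z1" and e2: "z2 - v2 = u2 - y2"
      using that(5,6) by (metis add_diff_cancel diff_diff_eq2 diff_add_eq add.commute)+
    have "y1 - u1 \<in> \<kappa>"
      using e1 that assms(2,6) by (simp add: vec.subspace_diff)
    then have "omega2 (y1 - u1) z2 = 0" using assms(4,8) by blast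
    moreover have "z2 - v2 \<in> \<beta>"
      using e2 that assms(1,7) by (simp add: vec.subspace_diff)
    then have "omega2 u1 (z2 - v2) = 0" using assms(3) that by blast
    ultimately show ?thesis
      using add1[of "y1 - u1" u1 z2] add2[of u1 "z2 - v2" v2] by simp
  qed
  then show ?thesis
    unfolding triple_form_def using assms(5-8) by (intro the_equality) blast+
qed

definition pos_index ::
  "(complex^'m) set \<Rightarrow> (complex^'m \<Rightarrow> complex^'m \<Rightarrow> complex) \<Rightarrow> nat" where
  "pos_index V q =
     Max {vec.dim W | W. vec.subspace W \<and> W \<subseteq> V \<and> (\<forall>w\<in>W. w \<noteq> 0 \<longrightarrow> Re (q w w) > 0)}"

definition triple_index ::
  "(complex^'m \<Rightarrow> complex^'m \<Rightarrow> complex)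
    \<Rightarrow> (complex^'m) set \<Rightarrow> (complex^'m) set \<Rightarrow> (complex^'m) set \<Rightarrow> int" where
  "triple_index w \<alpha> \<beta> \<kappa> =
     int (pos_index (\<alpha> \<inter> plus_set \<beta> \<kappa>) (triple_form w \<beta> \<kappa>))
     + int (vec.dim (\<alpha> \<inter> \<kappa>)) - int (vec.dim (\<alpha> \<inter> \<beta> \<inter> \<kappa>))"

section \<open>Lagrangian system\<close>

text \<open>
  On \<open>[0,T] \<times> \<real>\<^sup>2\<^sup>n\<close>, a convex set with nonempty interior, the derivatives relative to the set are
  unique (one-sided in \<open>t\<close> at the end points).
\<close>

definition C2_on :: "('a::real_normed_vector \<Rightarrow> 'b::real_normed_vector) \<Rightarrow> 'a set \<Rightarrow> bool" where
  "C2_on f S \<longleftrightarrow>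
     (\<exists>(f' :: 'a \<Rightarrow> 'a \<Rightarrow>\<^sub>L 'b) (f'' :: 'a \<Rightarrow> 'a \<Rightarrow>\<^sub>L ('a \<Rightarrow>\<^sub>L 'b)).
        (\<forall>p\<in>S. (f has_derivative blinfun_apply (f' p)) (at p within S)) \<and>
        (\<forall>p\<in>S. (f' has_derivative blinfun_apply (f'' p)) (at p within S)) \<and>
        continuous_on S f'')"

text \<open>\<open>pd_u i F = \<partial>F/\<partial>u\<^sub>i\<close> and \<open>pd_v i F = \<partial>F/\<partial>v\<^sub>i\<close> for \<open>F = F(t,u,v)\<close>.\<close>

definition pd_u ::
  "'n::finite \<Rightarrow> (real \<Rightarrow> real^'n \<Rightarrow> real^'n \<Rightarrow> real) \<Rightarrow> real \<Rightarrow> real^'n \<Rightarrow> real^'n \<Rightarrow> real" where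
  "pd_u i F t u v = deriv (\<lambda>s. F t (u + s *\<^sub>R axis i 1) v) 0"

definition pd_v ::
  "'n::finite \<Rightarrow> (real \<Rightarrow> real^'n \<Rightarrow> real^'n \<Rightarrow> real) \<Rightarrow> real \<Rightarrow> real^'n \<Rightarrow> real^'n \<Rightarrow> real" where
  "pd_v i F t u v = deriv (\<lambda>s. F t u (v + s *\<^sub>R axis i 1)) 0"

definition grad_u ::
  "(real \<Rightarrow> real^'n \<Rightarrow> real^'n \<Rightarrow> real) \<Rightarrow> real \<Rightarrow> real^'n \<Rightarrow> real^'n \<Rightarrow> real^'n" where
  "grad_u L t u v = (\<chi> i. pd_u i L t u v)"

definition grad_v ::
  "(real \<Rightarrow> real^'n \<Rightarrow> real^'n \<Rightarrow> real) \<Rightarrow> real \<Rightarrow> real^'n \<Rightarrow> real^'n \<Rightarrow> real^'n" where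
  "grad_v L t u v = (\<chi> i. pd_v i L t u v)"

definition D2_vv ::
  "(real \<Rightarrow> real^'n \<Rightarrow> real^'n \<Rightarrow> real) \<Rightarrow> real \<Rightarrow> real^'n \<Rightarrow> real^'n \<Rightarrow> real^'n^'n" where
  "D2_vv L t u v = (\<chi> i j. pd_v i (pd_v j L) t u v)"

definition D2_vu ::
  "(real \<Rightarrow> real^'n \<Rightarrow> real^'n \<Rightarrow> real) \<Rightarrow> real \<Rightarrow> real^'n \<Rightarrow> real^'n \<Rightarrow> real^'n^'n" where
  "D2_vu L t u v = (\<chi> i j. pd_v i (pd_u j L) t u v)"

definition D2_uu ::
  "(real \<Rightarrow> real^'n \<Rightarrow> real^'n \<Rightarrow> real) \<Rightarrow> real \<Rightarrow> real^'n \<Rightarrow> real^'n \<Rightarrow> real^'n^'n" where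
  "D2_uu L t u v = (\<chi> i j. pd_u i (pd_u j L) t u v)"

definition legendre_convex :: "real \<Rightarrow> (real \<Rightarrow> real^'n \<Rightarrow> real^'n \<Rightarrow> real) \<Rightarrow> bool" where
  "legendre_convex T L \<longleftrightarrow>
     (\<forall>t\<in>{0..T}. \<forall>u v w. w \<noteq> 0 \<longrightarrow> (D2_vv L t u v *v w) \<bullet> w > 0)"

definition velocity :: "real \<Rightarrow> (real \<Rightarrow> real^'n) \<Rightarrow> real \<Rightarrow> real^'n" where
  "velocity T x t = vector_derivative x (at t within {0..T})"

text \<open>Classical (\<open>C\<^sup>1\<close>) solutions of the Euler-Lagrange equation; no boundary condition is imposed.\<close>

definition critical_point ::
  "real \<Rightarrow> (real \<Rightarrow> real^'n \<Rightarrow> real^'n \<Rightarrow> real) \<Rightarrow> (real \<Rightarrow> real^'n) \<Rightarrow> bool" where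
  "critical_point T L x \<longleftrightarrow>
     x differentiable_on {0..T} \<and> continuous_on {0..T} (velocity T x) \<and>
     (\<forall>t\<in>{0..T}. ((\<lambda>s. grad_v L s (x s) (velocity T x s)) has_vector_derivative
        grad_u L t (x t) (velocity T x t)) (at t within {0..T}))"

definition P_along ::
  "real \<Rightarrow> (real \<Rightarrow> real^'n \<Rightarrow> real^'n \<Rightarrow> real) \<Rightarrow> (real \<Rightarrow> real^'n) \<Rightarrow> real \<Rightarrow> real^'n^'n" where
  "P_along T L x t = D2_vv L t (x t) (velocity T x t)"

definition Q_along ::
  "real \<Rightarrow> (real \<Rightarrow> real^'n \<Rightarrow> real^'n \<Rightarrow> real) \<Rightarrow> (real \<Rightarrow> real^'n) \<Rightarrow> real \<Rightarrow> real^'n^'n" where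
  "Q_along T L x t = D2_vu L t (x t) (velocity T x t)"

definition R_along ::
  "real \<Rightarrow> (real \<Rightarrow> real^'n \<Rightarrow> real^'n \<Rightarrow> real) \<Rightarrow> (real \<Rightarrow> real^'n) \<Rightarrow> real \<Rightarrow> real^'n^'n" where
  "R_along T L x t = D2_uu L t (x t) (velocity T x t)"

definition B_mat :: "real^'n^'n \<Rightarrow> real^'n^'n \<Rightarrow> real^'n^'n \<Rightarrow> real^('n::finite + 'n)^('n + 'n)" where
  "B_mat P Q R = block_mat
     (matrix_inv P) (- (matrix_inv P ** Q))
     (- (transpose Q ** matrix_inv P)) (transpose Q ** matrix_inv P ** Q - R)"

definition fundamental_solution ::
  "real \<Rightarrow> (real \<Rightarrow> real^('n::finite + 'n)^('n + 'n)) \<Rightarrow> (real \<Rightarrow> complex^('n + 'n)^('n + 'n)) \<Rightarrow> bool"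
  where
  "fundamental_solution T B \<gamma> \<longleftrightarrow> \<gamma> 0 = mat 1 \<and>
     (\<forall>t\<in>{0..T}. (\<gamma> has_vector_derivative J_mat ** cmat (B t) ** \<gamma> t) (at t within {0..T}))"

section \<open>The linearized operator and its Morse index\<close>

definition square_integrable :: "real \<Rightarrow> (real \<Rightarrow> complex^'n) \<Rightarrow> bool" where
  "square_integrable T f \<longleftrightarrow>
     f \<in> borel_measurable (lebesgue_on {0..T}) \<and>
     integrable (lebesgue_on {0..T}) (\<lambda>t. (norm (f t))\<^sup>2)"

text \<open>
  \<open>f \<in> W\<^sup>1\<^sup>,\<^sup>2([0,T], \<complex>\<^sup>n)\<close>, given by its absolutely continuous representative, with weak derivative \<open>g\<close>.
  The boundary values \<open>f 0\<close> and \<open>f T\<close> are those of this representative.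
\<close>

definition has_W12_deriv :: "real \<Rightarrow> (real \<Rightarrow> complex^'n) \<Rightarrow> (real \<Rightarrow> complex^'n) \<Rightarrow> bool" where
  "has_W12_deriv T f g \<longleftrightarrow>
     square_integrable T g \<and> (\<forall>t\<in>{0..T}. f t = f 0 + integral {0..t} g)"

text \<open>
  \<open>linearization T P Q R \<Lambda> \<xi> f\<close> says that \<open>\<xi>\<close> lies in the domain of the self-adjoint operator
  \<open>\<A>\<close> with boundary condition \<open>\<Lambda>\<close> and that \<open>\<A>\<xi> = f\<close> almost everywhere; \<open>\<eta>\<close> is the weak derivative
  of \<open>\<xi>\<close>, and \<open>y\<close> the absolutely continuous representative of \<open>P\<eta> + Q\<xi>\<close>, with weak derivative \<open>y'\<close>.

  The domain is \<open>{\<xi> \<in> W\<^sup>1\<^sup>,\<^sup>2. P\<xi>' + Q\<xi> \<in> W\<^sup>1\<^sup>,\<^sup>2, (z 0, z T) \<in> \<Lambda>}\<close>. If \<open>P\<close> (pointwise invertible) and \<open>Q\<close> are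
  continuously differentiable, then \<open>P\<xi>' + Q\<xi> \<in> W\<^sup>1\<^sup>,\<^sup>2\<close> holds iff \<open>\<xi> \<in> W\<^sup>2\<^sup>,\<^sup>2\<close>. For a \<open>C\<^sup>2\<close> Lagrangian,
  \<open>P\<close> and \<open>Q\<close> are in general only continuous; \<open>(P\<xi>' + Q\<xi>)'\<close> then need not be a function for
  \<open>\<xi> \<in> W\<^sup>2\<^sup>,\<^sup>2\<close>, and the domain below is the one on which \<open>\<A>\<close> is self-adjoint.
\<close>

definition linearization ::
  "real \<Rightarrow> (real \<Rightarrow> real^'n^'n) \<Rightarrow> (real \<Rightarrow> real^'n^'n) \<Rightarrow> (real \<Rightarrow> real^'n^'n)
    \<Rightarrow> (complex^(('n::finite + 'n) + ('n + 'n))) set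
    \<Rightarrow> (real \<Rightarrow> complex^'n) \<Rightarrow> (real \<Rightarrow> complex^'n) \<Rightarrow> bool" where
  "linearization T P Q R \<Lambda> \<xi> f \<longleftrightarrow>
     (\<exists>\<eta> y y'. has_W12_deriv T \<xi> \<eta> \<and> has_W12_deriv T y y' \<and>
        (AE t in lebesgue_on {0..T}. y t = cmat (P t) *v \<eta> t + cmat (Q t) *v \<xi> t) \<and>
        vjoin (vjoin (y 0) (\<xi> 0)) (vjoin (y T) (\<xi> T)) \<in> \<Lambda> \<and>
        (AE t in lebesgue_on {0..T}.
            f t = - y' t + cmat (transpose (Q t)) *v \<eta> t + cmat (R t) *v \<xi> t))"

definition fun_scale :: "complex \<Rightarrow> (real \<Rightarrow> complex^'n) \<Rightarrow> real \<Rightarrow> complex^'n" where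
  "fun_scale c f = (\<lambda>t. c *s f t)"

lemma vector_space_fun_scale: "vector_space (fun_scale :: complex \<Rightarrow> (real \<Rightarrow> complex^'n) \<Rightarrow> _)"
  by unfold_locales (auto simp: fun_scale_def vec.scale_right_distrib vec.scale_left_distrib)

text \<open>
  Functions on \<open>[0,T]\<close> are encoded as functions on \<open>\<real>\<close> vanishing outside \<open>[0,T]\<close>, so that eigenspaces
  have the right dimension. The eigenvalues of the self-adjoint operator are real.
\<close>

definition eigenspace ::
  "real \<Rightarrow> (real \<Rightarrow> real^'n^'n) \<Rightarrow> (real \<Rightarrow> real^'n^'n) \<Rightarrow> (real \<Rightarrow> real^'n^'n)
    \<Rightarrow> (complex^(('n::finite + 'n) + ('n + 'n))) set \<Rightarrow> real \<Rightarrow> (real \<Rightarrow> complex^'n) set" where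
  "eigenspace T P Q R \<Lambda> l =
     {\<xi>. (\<forall>t. t \<notin> {0..T} \<longrightarrow> \<xi> t = 0) \<and>
         linearization T P Q R \<Lambda> \<xi> (fun_scale (complex_of_real l) \<xi>)}"

definition negative_eigenvalues ::
  "real \<Rightarrow> (real \<Rightarrow> real^'n^'n) \<Rightarrow> (real \<Rightarrow> real^'n^'n) \<Rightarrow> (real \<Rightarrow> real^'n^'n)
    \<Rightarrow> (complex^(('n::finite + 'n) + ('n + 'n))) set \<Rightarrow> real set" where
  "negative_eigenvalues T P Q R \<Lambda> = {l. l < 0 \<and> (\<exists>\<xi>\<in>eigenspace T P Q R \<Lambda> l. \<xi> \<noteq> 0)}"

text \<open>
  Negative eigenvalues are counted with multiplicity. As \<open>sum\<close> and \<open>dim\<close> return \<open>0\<close> in infinite cases,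
  \<open>morse_index\<close> is meaningful only together with \<open>finite_morse_index\<close>.
\<close>

definition finite_morse_index ::
  "real \<Rightarrow> (real \<Rightarrow> real^'n^'n) \<Rightarrow> (real \<Rightarrow> real^'n^'n) \<Rightarrow> (real \<Rightarrow> real^'n^'n)
    \<Rightarrow> (complex^(('n::finite + 'n) + ('n + 'n))) set \<Rightarrow> bool" where
  "finite_morse_index T P Q R \<Lambda> \<longleftrightarrow>
     finite (negative_eigenvalues T P Q R \<Lambda>) \<and>
     (\<forall>l\<in>negative_eigenvalues T P Q R \<Lambda>.
        \<exists>F. finite F \<and> eigenspace T P Q R \<Lambda> l \<subseteq> module.span fun_scale F)"

definition morse_index ::
  "real \<Rightarrow> (real \<Rightarrow> real^'n^'n) \<Rightarrow> (real \<Rightarrow> real^'n^'n) \<Rightarrow> (real \<Rightarrow> real^'n^'n)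
    \<Rightarrow> (complex^(('n::finite + 'n) + ('n + 'n))) set \<Rightarrow> nat" where
  "morse_index T P Q R \<Lambda> =
     (\<Sum>l\<in>negative_eigenvalues T P Q R \<Lambda>. vector_space.dim fun_scale (eigenspace T P Q R \<Lambda> l))"

end

theory Submission
  imports Defs
begin

text \<open>
  For real \<open>l\<close> let \<open>\<gamma>\<^sub>l\<close> be the fundamental solution of the system with \<open>R\<close> replaced by \<open>R - l\<close>. The eigenspace
  of \<open>\<A>\<close> for \<open>l\<close> under the boundary condition \<open>\<Lambda>\<close> is isomorphic to \<open>Gr (\<gamma>\<^sub>l T) \<inter> \<Lambda>\<close>, so that the Morse index
  counts the crossings of the path \<open>l \<mapsto> Gr (\<gamma>\<^sub>l T)\<close> with \<open>\<Lambda>\<close> for \<open>l < 0\<close>. This path is strictly monotone, because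
  \<open>\<omega>\<^sub>2 (u, \<gamma>\<^sub>l u) (v, \<gamma>\<^sub>m v) = (m - l) \<integral> \<langle>\<xi>\<^sub>l, \<xi>\<^sub>m\<rangle>\<close> with \<open>\<xi>\<^sub>l\<close> the second component of \<open>\<gamma>\<^sub>l u\<close>. Near a given \<open>l\<^sub>0\<close> all
  Lagrangian subspaces involved are transversal to a single \<open>Gr (\<gamma>\<^sub>m T)\<close>; in the corresponding chart they become
  Hermitian forms, and \<open>i(\<alpha>, \<beta>, \<kappa>) = n(\<alpha> - \<beta>) - n(\<alpha> - \<kappa>) + n(\<beta> - \<kappa>)\<close>, where \<open>n\<close> is the negative index. Hence
  \<open>l \<mapsto> i(Gr (\<gamma>\<^sub>l T), \<Lambda>\<^sub>0, \<Lambda>\<^sub>D)\<close> is continuous from the left and jumps at \<open>l\<close> by the difference of the dimensions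
  of the two intersections. For very negative \<open>l\<close> the energy is coercive, which excludes crossings and makes
  the triple index vanish; summing the jumps over \<open>l < 0\<close> gives the theorem.
\<close>

section \<open>Hermitian forms on subspaces\<close>

text \<open>The Lagrange identity is used in integrated form and for two different parameters l and
  m. Dividing by m - l gives a continuous function \<open>g\<close> that plays the part of the
  crossing form, so isolation of crossings and the jumps of inertia are read off from compactness.
  The same identity supplies the chart: graphs with m close to l0 but different from it are
  transversal to any given Lagrangian subspace, so the reference point is taken from the path
  itself. The inertia formula for the triple index has to hold with all intersections possibly
  nontrivial; it comes from one inequality, applied to w and to -w, and a dimension count that makes
  both sharp. Continuity from the left is what fits the strict condition l < 0: a zero eigenvalue
  enters neither Morse index, and the value of the triple index at l = 0 itself is the one in the
  theorem.\<close>

lemma vec_dim_disjoint_le: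
  fixes S U V :: "('a::field^'m) set"
  assumes "vec.subspace S" "vec.subspace U" "S \<subseteq> V" "U \<subseteq> V" "vec.subspace V" "S \<inter> U \<subseteq> {0}"
  shows "vec.dim S + vec.dim U \<le> vec.dim V"
proof -
  have "vec.dim (S \<inter> U) = 0" using assms(6) vec.dim_eq_0 by blast
  then have "vec.dim S + vec.dim U = vec.dim {x + y |x y. x \<in> S \<and> y \<in> U}"
    using vec.dim_sums_Int[OF assms(1,2)] by linarith
  also have "\<dots> \<le> vec.dim V"
    by (rule vec.dim_subset) (use assms in \<open>auto intro: vec.subspace_add\<close>)
  finally show ?thesis .
qed

text \<open>The axioms are relative to \<open>V\<close> because the triple form is a definite
  description with a meaningful value only on its domain; with \<open>V = UNIV\<close> the same
  locale serves for forms on the whole space.\<close>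

locale herm_form =
  fixes V :: "(complex^'m) set" and q :: "complex^'m \<Rightarrow> complex^'m \<Rightarrow> complex"
  assumes sub: "vec.subspace V"
    and add_left: "x \<in> V \<Longrightarrow> y \<in> V \<Longrightarrow> z \<in> V \<Longrightarrow> q (x + y) z = q x z + q y z"
    and scale_left: "x \<in> V \<Longrightarrow> y \<in> V \<Longrightarrow> q (c *s x) y = c * q x y"
    and herm: "x \<in> V \<Longrightarrow> y \<in> V \<Longrightarrow> q y x = cnj (q x y)"
begin

lemma add_right: "x \<in> V \<Longrightarrow> y \<in> V \<Longrightarrow> z \<in> V \<Longrightarrow> q z (x + y) = q z x + q z y"
  by (metis herm add_left complex_cnj_add vec.subspace_add[OF sub])

lemma scale_right: "x \<in> V \<Longrightarrow> y \<in> V \<Longrightarrow> q x (c *s y) = cnj c * q x y"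
  by (metis herm scale_left complex_cnj_mult vec.subspace_scale[OF sub])

lemma zero_left: "x \<in> V \<Longrightarrow> q 0 x = 0"
  using scale_left[of x x 0] by simp

lemma zero_right: "x \<in> V \<Longrightarrow> q x 0 = 0"
  using scale_right[of x x 0] by simp

lemma diag_real: "x \<in> V \<Longrightarrow> q x x = of_real (Re (q x x))"
  using herm[of x x] by (metis Reals_cnj_iff of_real_Re)

lemma subform: "vec.subspace W \<Longrightarrow> W \<subseteq> V \<Longrightarrow> herm_form W q"
  by unfold_locales (auto simp: subset_iff add_left scale_left intro: herm)

lemma uminus: "herm_form V (\<lambda>x y. - q x y)"
  by unfold_locales (auto simp: sub add_left scale_left intro: herm)

definition rad :: "(complex^'m) set" where
  "rad = {x \<in> V. \<forall>y\<in>V. q x y = 0}"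

lemma subspace_rad: "vec.subspace rad"
  unfolding rad_def vec.subspace_def
  using sub by (auto simp: vec.subspace_def zero_left add_left scale_left)

text \<open>The values at x + y and x + i y give the sum and the difference of q x y and q y x, and
  both vanish.\<close>

lemma polarization:
  assumes "\<And>x. x \<in> V \<Longrightarrow> q x x = 0" "x \<in> V" "y \<in> V"
  shows "q x y = 0"
proof -
  have "q (x + y) (x + y) = 0" "q (x + \<i> *s y) (x + \<i> *s y) = 0"
    using assms sub by (auto intro!: assms(1) vec.subspace_add vec.subspace_scale)
  moreover have "q x x = 0" "q y y = 0" using assms by auto
  ultimately have "q x y + q y x = 0" "- \<i> * q x y + \<i> * q y x = 0"
    using assms(2,3) sub by (simp_all add: add_left add_right scale_left scale_right
        vec.subspace_add vec.subspace_scale)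
  then have "\<i> * (q x y + q y x) = 0" "- \<i> * q x y + \<i> * q y x = 0" by simp_all
  then have "\<i> * (2 * q x y) = 0" by (simp add: algebra_simps)
  then show ?thesis by simp
qed

end

definition orth_basis ::
  "(complex^'m) set \<Rightarrow> (complex^'m \<Rightarrow> complex^'m \<Rightarrow> complex) \<Rightarrow> (complex^'m) set \<Rightarrow> bool" where
  "orth_basis V q B \<longleftrightarrow> vec.independent B \<and> vec.span B = V \<and>
     (\<forall>b\<in>B. \<forall>c\<in>B. b \<noteq> c \<longrightarrow> q b c = 0)"

text \<open>Gram-Schmidt without normalisation, by induction on the dimension: split off a vector e
  with q e e \<noteq> 0 and continue on its orthogonal complement; if there is no such e,
  polarization makes the form zero and any basis will do.\<close>

lemma orth_basis_exists:
  assumes "herm_form V q"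
  shows "\<exists>B. orth_basis V q B"
  using assms
proof (induction "vec.dim V" arbitrary: V rule: less_induct)
  case less
  interpret herm_form V q by fact
  show ?case
  proof (cases "\<exists>e\<in>V. q e e \<noteq> 0")
    case True
    then obtain e where e: "e \<in> V" "q e e \<noteq> 0" by blast
    define W where "W = {x\<in>V. q x e = 0}"
    have W: "vec.subspace W"
      unfolding W_def vec.subspace_def using sub e
      by (auto simp: vec.subspace_def zero_left add_left scale_left)
    have "e \<notin> W" "W \<subseteq> V" using e by (auto simp: W_def)
    then have "vec.span W \<subset> vec.span V"
      by (metis W e(1) psubsetI sub vec.span_eq_iff)
    then have "vec.dim W < vec.dim V" by (rule vec.dim_psubset)
    then obtain B where B: "orth_basis W q B"
      using less(1) subform[OF W \<open>W \<subseteq> V\<close>] by blast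
    have "x \<in> vec.span (insert e B)" if "x \<in> V" for x
    proof -
      let ?c = "q x e / q e e"
      have "- (?c *s e) \<in> V"
        using that e sub by (intro vec.subspace_neg vec.subspace_scale) auto
      then have "x - ?c *s e \<in> V" "q (x - ?c *s e) e = q x e + q (- (?c *s e)) e"
        using that e sub add_left[of x "- (?c *s e)" e]
        by (auto intro!: vec.subspace_diff vec.subspace_scale)
      moreover have "q (- (?c *s e)) e = - ?c * q e e"
        using scale_left[of e e "- ?c"] e by (simp add: vec.scale_minus_left)
      ultimately have "x - ?c *s e \<in> W" using e by (simp add: W_def)
      then have "x - ?c *s e \<in> vec.span B" using B by (simp add: orth_basis_def)
      then show ?thesis using vec.span_breakdown_eq by blast
    qed
    moreover have "insert e B \<subseteq> V"
      using B e \<open>W \<subseteq> V\<close> vec.span_superset by (auto simp: orth_basis_def)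
    ultimately have "vec.span (insert e B) = V"
      using sub vec.span_minimal by blast
    moreover have "vec.independent (insert e B)"
      using B \<open>e \<notin> W\<close> by (auto simp: orth_basis_def vec.independent_insert)
    moreover have "q b e = 0" "q e b = 0" if "b \<in> B" for b
    proof -
      have "b \<in> W" using that B vec.span_base by (auto simp: orth_basis_def)
      then show "q b e = 0" "q e b = 0" using herm[of b e] e by (auto simp: W_def)
    qed
    ultimately have "orth_basis V q (insert e B)"
      using B by (auto simp: orth_basis_def)
    then show ?thesis by blast
  next
    case False
    then have "q x y = 0" if "x \<in> V" "y \<in> V" for x y
      using polarization that by blast
    moreover obtain B where "B \<subseteq> V" "vec.independent B" "vec.span B = V"
      using vec.basis_exists[of V] vec.span_minimal[OF _ sub] by (metis subset_antisym)
    ultimately have "orth_basis V q B" by (auto simp: orth_basis_def)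
    then show ?thesis by blast
  qed
qed

locale herm_basis = herm_form +
  fixes B
  assumes ob: "orth_basis V q B"
begin

lemma finB: "finite B"
  using ob vec.finiteI_independent by (auto simp: orth_basis_def)

lemma dimV: "vec.dim V = card B"
  using ob vec.dim_span_eq_card_independent by (auto simp: orth_basis_def)

lemma BV: "B \<subseteq> V"
  using ob vec.span_superset by (auto simp: orth_basis_def)

lemma dim_span_sub: "C \<subseteq> B \<Longrightarrow> vec.dim (vec.span C) = card C"
  using ob vec.dim_span_eq_card_independent vec.independent_mono by (auto simp: orth_basis_def)

lemma span_subV: "C \<subseteq> B \<Longrightarrow> vec.span C \<subseteq> V"
  using ob vec.span_mono by (auto simp: orth_basis_def)

lemma sum_left:
  "finite C \<Longrightarrow> C \<subseteq> B \<Longrightarrow> y \<in> V \<Longrightarrow> q (\<Sum>b\<in>C. u b *s b) y = (\<Sum>b\<in>C. u b * q b y)"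
proof (induction C rule: finite_induct)
  case (insert c C)
  have "(\<Sum>b\<in>C. u b *s b) \<in> V" "u c *s c \<in> V" "c \<in> V"
    using insert sub BV by (auto intro!: vec.subspace_sum vec.subspace_scale)
  then show ?case using insert by (simp add: add_left scale_left)
qed (simp add: zero_left)

lemma sum_right:
  "finite C \<Longrightarrow> C \<subseteq> B \<Longrightarrow> y \<in> V \<Longrightarrow> q y (\<Sum>b\<in>C. u b *s b) = (\<Sum>b\<in>C. cnj (u b) * q y b)"
proof (induction C rule: finite_induct)
  case (insert c C)
  have "(\<Sum>b\<in>C. u b *s b) \<in> V" "u c *s c \<in> V" "c \<in> V"
    using insert sub BV by (auto intro!: vec.subspace_sum vec.subspace_scale)
  then show ?case using insert by (simp add: add_right scale_right)
qed (simp add: zero_right)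

lemma diag_expand:
  assumes "C \<subseteq> B"
  shows "Re (q (\<Sum>b\<in>C. u b *s b) (\<Sum>b\<in>C. u b *s b)) = (\<Sum>b\<in>C. (cmod (u b))\<^sup>2 * Re (q b b))"
proof -
  have fin: "finite C" using assms finB finite_subset by blast
  have CV: "c \<in> V" if "c \<in> C" for c using that assms BV by auto
  have V: "(\<Sum>b\<in>C. u b *s b) \<in> V"
    using CV sub by (auto intro!: vec.subspace_sum vec.subspace_scale)
  have "q b (\<Sum>c\<in>C. u c *s c) = cnj (u b) * q b b" if "b \<in> C" for b
  proof -
    have "q b (\<Sum>c\<in>C. u c *s c) = (\<Sum>c\<in>C. cnj (u c) * q b c)"
      using sum_right[OF fin assms] CV that by auto
    also have "\<dots> = (\<Sum>c\<in>C. if c = b then cnj (u b) * q b b else 0)"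
      using ob that assms by (intro sum.cong) (auto simp: orth_basis_def subset_iff)
    finally show ?thesis using fin that by simp
  qed
  then have "q (\<Sum>b\<in>C. u b *s b) (\<Sum>b\<in>C. u b *s b) = (\<Sum>b\<in>C. u b * (cnj (u b) * q b b))"
    using sum_left[OF fin assms V] by simp
  also have "\<dots> = (\<Sum>b\<in>C. of_real ((cmod (u b))\<^sup>2 * Re (q b b)))"
    by (intro sum.cong refl) (metis CV complex_norm_square diag_real mult.assoc of_real_mult)
  finally show ?thesis by simp
qed

lemma span_cases:
  assumes "C \<subseteq> B" "x \<in> vec.span C"
  obtains u where "x = (\<Sum>b\<in>C. u b *s b)"
  using assms(2) vec.span_finite[of C] finite_subset[OF assms(1) finB] by auto

lemma span_pos:
  assumes "C \<subseteq> B" "\<And>b. b \<in> C \<Longrightarrow> Re (q b b) > 0" "x \<in> vec.span C" "x \<noteq> 0"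
  shows "Re (q x x) > 0"
proof -
  obtain u where x: "x = (\<Sum>b\<in>C. u b *s b)" using span_cases assms by blast
  have "\<exists>c\<in>C. u c \<noteq> 0"
  proof (rule ccontr)
    assume "\<not> ?thesis"
    then have "x = 0" unfolding x by (intro sum.neutral) auto
    then show False using assms(4) by simp
  qed
  then obtain c where "c \<in> C" "u c \<noteq> 0" by blast
  then show ?thesis unfolding x diag_expand[OF assms(1)]
    using assms(2) finite_subset[OF assms(1) finB]
    by (intro sum_pos2[where i = c]) (auto simp: less_imp_le)
qed

lemma span_nonpos:
  assumes "C \<subseteq> B" "\<And>b. b \<in> C \<Longrightarrow> Re (q b b) \<le> 0" "x \<in> vec.span C"
  shows "Re (q x x) \<le> 0"
proof -
  obtain u where x: "x = (\<Sum>b\<in>C. u b *s b)" using span_cases assms by blast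
  show ?thesis unfolding x diag_expand[OF assms(1)]
    using assms(2) by (intro sum_nonpos) (auto intro!: mult_nonneg_nonpos)
qed

text \<open>Testing a radical vector against a basis vector c isolates the coefficient of c, which
  must vanish unless q c c = 0.\<close>

lemma rad_span: "rad = vec.span {b\<in>B. Re (q b b) = 0}"
proof (intro equalityI subsetI)
  fix x assume x: "x \<in> rad"
  then have "x \<in> vec.span B" "x \<in> V" using ob by (auto simp: rad_def orth_basis_def)
  then obtain u where u: "x = (\<Sum>b\<in>B. u b *s b)" using span_cases by blast
  have "u c = 0" if "c \<in> B" "Re (q c c) \<noteq> 0" for c
  proof -
    have "q x c = (\<Sum>b\<in>B. u b * q b c)"
      unfolding u using sum_left[OF finB] BV that by auto
    also have "\<dots> = (\<Sum>b\<in>B. if b = c then u c * q c c else 0)"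
      using ob that by (intro sum.cong) (auto simp: orth_basis_def)
    also have "\<dots> = u c * q c c" using finB that by simp
    finally have "u c * q c c = 0" using x that BV by (auto simp: rad_def)
    then show ?thesis using that by auto
  qed
  then have "x = (\<Sum>b\<in>{b\<in>B. Re (q b b) = 0}. u b *s b)"
    unfolding u by (intro sum.mono_neutral_right) (auto simp: finB)
  also have "\<dots> \<in> vec.span {b\<in>B. Re (q b b) = 0}"
    by (intro vec.span_sum vec.span_scale vec.span_base)
  finally show "x \<in> vec.span {b\<in>B. Re (q b b) = 0}" .
next
  have "{b\<in>B. Re (q b b) = 0} \<subseteq> rad"
  proof
    fix b assume b: "b \<in> {b\<in>B. Re (q b b) = 0}"
    then have "q b b = of_real (Re (q b b))" "Re (q b b) = 0" using diag_real[of b] BV by auto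
    then have bb: "q b b = 0" by (metis of_real_0)
    have "q b y = 0" if yV: "y \<in> V" for y
    proof -
      have "y \<in> vec.span B" using yV ob by (simp add: orth_basis_def)
      then obtain u where u: "y = (\<Sum>b\<in>B. u b *s b)"
        by (rule span_cases[OF order_refl])
      have "q b c = 0" if "c \<in> B" for c
        using that b bb ob by (cases "c = b") (auto simp: orth_basis_def)
      then show ?thesis
        unfolding u using sum_right[OF finB order_refl, of b u] b BV by auto
    qed
    then show "b \<in> rad" using b BV by (auto simp: rad_def)
  qed
  then show "x \<in> rad" if "x \<in> vec.span {b\<in>B. Re (q b b) = 0}" for x
    using that subspace_rad vec.span_minimal by blast
qed

text \<open>In the diagonal expansion every term is nonpositive, so a nonnegative total kills each
  of them and leaves only null basis vectors, which span the radical.\<close>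

lemma nonpos_null_rad:
  assumes "x \<in> vec.span {b\<in>B. Re (q b b) \<le> 0}" "Re (q x x) \<ge> 0"
  shows "x \<in> rad"
proof -
  let ?C = "{b\<in>B. Re (q b b) \<le> 0}"
  have CB: "?C \<subseteq> B" by auto
  obtain u where u: "x = (\<Sum>b\<in>?C. u b *s b)" using span_cases[OF CB assms(1)] by blast
  have "(\<Sum>b\<in>?C. - ((cmod (u b))\<^sup>2 * Re (q b b))) \<le> 0"
    using assms(2) unfolding u diag_expand[OF CB] by (simp add: sum_negf)
  moreover have nn: "- ((cmod (u b))\<^sup>2 * Re (q b b)) \<ge> 0" if "b \<in> ?C" for b
    using that by (simp add: mult_nonneg_nonpos)
  moreover have "finite ?C" using finB by simp
  ultimately have "\<forall>b\<in>?C. - ((cmod (u b))\<^sup>2 * Re (q b b)) = 0"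
    by (metis (no_types, lifting) antisym sum_nonneg sum_nonneg_eq_0_iff)
  then have "u b = 0" if "b \<in> ?C" "Re (q b b) \<noteq> 0" for b using that by auto
  then have "x = (\<Sum>b\<in>{b\<in>B. Re (q b b) = 0}. u b *s b)"
    unfolding u by (intro sum.mono_neutral_right) (auto simp: finB)
  also have "\<dots> \<in> vec.span {b\<in>B. Re (q b b) = 0}"
    by (intro vec.span_sum vec.span_scale vec.span_base)
  finally show ?thesis by (simp add: rad_span)
qed

text \<open>Such a \<open>W\<close> meets the span of the nonpositive basis vectors only in 0, by
  \<open>nonpos_null_rad\<close>, so it has at most the complementary dimension.\<close>

lemma dim_nonneg_le:
  assumes "vec.subspace W" "W \<subseteq> V" "\<And>x. x \<in> W \<Longrightarrow> Re (q x x) \<ge> 0" "W \<inter> rad \<subseteq> {0}"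
  shows "vec.dim W \<le> card {b\<in>B. Re (q b b) > 0}"
proof -
  let ?C = "{b\<in>B. Re (q b b) \<le> 0}"
  have "W \<inter> vec.span ?C \<subseteq> {0}" using nonpos_null_rad assms by blast
  then have "vec.dim W + vec.dim (vec.span ?C) \<le> vec.dim V"
    using assms sub span_subV[of ?C] by (intro vec_dim_disjoint_le) auto
  moreover have "vec.dim (vec.span ?C) = card ?C" by (intro dim_span_sub) auto
  moreover have "card B = card {b\<in>B. Re (q b b) > 0} + card ?C"
    using finB by (subst card_Un_disjoint[symmetric]) (auto intro!: arg_cong[where f = card])
  ultimately show ?thesis by (simp add: dimV)
qed

text \<open>Sylvester's law of inertia. The bound also shows that the set under \<open>Max\<close>
  is finite, which is what gives \<open>Max\<close> its meaning.\<close>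

lemma pos_index_card: "pos_index V q = card {b\<in>B. Re (q b b) > 0}"
  unfolding pos_index_def
proof (rule Max_eqI)
  let ?S = "{vec.dim W |W. vec.subspace W \<and> W \<subseteq> V \<and> (\<forall>w\<in>W. w \<noteq> 0 \<longrightarrow> 0 < Re (q w w))}"
  have *: "W \<inter> rad \<subseteq> {0}" if "\<forall>w\<in>W. w \<noteq> 0 \<longrightarrow> 0 < Re (q w w)" for W
    using that unfolding rad_def by force
  have **: "Re (q w w) \<ge> 0" if "\<forall>w\<in>W. w \<noteq> 0 \<longrightarrow> 0 < Re (q w w)" "w \<in> W" "W \<subseteq> V" for w W
    using that zero_left[of 0] by (cases "w = 0") (auto simp: less_imp_le)
  show le: "y \<le> card {b\<in>B. Re (q b b) > 0}" if yS: "y \<in> ?S" for y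
  proof -
    obtain W where "y = vec.dim W" "vec.subspace W" "W \<subseteq> V" "\<forall>w\<in>W. w \<noteq> 0 \<longrightarrow> 0 < Re (q w w)"
      using yS by auto
    then show ?thesis using dim_nonneg_le[of W] * ** by blast
  qed
  then show "finite ?S" by (meson atMost_iff finite_atMost finite_subset subsetI)
  let ?W = "vec.span {b\<in>B. Re (q b b) > 0}"
  have "vec.dim ?W = card {b\<in>B. Re (q b b) > 0}" by (intro dim_span_sub) auto
  moreover have "?W \<subseteq> V" by (intro span_subV) auto
  moreover have "Re (q w w) > 0" if "w \<in> ?W" "w \<noteq> 0" for w
    by (rule span_pos[OF _ _ that]) auto
  ultimately show "card {b\<in>B. Re (q b b) > 0} \<in> ?S"
    by (intro CollectI exI[of _ ?W]) auto
qed

end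

context herm_form
begin

lemma obtain_basis: obtains B where "herm_basis V q B"
  using orth_basis_exists[OF herm_form_axioms] herm_form_axioms
  by (meson herm_basis.intro herm_basis_axioms.intro)

definition neg_index :: nat where "neg_index = pos_index V (\<lambda>x y. - q x y)"

text \<open>One orthogonal basis diagonalises both q and -q; the signs of its diagonal values
  partition it.\<close>

lemma index_sum: "pos_index V q + neg_index + vec.dim rad = vec.dim V"
proof -
  obtain B where B: "herm_basis V q B" by (rule obtain_basis)
  interpret b: herm_basis V q B by fact
  have "orth_basis V (\<lambda>x y. - q x y) B" using b.ob by (auto simp: orth_basis_def)
  then interpret m: herm_basis V "\<lambda>x y. - q x y" B
    using uminus by (intro herm_basis.intro herm_basis_axioms.intro)
  have "card B = card {b\<in>B. Re (q b b) > 0} + card {b\<in>B. Re (q b b) < 0} + card {b\<in>B. Re (q b b) = 0}"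
    using b.finB by (subst card_Un_disjoint[symmetric], auto)+ (auto intro!: arg_cong[where f = card])
  moreover have "vec.dim rad = card {b\<in>B. Re (q b b) = 0}"
    unfolding b.rad_span by (intro b.dim_span_sub) auto
  ultimately show ?thesis
    using m.pos_index_card by (simp add: neg_index_def b.pos_index_card b.dimV)
qed

lemma dim_nonneg_le_pos_index:
  assumes "vec.subspace W" "W \<subseteq> V" "\<And>x. x \<in> W \<Longrightarrow> Re (q x x) \<ge> 0" "W \<inter> rad \<subseteq> {0}"
  shows "vec.dim W \<le> pos_index V q"
proof -
  obtain B where "herm_basis V q B" by (rule obtain_basis)
  then interpret b: herm_basis V q B .
  show ?thesis unfolding b.pos_index_card using assms by (intro b.dim_nonneg_le) auto
qed

lemma pos_subspace:
  "\<exists>W. vec.subspace W \<and> W \<subseteq> V \<and> vec.dim W = pos_index V q \<and>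
    (\<forall>x\<in>W. x \<noteq> 0 \<longrightarrow> Re (q x x) > 0)"
proof -
  obtain B where "herm_basis V q B" by (rule obtain_basis)
  then interpret b: herm_basis V q B .
  let ?C = "{b\<in>B. Re (q b b) > 0}"
  have "vec.dim (vec.span ?C) = pos_index V q"
    unfolding b.pos_index_card by (intro b.dim_span_sub) auto
  moreover have "Re (q x x) > 0" if "x \<in> vec.span ?C" "x \<noteq> 0" for x
    by (rule b.span_pos[OF _ _ that]) auto
  moreover have "vec.span ?C \<subseteq> V" by (rule b.span_subV) auto
  ultimately show ?thesis using vec.subspace_span[of ?C] by blast
qed

text \<open>Counterpart of a maximal positive subspace, with the equality case: a null vector of
  \<open>U\<close> lies in the radical. This is the form in which inertia enters the dimension count
  of \<open>chart_triple_le\<close>.\<close>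

lemma nonpos_subspace:
  "\<exists>U. vec.subspace U \<and> U \<subseteq> V \<and> vec.dim U + pos_index V q = vec.dim V \<and>
    (\<forall>x\<in>U. Re (q x x) \<le> 0 \<and> (Re (q x x) = 0 \<longrightarrow> x \<in> rad))"
proof -
  obtain B where "herm_basis V q B" by (rule obtain_basis)
  then interpret b: herm_basis V q B .
  let ?C = "{b\<in>B. Re (q b b) \<le> 0}"
  have "vec.dim (vec.span ?C) = card ?C" by (intro b.dim_span_sub) auto
  moreover have "card B = card {b\<in>B. Re (q b b) > 0} + card ?C"
    using b.finB by (subst card_Un_disjoint[symmetric]) (auto intro!: arg_cong[where f = card])
  ultimately have "vec.dim (vec.span ?C) + pos_index V q = vec.dim V"
    by (simp add: b.dimV b.pos_index_card)
  moreover have "Re (q x x) \<le> 0" if "x \<in> vec.span ?C" for x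
    by (rule b.span_nonpos[OF _ _ that]) auto
  moreover have "x \<in> rad" if "x \<in> vec.span ?C" "Re (q x x) = 0" for x
    by (rule b.nonpos_null_rad) (use that in auto)
  moreover have "vec.span ?C \<subseteq> V" by (rule b.span_subV) auto
  ultimately show ?thesis using vec.subspace_span[of ?C] by blast
qed

end

section \<open>Lagrangian subspaces and the triple index\<close>

lemma pos_index_cong:
  assumes "\<And>x. x \<in> V \<Longrightarrow> q x x = q' x x"
  shows "pos_index V q = pos_index V q'"
  unfolding pos_index_def using assms by (intro arg_cong[where f = Max]) (auto simp: subset_iff)

lemma dim_kernel_functional:
  fixes \<phi> :: "'a::field^'m \<Rightarrow> 'a"
  assumes U: "vec.subspace U" and add: "\<And>x y. \<phi> (x + y) = \<phi> x + \<phi> y"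
    and scale: "\<And>c x. \<phi> (c *s x) = c * \<phi> x"
  shows "vec.dim U \<le> vec.dim {x\<in>U. \<phi> x = 0} + 1"
proof (cases "\<exists>e\<in>U. \<phi> e \<noteq> 0")
  case True
  then obtain e where e: "e \<in> U" "\<phi> e \<noteq> 0" by blast
  let ?K = "{x\<in>U. \<phi> x = 0}"
  have "U \<subseteq> vec.span (insert e ?K)"
  proof
    fix x assume x: "x \<in> U"
    have "\<phi> (x + (- (\<phi> x / \<phi> e)) *s e) = 0" unfolding add scale using e by simp
    then have "x - (\<phi> x / \<phi> e) *s e \<in> ?K"
      using x e U by (simp add: vec.subspace_diff vec.subspace_scale vec.scale_minus_left)
    then show "x \<in> vec.span (insert e ?K)"
      unfolding vec.span_breakdown_eq by (intro exI[of _ "\<phi> x / \<phi> e"] vec.span_base)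
  qed
  then have "vec.dim U \<le> vec.dim (insert e ?K)" by (rule vec.dim_mono)
  also have "\<dots> \<le> vec.dim ?K + 1" by (simp add: vec.dim_insert)
  finally show ?thesis .
next
  case False
  then have "{x\<in>U. \<phi> x = 0} = U" by auto
  then show ?thesis by simp
qed

text \<open>A skew-Hermitian form, linear in its first argument. It is kept abstract so that the
  results apply to -w as well, which exchanges positive and negative indices.\<close>

locale symp =
  fixes w :: "complex^'v \<Rightarrow> complex^'v \<Rightarrow> complex"
  assumes add_left: "w (x + y) z = w x z + w y z"
    and scale_left: "w (c *s x) y = c * w x y"
    and skew: "w y x = - cnj (w x y)"
    and nondeg: "(\<And>y. w x y = 0) \<Longrightarrow> x = 0"
begin

lemma add_right: "w z (x + y) = w z x + w z y"
  using skew[where y = z and x = "x + y"] skew[where y = z and x = x] skew[where y = z and x = y]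
  by (simp add: add_left)

lemma scale_right: "w x (c *s y) = cnj c * w x y"
  using skew[where y = x and x = "c *s y"] skew[where y = x and x = y] by (simp add: scale_left)

lemma zero_left [simp]: "w 0 x = 0"
  using scale_left[of 0 x x] by simp

lemma zero_right [simp]: "w x 0 = 0"
  using scale_right[of x 0 x] by simp

lemma minus_left: "w (- x) y = - w x y"
  using scale_left[of "-1" x y] by (simp add: vec.scale_minus_left)

lemma minus_right: "w x (- y) = - w x y"
  using scale_right[of x "-1" y] by (simp add: vec.scale_minus_left)

lemma diff_left: "w (x - y) z = w x z - w y z"
  using add_left[of x "- y" z] by (simp add: minus_left)

lemma diff_right: "w z (x - y) = w z x - w z y"
  using add_right[of z x "- y"] by (simp add: minus_right)

lemma symp_uminus: "symp (\<lambda>x y. - w x y)"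
proof
  show "x = 0" if "\<And>y. - w x y = 0" for x using nondeg[of x] that by simp
qed (auto simp: add_left scale_left intro: skew[THEN arg_cong[where f = uminus], simplified])

definition ann :: "(complex^'v) set \<Rightarrow> (complex^'v) set" where
  "ann S = {x. \<forall>s\<in>S. w x s = 0}"

lemma subspace_ann: "vec.subspace (ann S)"
  by (auto simp: ann_def vec.subspace_def add_left scale_left)

lemma ann_sym: "x \<in> ann S \<Longrightarrow> s \<in> S \<Longrightarrow> w s x = 0"
  using skew[where y = s and x = x] by (simp add: ann_def)

lemma ann_span: "ann (vec.span S) = ann S"
proof (intro equalityI subsetI)
  fix x assume x: "x \<in> ann S"
  have "w x s = 0" if "s \<in> vec.span S" for s
    using that
  proof (induction rule: vec.span_induct_alt)
    case (step c a y) then show ?case using x by (simp add: ann_def add_right scale_right)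
  qed simp
  then show "x \<in> ann (vec.span S)" by (simp add: ann_def)
qed (auto simp: ann_def vec.span_base)

lemma dim_ann_ge: "finite B \<Longrightarrow> CARD('v) \<le> vec.dim (ann B) + card B"
proof (induction B rule: finite_induct)
  case empty
  have "ann {} = UNIV" by (simp add: ann_def)
  then show ?case by (simp only: vec_dim_card card.empty)
next
  case (insert b B)
  have "ann (insert b B) = {x \<in> ann B. w x b = 0}" by (auto simp: ann_def)
  then have "vec.dim (ann B) \<le> vec.dim (ann (insert b B)) + 1"
    using dim_kernel_functional[OF subspace_ann, of "\<lambda>x. w x b" B]
    by (simp add: add_left scale_left)
  then show ?case using insert by simp
qed

text \<open>\<open>dim_ann_ge\<close> bounds from below both the annihilator of S and that of a
  complement of S; by nondegeneracy the two meet only in 0, and the dimension of the whole space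
  forces equality.\<close>

lemma dim_ann:
  assumes "vec.subspace S"
  shows "vec.dim (ann S) + vec.dim S = CARD('v)"
proof -
  obtain B where B: "B \<subseteq> S" "vec.independent B" "S \<subseteq> vec.span B" "card B = vec.dim S"
    by (rule vec.basis_exists)
  let ?E = "vec.extend_basis B"
  have E: "B \<subseteq> ?E" "vec.independent ?E" "vec.span ?E = UNIV"
    using vec.extend_basis_superset[OF B(2)] vec.independent_extend_basis[OF B(2)]
      vec.span_extend_basis[OF B(2)] by auto
  have fin: "finite ?E" by (rule vec.finiteI_independent[OF E(2)])
  then have finB: "finite B" by (rule finite_subset[OF E(1)])
  have S: "vec.span B = S" using B assms vec.span_minimal by blast
  have "CARD('v) \<le> vec.dim (ann S) + vec.dim S"
    using dim_ann_ge[OF finB] ann_span[of B] S B by simp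
  moreover have "CARD('v) \<le> vec.dim (ann (?E - B)) + card (?E - B)"
    using dim_ann_ge fin by blast
  moreover have "card (?E - B) = CARD('v) - vec.dim S" "vec.dim S \<le> CARD('v)"
  proof -
    have "card ?E = CARD('v)"
      using E vec.dim_span_eq_card_independent[OF E(2)] by (simp only: vec_dim_card)
    moreover have "card B \<le> card ?E" using fin E(1) by (rule card_mono)
    ultimately show "card (?E - B) = CARD('v) - vec.dim S" "vec.dim S \<le> CARD('v)"
      using card_Diff_subset[OF finB E(1)] B(4) by simp_all
  qed
  moreover have "vec.dim (ann S) + vec.dim (ann (?E - B)) \<le> vec.dim (UNIV :: (complex^'v) set)"
  proof (rule vec_dim_disjoint_le)
    show "ann S \<inter> ann (?E - B) \<subseteq> {0}"
    proof
      fix x assume x: "x \<in> ann S \<inter> ann (?E - B)"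
      then have "x \<in> ann ?E" using B(1) by (auto simp: ann_def)
      then have "x \<in> ann UNIV" using ann_span[of ?E] E by simp
      then show "x \<in> {0}" using nondeg[of x] by (simp add: ann_def)
    qed
  qed (auto simp: subspace_ann)
  ultimately show ?thesis unfolding vec_dim_card by linarith
qed

lemma ann_ann:
  assumes "vec.subspace S" shows "ann (ann S) = S"
proof -
  have "S \<subseteq> ann (ann S)" using ann_sym by (auto simp: ann_def)
  moreover have "vec.dim (ann (ann S)) = vec.dim S"
    using dim_ann[OF assms] dim_ann[OF subspace_ann[of S]] by linarith
  ultimately show ?thesis
    using vec.subspace_dim_equal[OF assms subspace_ann, of "ann S"] by simp
qed

lemma ann_plus:
  assumes "vec.subspace S" "vec.subspace U"
  shows "ann (plus_set S U) = ann S \<inter> ann U"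
proof -
  have "0 \<in> S" "0 \<in> U" using assms vec.subspace_0 by auto
  then have "S \<subseteq> plus_set S U" "U \<subseteq> plus_set S U"
    unfolding plus_set_def by (force, force)
  then have "ann (plus_set S U) \<subseteq> ann S \<inter> ann U" unfolding ann_def by blast
  then show ?thesis by (auto simp: ann_def plus_set_def add_right)
qed

lemma ann_lagrangian:
  assumes "lagrangian w S" shows "ann S = S"
proof -
  have S: "vec.subspace S" "S \<subseteq> ann S" "2 * vec.dim S = CARD('v)"
    using assms by (auto simp: lagrangian_def ann_def)
  then have "vec.dim (ann S) = vec.dim S" using dim_ann[OF S(1)] by linarith
  then show ?thesis using vec.subspace_dim_equal[OF S(1) subspace_ann S(2)] by simp
qed

text \<open>The annihilator of S + U is S \<inter> U, because S and U are their own annihilators;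
  now take annihilators once more.\<close>

lemma ann_int:
  assumes "lagrangian w S" "lagrangian w U"
  shows "ann (S \<inter> U) = plus_set S U"
proof -
  have s: "vec.subspace S" "vec.subspace U" using assms by (auto simp: lagrangian_def)
  have "vec.subspace (plus_set S U)"
    unfolding plus_set_def by (rule vec.subspace_sums[OF s])
  then show ?thesis
    using ann_plus[OF s] ann_ann ann_lagrangian assms by metis
qed

text \<open>The components of two decompositions of a vector differ by elements of \<beta> \<inter>
  \<kappa>, which pair to 0 with both subspaces.\<close>

lemma triple_form_eval:
  assumes "lagrangian w \<beta>" "lagrangian w \<kappa>" "y1 \<in> \<beta>" "z1 \<in> \<kappa>" "y2 \<in> \<beta>" "z2 \<in> \<kappa>"
  shows "triple_form w \<beta> \<kappa> (y1 + z1) (y2 + z2) = w y1 z2"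
proof -
  have *: "w u1 v2 = w y1 z2"
    if "u1 \<in> \<beta>" "v1 \<in> \<kappa>" "u2 \<in> \<beta>" "v2 \<in> \<kappa>" "y1 + z1 = u1 + v1" "y2 + z2 = u2 + v2" for u1 v1 u2 v2
  proof -
    have "y1 - u1 = v1 - z1" and e2: "z2 - v2 = u2 - y2"
      using that(5,6) by (metis add_diff_cancel diff_diff_eq2 diff_add_eq add.commute)+
    then have "y1 - u1 \<in> \<kappa>" "z2 - v2 \<in> \<beta>"
      using that assms by (simp_all add: lagrangian_def vec.subspace_diff)
    then have "w (y1 - u1) z2 = 0" "w u1 (z2 - v2) = 0"
      using assms that by (auto simp: lagrangian_def)
    then show ?thesis by (simp add: diff_left diff_right)
  qed
  show ?thesis
    unfolding triple_form_def
  proof (rule the_equality)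
    show "\<exists>y1a\<in>\<beta>. \<exists>z1a\<in>\<kappa>. \<exists>y2a\<in>\<beta>. \<exists>z2a\<in>\<kappa>. y1 + z1 = y1a + z1a \<and> y2 + z2 = y2a + z2a \<and> w y1 z2 = w y1a z2a"
      using assms by blast
  qed (use * in blast)
qed

text \<open>Hermitian symmetry is where \<alpha> enters: expanding w x y = 0 by the two
  decompositions leaves w x1 y2 + w x2 y1 = 0, and skewness turns this into conjugation.\<close>

lemma herm_triple_form:
  assumes "lagrangian w \<alpha>" "lagrangian w \<beta>" "lagrangian w \<kappa>"
  shows "herm_form (\<alpha> \<inter> plus_set \<beta> \<kappa>) (triple_form w \<beta> \<kappa>)"
proof
  note ev = triple_form_eval[OF assms(2,3)]
  have s: "vec.subspace \<alpha>" "vec.subspace \<beta>" "vec.subspace \<kappa>" using assms by (auto simp: lagrangian_def)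
  show "vec.subspace (\<alpha> \<inter> plus_set \<beta> \<kappa>)"
    using s vec.subspace_sums[OF s(2,3)] unfolding plus_set_def
    by (intro vec.subspace_inter) auto
  fix x y z assume x: "x \<in> \<alpha> \<inter> plus_set \<beta> \<kappa>" and y: "y \<in> \<alpha> \<inter> plus_set \<beta> \<kappa>"
  obtain x1 x2 where X: "x = x1 + x2" "x1 \<in> \<beta>" "x2 \<in> \<kappa>" using x by (auto simp: plus_set_def)
  obtain y1 y2 where Y: "y = y1 + y2" "y1 \<in> \<beta>" "y2 \<in> \<kappa>" using y by (auto simp: plus_set_def)
  show "triple_form w \<beta> \<kappa> (c *s x) y = c * triple_form w \<beta> \<kappa> x y" for c
    using X Y s ev[of "c *s x1" "c *s x2" y1 y2] ev[of x1 x2 y1 y2]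
    by (simp add: vec.subspace_scale vec.scale_right_distrib scale_left)
  have "w x y = 0" using x y assms by (auto simp: lagrangian_def)
  moreover have "w x1 y1 = 0" "w x2 y2 = 0" using X Y assms by (auto simp: lagrangian_def)
  ultimately have "w x1 y2 + w x2 y1 = 0" using X Y by (simp add: add_left add_right add.commute)
  then have "w x2 y1 = - w x1 y2" by (simp add: add_eq_0_iff2 add.commute)
  then have "w y1 x2 = cnj (w x1 y2)" using skew[where y = y1 and x = x2] by simp
  then show "triple_form w \<beta> \<kappa> y x = cnj (triple_form w \<beta> \<kappa> x y)"
    using ev X Y by simp
  assume z: "z \<in> \<alpha> \<inter> plus_set \<beta> \<kappa>"
  obtain z1 z2 where Z: "z = z1 + z2" "z1 \<in> \<beta>" "z2 \<in> \<kappa>" using z by (auto simp: plus_set_def)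
  have xy: "x + y = (x1 + y1) + (x2 + y2)" using X Y by simp
  have "x1 + y1 \<in> \<beta>" "x2 + y2 \<in> \<kappa>" using X Y s vec.subspace_add by auto
  then have "triple_form w \<beta> \<kappa> (x + y) z = w (x1 + y1) z2"
    unfolding xy Z(1) using Z by (intro ev)
  then show "triple_form w \<beta> \<kappa> (x + y) z = triple_form w \<beta> \<kappa> x z + triple_form w \<beta> \<kappa> y z"
    using X Y Z ev[of x1 x2 z1 z2] ev[of y1 y2 z1 z2]
    by (simp add: add_left)
qed

text \<open>All of \<alpha> + (\<beta> + \<kappa>) annihilates the triple intersection. This bounds
  the dimension of the sum from above, hence that of the domain of the triple form from
  below.\<close>

lemma dim_triple_domain:
  assumes "lagrangian w \<alpha>" "lagrangian w \<beta>" "lagrangian w \<kappa>"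
  shows "vec.dim \<alpha> + vec.dim (\<alpha> \<inter> \<beta> \<inter> \<kappa>) \<le> vec.dim (\<alpha> \<inter> plus_set \<beta> \<kappa>) + vec.dim (\<beta> \<inter> \<kappa>)"
proof -
  have s: "vec.subspace \<alpha>" "vec.subspace \<beta>" "vec.subspace \<kappa>" using assms by (auto simp: lagrangian_def)
  have sp: "vec.subspace (plus_set \<beta> \<kappa>)"
    unfolding plus_set_def by (rule vec.subspace_sums[OF s(2,3)])
  have st: "vec.subspace (\<alpha> \<inter> \<beta> \<inter> \<kappa>)" using s by (intro vec.subspace_inter)
  have "plus_set \<alpha> (plus_set \<beta> \<kappa>) \<subseteq> ann (\<alpha> \<inter> \<beta> \<inter> \<kappa>)"
    using assms by (auto simp: plus_set_def ann_def lagrangian_def add_left)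
  then have "vec.dim (plus_set \<alpha> (plus_set \<beta> \<kappa>)) \<le> vec.dim (ann (\<alpha> \<inter> \<beta> \<inter> \<kappa>))"
    by (rule vec.dim_subset)
  moreover have "vec.dim (plus_set \<alpha> (plus_set \<beta> \<kappa>)) + vec.dim (\<alpha> \<inter> plus_set \<beta> \<kappa>)
      = vec.dim \<alpha> + vec.dim (plus_set \<beta> \<kappa>)"
    using vec.dim_sums_Int[OF s(1) sp] by (simp only: plus_set_def)
  moreover have "vec.dim (plus_set \<beta> \<kappa>) + vec.dim (\<beta> \<inter> \<kappa>) = vec.dim \<beta> + vec.dim \<kappa>"
    using vec.dim_sums_Int[OF s(2,3)] by (simp only: plus_set_def)
  moreover have "vec.dim \<beta> + vec.dim \<kappa> = CARD('v)" using assms by (simp add: lagrangian_def)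
  ultimately show ?thesis using dim_ann[OF st] by linarith
qed

text \<open>The radical lies in (\<alpha> \<inter> \<beta>) + (\<alpha> \<inter> \<kappa>): the
  \<beta>-part of a radical vector annihilates \<kappa> \<inter> (\<alpha> + \<beta>), whose
  annihilator is \<kappa> + (\<alpha> \<inter> \<beta>).\<close>

lemma dim_triple_rad:
  assumes "lagrangian w \<alpha>" "lagrangian w \<beta>" "lagrangian w \<kappa>"
  shows "vec.dim (herm_form.rad (\<alpha> \<inter> plus_set \<beta> \<kappa>) (triple_form w \<beta> \<kappa>)) + vec.dim (\<alpha> \<inter> \<beta> \<inter> \<kappa>)
      \<le> vec.dim (\<alpha> \<inter> \<beta>) + vec.dim (\<alpha> \<inter> \<kappa>)"
proof -
  interpret Q: herm_form "\<alpha> \<inter> plus_set \<beta> \<kappa>" "triple_form w \<beta> \<kappa>" by (rule herm_triple_form[OF assms])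
  have s: "vec.subspace \<alpha>" "vec.subspace \<beta>" "vec.subspace \<kappa>" using assms by (auto simp: lagrangian_def)
  have ab: "vec.subspace (\<alpha> \<inter> \<beta>)" "vec.subspace (\<alpha> \<inter> \<kappa>)" using s by (auto intro: vec.subspace_inter)
  have sX: "vec.subspace (plus_set \<kappa> (\<alpha> \<inter> \<beta>))"
    unfolding plus_set_def by (rule vec.subspace_sums[OF s(3) ab(1)])
  have "ann (plus_set \<kappa> (\<alpha> \<inter> \<beta>)) = \<kappa> \<inter> plus_set \<alpha> \<beta>"
    unfolding ann_plus[OF s(3) ab(1)] using ann_int ann_lagrangian assms by simp
  then have X: "ann (\<kappa> \<inter> plus_set \<alpha> \<beta>) = plus_set \<kappa> (\<alpha> \<inter> \<beta>)" using ann_ann[OF sX] by simp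
  have "Q.rad \<subseteq> plus_set (\<alpha> \<inter> \<beta>) (\<alpha> \<inter> \<kappa>)"
  proof
    fix x assume x: "x \<in> Q.rad"
    then have "x \<in> \<alpha>" "x \<in> plus_set \<beta> \<kappa>" by (auto simp: Q.rad_def)
    then obtain y z where yz: "x = y + z" "y \<in> \<beta>" "z \<in> \<kappa>" by (auto simp: plus_set_def)
    have "w y z' = 0" if z': "z' \<in> \<kappa> \<inter> plus_set \<alpha> \<beta>" for z'
    proof -
      obtain a b where ab: "z' = a + b" "a \<in> \<alpha>" "b \<in> \<beta>" using z' by (auto simp: plus_set_def)
      \<comment> \<open>Read this way, z' = a + b makes a an admissible test vector whose
        \<kappa>-part is z'.\<close>
      have "a = (- b) + z'" using ab by simp
      have "- b \<in> \<beta>" by (rule vec.subspace_neg[OF s(2) ab(3)])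
      have "z' \<in> \<kappa>" using z' by simp
      then have "a \<in> \<alpha> \<inter> plus_set \<beta> \<kappa>"
        using \<open>a \<in> \<alpha>\<close> \<open>a = - b + z'\<close> \<open>- b \<in> \<beta>\<close> unfolding plus_set_def by blast
      then have "triple_form w \<beta> \<kappa> x a = 0" using x by (simp add: Q.rad_def)
      moreover have "triple_form w \<beta> \<kappa> x a = w y z'"
        using triple_form_eval[OF assms(2,3) yz(2,3) \<open>- b \<in> \<beta>\<close> \<open>z' \<in> \<kappa>\<close>] yz(1) \<open>a = - b + z'\<close> by simp
      ultimately show ?thesis by simp
    qed
    then have "y \<in> ann (\<kappa> \<inter> plus_set \<alpha> \<beta>)" by (simp add: ann_def)
    then obtain k a where ka: "y = k + a" "k \<in> \<kappa>" "a \<in> \<alpha> \<inter> \<beta>" using X by (auto simp: plus_set_def)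
    have "x - a = k + z" using yz ka by simp
    then have "x - a \<in> \<kappa>" using ka yz s vec.subspace_add by auto
    moreover have "x - a \<in> \<alpha>" using \<open>x \<in> \<alpha>\<close> ka s vec.subspace_diff by auto
    moreover have "x = a + (x - a)" by simp
    ultimately show "x \<in> plus_set (\<alpha> \<inter> \<beta>) (\<alpha> \<inter> \<kappa>)" using ka unfolding plus_set_def by blast
  qed
  then have "vec.dim Q.rad \<le> vec.dim (plus_set (\<alpha> \<inter> \<beta>) (\<alpha> \<inter> \<kappa>))" by (rule vec.dim_subset)
  moreover have "vec.dim (plus_set (\<alpha> \<inter> \<beta>) (\<alpha> \<inter> \<kappa>)) + vec.dim ((\<alpha> \<inter> \<beta>) \<inter> (\<alpha> \<inter> \<kappa>))
      = vec.dim (\<alpha> \<inter> \<beta>) + vec.dim (\<alpha> \<inter> \<kappa>)"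
    using vec.dim_sums_Int[OF ab] by (simp only: plus_set_def)
  moreover have "(\<alpha> \<inter> \<beta>) \<inter> (\<alpha> \<inter> \<kappa>) = \<alpha> \<inter> \<beta> \<inter> \<kappa>" by auto
  ultimately show ?thesis by simp
qed

end


section \<open>Coordinates and dimensions in direct sums\<close>

lemma vfst_vjoin [simp]: "vfst (vjoin a b) = a" and vsnd_vjoin [simp]: "vsnd (vjoin a b) = b"
  by (simp_all add: vfst_def vsnd_def vjoin_def vec_eq_iff)

lemma vjoin_vfst_vsnd [simp]: "vjoin (vfst v) (vsnd v) = v"
  by (simp add: vfst_def vsnd_def vjoin_def vec_eq_iff split: sum.split)

lemma vjoin_eq_iff [simp]: "vjoin a b = vjoin c d \<longleftrightarrow> a = c \<and> b = d"
  by (metis vfst_vjoin vsnd_vjoin)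

lemma vjoin_zero [simp]: "vjoin 0 0 = 0"
  by (simp add: vjoin_def vec_eq_iff split: sum.split)

lemma vjoin_add: "vjoin a b + vjoin c d = vjoin (a + c) (b + d)"
  by (simp add: vjoin_def vec_eq_iff split: sum.split)

lemma vjoin_scale: "k *s vjoin a b = vjoin (k *s a) (k *s b)"
  by (simp add: vjoin_def vec_eq_iff split: sum.split)

lemma vfst_add [simp]: "vfst (a + b) = vfst a + vfst b"
  and vsnd_add [simp]: "vsnd (a + b) = vsnd a + vsnd b"
  and vfst_diff [simp]: "vfst (c - d) = vfst c - vfst (d::'a::ab_group_add^('m::finite + 'n::finite))"
  and vsnd_diff [simp]: "vsnd (c - d) = vsnd c - vsnd (d::'a::ab_group_add^('m::finite + 'n::finite))"
  and vfst_scale [simp]: "vfst (k *s e) = k *s vfst e"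
  and vsnd_scale [simp]: "vsnd (k *s e) = k *s vsnd e"
  and vfst_zero [simp]: "vfst (0::'b::zero^('m::finite + 'n::finite)) = 0"
  and vsnd_zero [simp]: "vsnd (0::'b^('m + 'n)) = 0"
  by (simp_all add: vfst_def vsnd_def vec_eq_iff)

abbreviation vlinear :: "('a::field^'m \<Rightarrow> 'a^'n) \<Rightarrow> bool" where
  "vlinear \<equiv> Vector_Spaces.linear (*s) (*s)"

lemma vlinearI:
  assumes "\<And>x y. f (x + y) = f x + f y" "\<And>c x. f (c *s x) = c *s f x"
  shows "vlinear f"
  using assms by unfold_locales auto

lemma dim_vlinear_image:
  assumes "vlinear f" "inj_on f (vec.span S)"
  shows "vec.dim (f ` S) = vec.dim S"
  by (rule vec.dim_image_eq[OF assms])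

lemma subspace_vjoin:
  fixes S :: "('a::field^'m) set" and U :: "('a^'n) set"
  assumes "vec.subspace S" "vec.subspace U"
  shows "vec.subspace {vjoin a b |a b. a \<in> S \<and> b \<in> U}"
proof -
  have "{vjoin a b |a b. a \<in> S \<and> b \<in> U} = {v. vfst v \<in> S \<and> vsnd v \<in> U}"
    by (auto intro: vjoin_vfst_vsnd[symmetric])
  with assms show ?thesis by (simp add: vec.subspace_def)
qed

lemma dim_vjoin:
  fixes S :: "('a::field^'m) set" and U :: "('a^'n) set"
  assumes "vec.subspace S" "vec.subspace U"
  shows "vec.dim {vjoin a b |a b. a \<in> S \<and> b \<in> U} = vec.dim S + vec.dim U"
proof -
  let ?f = "\<lambda>a. vjoin a (0::'a^'n)" and ?g = "\<lambda>b. vjoin (0::'a^'m) b"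
  have f: "vlinear ?f" and g: "vlinear ?g"
    by (auto intro!: vlinearI simp: vjoin_add vjoin_scale)
  have d: "vec.dim (?f ` S) = vec.dim S" "vec.dim (?g ` U) = vec.dim U"
    by (intro dim_vlinear_image f g; auto simp: inj_on_def)+
  have s: "vec.subspace (?f ` S)" "vec.subspace (?g ` U)"
    using assms f g by (auto intro: vec.linear_subspace_image)
  have eq: "{vjoin a b |a b. a \<in> S \<and> b \<in> U} = {x + y |x y. x \<in> ?f ` S \<and> y \<in> ?g ` U}"
  proof (intro equalityI subsetI)
    fix x assume "x \<in> {vjoin a b |a b. a \<in> S \<and> b \<in> U}"
    then obtain a b where "x = vjoin a b" "a \<in> S" "b \<in> U" by blast
    moreover from this have "x = ?f a + ?g b" by (simp add: vjoin_add)
    ultimately show "x \<in> {x + y |x y. x \<in> ?f ` S \<and> y \<in> ?g ` U}" by blast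
  qed (auto simp: vjoin_add)
  have "?f ` S \<inter> ?g ` U \<subseteq> {0}" by auto
  then have "vec.dim (?f ` S \<inter> ?g ` U) = 0" using vec.dim_eq_0 by blast
  then show ?thesis unfolding eq using vec.dim_sums_Int[OF s] d by linarith
qed

section \<open>The triple index in a chart\<close>

context symp
begin

text \<open>The affine chart of the Lagrangian Grassmannian at \<open>\<rho>\<close>:
  \<open>a\<close> and \<open>b\<close> parametrise subspaces transversal to \<open>\<rho>\<close>
  compatibly, points with equal parameters agreeing modulo \<open>\<rho>\<close>. Then w (a x) (b y)
  is the Hermitian form that represents the difference of the two subspaces.\<close>

definition chart :: "(complex^'v) set \<Rightarrow> (complex^'p \<Rightarrow> complex^'v) \<Rightarrow> (complex^'p \<Rightarrow> complex^'v) \<Rightarrow> bool"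
  where "chart \<rho> a b \<longleftrightarrow> vec.subspace \<rho> \<and> (\<forall>r\<in>\<rho>. \<forall>s\<in>\<rho>. w r s = 0) \<and>
    vlinear a \<and> vlinear b \<and> (\<forall>x y. w (a x) (a y) = 0) \<and> (\<forall>x y. w (b x) (b y) = 0) \<and>
    (\<forall>x. a x \<in> \<rho> \<longrightarrow> x = 0) \<and> (\<forall>x. a x - b x \<in> \<rho>)"

lemma chart_sym:
  assumes "chart \<rho> a b" shows "chart \<rho> b a"
proof -
  have s: "vec.subspace \<rho>" using assms by (simp add: chart_def)
  have 1: "b x - a x \<in> \<rho>" for x
  proof -
    have "- (a x - b x) \<in> \<rho>" using assms by (intro vec.subspace_neg[OF s]) (simp add: chart_def)
    then show ?thesis by simp
  qed
  have "x = 0" if "b x \<in> \<rho>" for x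
  proof -
    have "(a x - b x) + b x \<in> \<rho>"
      using assms that by (intro vec.subspace_add[OF s]) (auto simp: chart_def)
    then show ?thesis using assms by (simp add: chart_def)
  qed
  with 1 show ?thesis using assms by (simp add: chart_def)
qed

lemma chart_trans:
  assumes "chart \<rho> a b" "chart \<rho> b k" shows "chart \<rho> a k"
proof -
  have s: "vec.subspace \<rho>" using assms by (simp add: chart_def)
  have "a x - k x \<in> \<rho>" for x
    using vec.subspace_add[OF s, of "a x - b x" "b x - k x"] assms by (simp add: chart_def)
  then show ?thesis using assms by (simp add: chart_def)
qed

text \<open>Additivity of differences, a - k = (a - b) + (b - k): expand w (a x - b x) (b y - k y) =
  0, which holds because \<open>\<rho>\<close> is isotropic.\<close>

lemma chart_cocycle:
  assumes "chart \<rho> a b" "chart \<rho> b k"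
  shows "w (a x) (k y) = w (a x) (b y) + w (b x) (k y)"
proof -
  have "w (a x - b x) (b y - k y) = 0" using assms by (simp add: chart_def)
  moreover have "w (b x) (b y) = 0" using assms by (simp add: chart_def)
  ultimately show ?thesis by (simp add: diff_left diff_right algebra_simps)
qed

text \<open>The cocycle identity for \<open>a\<close>, \<open>b\<close>, \<open>a\<close> reads 0 =
  w (a y) (b x) + w (b y) (a x); together with skewness this is Hermitian symmetry.\<close>

lemma chart_herm:
  assumes "chart \<rho> a b" shows "herm_form UNIV (\<lambda>x y. w (a x) (b y))"
proof
  have lin: "vlinear a" using assms by (simp add: chart_def)
  show "w (a (x + y)) (b z) = w (a x) (b z) + w (a y) (b z)" for x y z
    by (simp add: vec.linear_add[OF lin] add_left)
  show "w (a (c *s x)) (b y) = c * w (a x) (b y)" for c x y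
    by (simp add: vec.linear_scale[OF lin] scale_left)
  show "w (a y) (b x) = cnj (w (a x) (b y))" for x y
  proof -
    have "w (a y) (a x) = w (a y) (b x) + w (b y) (a x)"
      using chart_cocycle[OF assms chart_sym[OF assms]] .
    moreover have "w (a y) (a x) = 0" using assms by (simp add: chart_def)
    moreover have "w (b y) (a x) = - cnj (w (a x) (b y))" by (rule skew)
    ultimately show ?thesis by simp
  qed
qed auto

lemma chart_inj:
  assumes "chart \<rho> a b" shows "inj a"
proof -
  have "x = 0" if "a x = 0" for x
    using assms that vec.subspace_0[of \<rho>] by (simp add: chart_def)
  moreover have "vlinear a" using assms by (simp add: chart_def)
  ultimately show ?thesis using vec.linear_inj_iff_eq_0 by blast
qed

lemma chart_lagrangian:
  fixes a :: "complex^'p \<Rightarrow> complex^'v"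
  assumes "chart \<rho> a b" "CARD('v) = 2 * CARD('p)"
  shows "lagrangian w (range a)"
proof -
  have lin: "vlinear a" using assms by (simp add: chart_def)
  have "vec.dim (range a) = vec.dim (UNIV :: (complex^'p) set)"
    by (rule dim_vlinear_image[OF lin]) (use chart_inj[OF assms(1)] in \<open>simp add: inj_on_def\<close>)
  then have "vec.dim (range a) = CARD('p)" by (simp only: vec_dim_card)
  moreover have "vec.subspace (range a)"
    by (rule vec.linear_subspace_image[OF lin vec.subspace_UNIV])
  ultimately show ?thesis using assms by (auto simp: lagrangian_def chart_def)
qed

lemma chart_eqI:
  assumes "chart \<rho> a b" "a x = b y" shows "x = y"
proof -
  have lin: "vlinear a" using assms by (simp add: chart_def)
  have "a (x - y) = - (a y - b y)" using assms(2) by (simp add: vec.linear_diff[OF lin])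
  also have "\<dots> \<in> \<rho>" using assms by (intro vec.subspace_neg) (simp_all add: chart_def)
  finally have "x - y = 0" using assms(1) unfolding chart_def by blast
  then show ?thesis by simp
qed

text \<open>For x in the radical, a x annihilates range b and so lies in it, that subspace being its
  own annihilator; compatibility of the parameters then gives a x = b x. Degeneracy thus measures
  the intersection of the two subspaces.\<close>

lemma chart_rad:
  fixes a :: "complex^'p \<Rightarrow> complex^'v"
  assumes "chart \<rho> a b" "CARD('v) = 2 * CARD('p)"
  shows "herm_form.rad UNIV (\<lambda>x y. w (a x) (b y)) = {x. a x = b x}"
proof -
  interpret herm_form UNIV "\<lambda>x y. w (a x) (b y)" by (rule chart_herm[OF assms(1)])
  have "a x = b x" if "x \<in> rad" for x
  proof -
    have "a x \<in> ann (range b)" using that by (auto simp: rad_def ann_def)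
    then have "a x \<in> range b"
      using ann_lagrangian[OF chart_lagrangian[OF chart_sym[OF assms(1)] assms(2)]] by simp
    then obtain y where "a x = b y" by blast
    then show ?thesis using chart_eqI[OF assms(1)] by blast
  qed
  moreover have "w (b x) (b y) = 0" for x y using assms(1) by (simp add: chart_def)
  then have "x \<in> rad" if "a x = b x" for x using that by (simp add: rad_def)
  ultimately show ?thesis by blast
qed

lemma chart_dim_eq:
  assumes "chart \<rho> a b"
  shows "vec.dim {x. a x = b x \<and> P x} = vec.dim (a ` {x. a x = b x \<and> P x})"
proof -
  have lin: "vlinear a" using assms by (simp add: chart_def)
  show ?thesis
    by (rule dim_vlinear_image[OF lin, symmetric])
      (use chart_inj[OF assms(1)] in \<open>simp add: inj_on_def\<close>)
qed

lemma chart_dim_rad: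
  assumes "chart \<rho> a b"
  shows "vec.dim {x. a x = b x} = vec.dim (range a \<inter> range b)"
proof -
  have "a ` {x. a x = b x} = range a \<inter> range b"
  proof (intro equalityI subsetI)
    fix v assume "v \<in> range a \<inter> range b"
    then obtain x y where v: "v = a x" "v = b y" by blast
    then have "x = y" using chart_eqI[OF assms] by metis
    then have "x \<in> {x. a x = b x}" using v by simp
    then show "v \<in> a ` {x. a x = b x}" using v(1) by blast
  next
    fix v assume "v \<in> a ` {x. a x = b x}"
    then obtain x where "v = a x" "a x = b x" by blast
    then have "v = a x" "v = b x" by simp_all
    then show "v \<in> range a \<inter> range b" by blast
  qed
  then show ?thesis using chart_dim_eq[OF assms, of "\<lambda>_. True"] by simp
qed

lemma chart_dim_rad3:
  assumes "chart \<rho> a b" "chart \<rho> b k"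
  shows "vec.dim {x. a x = b x \<and> a x = k x} = vec.dim (range a \<inter> range b \<inter> range k)"
proof -
  have "a ` {x. a x = b x \<and> a x = k x} = range a \<inter> range b \<inter> range k"
  proof (intro equalityI subsetI)
    fix v assume "v \<in> range a \<inter> range b \<inter> range k"
    then obtain x y z where v: "v = a x" "v = b y" "v = k z" by blast
    then have "x = y" "x = z"
      using chart_eqI[OF assms(1)] chart_eqI[OF chart_trans[OF assms]] by metis+
    then have "x \<in> {x. a x = b x \<and> a x = k x}" using v by simp
    then show "v \<in> a ` {x. a x = b x \<and> a x = k x}" using v(1) by blast
  next
    fix v assume "v \<in> a ` {x. a x = b x \<and> a x = k x}"
    then obtain x where "v = a x" "a x = b x" "a x = k x" by blast
    then have "v = a x" "v = b x" "v = k x" by simp_all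
    then show "v \<in> range a \<inter> range b \<inter> range k" by blast
  qed
  then show ?thesis using chart_dim_eq[OF assms(1), of "\<lambda>x. a x = k x"] by simp
qed

text \<open>
  With \<open>F = w (a \<cdot>) (k \<cdot>)\<close>, \<open>G = w (b \<cdot>) (k \<cdot>)\<close>, the form \<open>(F - G) \<oplus> G\<close> restricts to \<open>F\<close> on the diagonal, and
  to minus the triple form on the orthogonal complement of the diagonal.
\<close>

lemma chart_triple_le:
  fixes a b k :: "complex^'p \<Rightarrow> complex^'v"
  assumes ab: "chart \<rho> a b" and bk: "chart \<rho> b k" and card: "CARD('v) = 2 * CARD('p)"
  shows "pos_index UNIV (\<lambda>x y. - w (a x) (k y))
      + pos_index (range a \<inter> plus_set (range b) (range k)) (triple_form w (range b) (range k))
      + vec.dim (range a \<inter> range k)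
    \<le> pos_index UNIV (\<lambda>x y. - w (a x) (b y)) + pos_index UNIV (\<lambda>x y. - w (b x) (k y))
      + vec.dim (range a \<inter> range b \<inter> range k)"
proof -
  let ?V = "range a \<inter> plus_set (range b) (range k)" and ?q = "triple_form w (range b) (range k)"
  note ak = chart_trans[OF ab bk]
  have lin: "vlinear a" "vlinear b" "vlinear k" using ab bk by (auto simp: chart_def)
  have lag: "lagrangian w (range a)" "lagrangian w (range b)" "lagrangian w (range k)"
    using chart_lagrangian[OF _ card] ab chart_sym[OF ab] chart_sym[OF bk] by auto
  have N: "vec.dim (UNIV :: (complex^'p) set) = CARD('p)" by (simp only: vec_dim_card)
  interpret F: herm_form UNIV "\<lambda>x y. w (a x) (k y)" by (rule chart_herm[OF ak])
  interpret G: herm_form UNIV "\<lambda>x y. w (b x) (k y)" by (rule chart_herm[OF bk])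
  interpret G1: herm_form UNIV "\<lambda>x y. - w (b x) (k y)" by (rule G.uminus)
  interpret H: herm_form UNIV "\<lambda>x y. w (a x) (b y)" by (rule chart_herm[OF ab])
  interpret H1: herm_form UNIV "\<lambda>x y. - w (a x) (b y)" by (rule H.uminus)
  interpret Q: herm_form ?V ?q
    by (rule herm_triple_form[OF lag])
  have rad: "H1.rad = {x. a x = b x}" "G1.rad = {x. b x = k x}" "F.rad = {x. a x = k x}"
    using chart_rad[OF ab card] chart_rad[OF bk card] chart_rad[OF ak card]
    by (simp_all add: H1.rad_def H.rad_def G1.rad_def G.rad_def)
  obtain U where U: "vec.subspace U" "vec.dim U + pos_index UNIV (\<lambda>x y. w (a x) (k y)) = CARD('p)"
    "\<forall>x\<in>U. Re (w (a x) (k x)) \<le> 0 \<and> (Re (w (a x) (k x)) = 0 \<longrightarrow> a x = k x)"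
    using F.nonpos_subspace unfolding rad N mem_Collect_eq by blast
  obtain U1 where U1: "vec.subspace U1" "vec.dim U1 + pos_index UNIV (\<lambda>x y. - w (a x) (b y)) = CARD('p)"
    "\<forall>x\<in>U1. Re (- w (a x) (b x)) \<le> 0 \<and> (Re (- w (a x) (b x)) = 0 \<longrightarrow> a x = b x)"
    using H1.nonpos_subspace unfolding rad N mem_Collect_eq by blast
  obtain U2 where U2: "vec.subspace U2" "vec.dim U2 + pos_index UNIV (\<lambda>x y. - w (b x) (k y)) = CARD('p)"
    "\<forall>x\<in>U2. Re (- w (b x) (k x)) \<le> 0 \<and> (Re (- w (b x) (k x)) = 0 \<longrightarrow> b x = k x)"
    using G1.nonpos_subspace unfolding rad N mem_Collect_eq by blast
  obtain E where E: "vec.subspace E" "E \<subseteq> ?V"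
    "vec.dim E = pos_index ?V ?q"
    "\<forall>x\<in>E. x \<noteq> 0 \<longrightarrow> Re (?q x x) > 0"
    using Q.pos_subspace by blast
  define \<tau> where "\<tau> v = a (vfst v)" for v :: "complex^('p + 'p)"
  \<comment> \<open>A pair (u, y) in \<open>D\<close> encodes a decomposition of a u with parts in
    range b and range k. The parameter of the first part must be u - y: modulo
    \<open>\<rho>\<close>, a u = b x + k y forces u = x + y.\<close>
  define D where "D = {v :: complex^('p + 'p). a (vfst v) = b (vfst v - vsnd v) + k (vsnd v)}"
  have lt: "vlinear \<tau>"
    by (intro vlinearI) (auto simp: \<tau>_def vec.linear_add[OF lin(1)] vec.linear_scale[OF lin(1)])
  have "vlinear (\<lambda>v :: complex^('p + 'p). a (vfst v) - (b (vfst v - vsnd v) + k (vsnd v)))"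
    by (intro vlinearI)
      (simp_all add: vec.linear_add[OF lin(1)] vec.linear_scale[OF lin(1)]
        vec.linear_add[OF lin(2)] vec.linear_scale[OF lin(2)] vec.linear_diff[OF lin(2)]
        vec.linear_add[OF lin(3)] vec.linear_scale[OF lin(3)]
        vec.scale_right_diff_distrib vec.scale_right_distrib)
  moreover have "D = {v. a (vfst v) - (b (vfst v - vsnd v) + k (vsnd v)) = 0}" by (simp add: D_def)
  ultimately have D: "vec.subspace D" using vec.linear_subspace_kernel by (simp only:)
  have ED: "E \<subseteq> \<tau> ` D"
  proof
    fix e assume "e \<in> E"
    then have "e \<in> range a" "e \<in> plus_set (range b) (range k)" using E(2) by blast+
    then obtain u where u: "e = a u" by blast
    obtain x y where "e = b x + k y"
      using \<open>e \<in> plus_set (range b) (range k)\<close> unfolding plus_set_def by blast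
    with u have e: "e = a u" "e = b x + k y" by auto
    have "a (u - (x + y)) = - ((a x - b x) + (a y - k y))"
      using e by (simp add: vec.linear_diff[OF lin(1)] vec.linear_add[OF lin(1)])
    also have "\<dots> \<in> \<rho>"
      using ab ak by (intro vec.subspace_neg vec.subspace_add) (auto simp: chart_def)
    finally have "u - (x + y) = 0" using ab unfolding chart_def by blast
    then have "u - y = x" by (simp add: algebra_simps)
    then have "vjoin u y \<in> D" using e by (simp add: D_def)
    moreover have "e = \<tau> (vjoin u y)" using e by (simp add: \<tau>_def)
    ultimately show "e \<in> \<tau> ` D" by blast
  qed
  \<comment> \<open>A linear choice of decompositions on \<open>E\<close>, so that its image is a
    subspace of the same dimension.\<close>
  obtain g where g: "g ` UNIV \<subseteq> D" "vlinear g" "\<And>e. e \<in> E \<Longrightarrow> \<tau> (g e) = e"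
    using vec.linear_exists_right_inverse_on[OF lt D] ED by (meson subsetD)
  have gQ: "?q e e = w (b (vfst (g e) - vsnd (g e))) (k (vsnd (g e)))"
    and ge: "e = b (vfst (g e) - vsnd (g e)) + k (vsnd (g e))" "e = a (vfst (g e))" if "e \<in> E" for e
  proof -
    show e: "e = a (vfst (g e))" using g(3)[OF that] by (simp add: \<tau>_def)
    have "g e \<in> D" using g(1) by blast
    then show e2: "e = b (vfst (g e) - vsnd (g e)) + k (vsnd (g e))" using e by (simp add: D_def)
    show "?q e e = w (b (vfst (g e) - vsnd (g e))) (k (vsnd (g e)))"
      by (subst (1 2) e2) (intro triple_form_eval lag rangeI)
  qed
  have g0: "g 0 = 0" by (rule vec.linear_0[OF g(2)])
  \<comment> \<open>The direct sum form announced above; by the cocycle identity F - G is w (a x) (b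
    y).\<close>
  define h where "h v = w (a (vfst v)) (b (vfst v)) + w (b (vsnd v)) (k (vsnd v))" for v
  \<comment> \<open>The cross terms \<open>c1\<close> and \<open>c2\<close> vanish: decompositions
    are orthogonal to the diagonal.\<close>
  have h_sum: "Re (h (vjoin u u + g e)) = Re (w (a u) (k u)) - Re (?q e e)"
    if "e \<in> E" for u e
  proof -
    define x y where "x = vfst (g e)" and "y = vsnd (g e)"
    have e: "a x = b (x - y) + k y" using ge[OF that] by (simp add: x_def y_def)
    then have bx: "b x = a x + b y - k y" by (simp add: vec.linear_diff[OF lin(2)])
    have z: "w (a s) (a t) = 0" "w (b s) (b t) = 0" "w (k s) (k t) = 0" for s t
      using ab bk by (auto simp: chart_def)
    have co: "w (a s) (k t) = w (a s) (b t) + w (b s) (k t)" for s t by (rule chart_cocycle[OF ab bk])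
    have c1: "w (a u) (b x) + w (b u) (k y) = 0"
      unfolding bx using co[of u y] by (simp add: add_right diff_right z)
    have c2: "w (a x) (b u) + w (b y) (k u) = 0"
      using c1 H.herm[of u x] G.herm[of u y] by (metis UNIV_I complex_cnj_add complex_cnj_zero)
    have "h (vjoin u u + g e) = w (a (u + x)) (b (u + x)) + w (b (u + y)) (k (u + y))"
      by (simp add: h_def x_def y_def)
    also have "\<dots> = (w (a u) (b u) + w (b u) (k u)) + (w (a u) (b x) + w (b u) (k y))
        + (w (a x) (b u) + w (b y) (k u)) + w (a x) (b x) + w (b y) (k y)"
      by (simp add: vec.linear_add[OF lin(1)] vec.linear_add[OF lin(2)] vec.linear_add[OF lin(3)]
          add_left add_right)
    also have "\<dots> = w (a u) (k u) + w (a x) (b x) + w (b y) (k y)"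
      using co[of u u] c1 c2 by simp
    also have "w (a x) (b x) = w (k y) (b x) " unfolding e
      by (simp add: add_left z)
    also have "w (k y) (b x) = - cnj (w (b x) (k y))" by (rule skew)
    finally have "Re (h (vjoin u u + g e)) = Re (w (a u) (k u)) - (Re (w (b x) (k y)) - Re (w (b y) (k y)))"
      by simp
    then show ?thesis
      using gQ[OF that] by (simp add: x_def y_def vec.linear_diff[OF lin(2)] diff_left)
  qed
  have Qnn: "Re (?q e e) \<ge> 0" if "e \<in> E" for e
    using E(4) that gQ[of 0] ge[of 0] vec.subspace_0[OF E(1)]
    by (cases "e = 0") (auto simp: g0 vec.linear_0[OF lin(2)] vec.linear_0[OF lin(3)])
  let ?\<delta> = "\<lambda>u :: complex^'p. vjoin u u"
  have l\<delta>: "vlinear ?\<delta>" by (intro vlinearI) (auto simp: vjoin_add vjoin_scale)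
  have s: "vec.subspace (?\<delta> ` U)" "vec.subspace (g ` E)"
    using U(1) E(1) l\<delta> g(2) by (auto intro: vec.linear_subspace_image)
  have d1: "vec.dim (?\<delta> ` U) = vec.dim U"
    by (rule dim_vlinear_image[OF l\<delta>]) (simp add: inj_on_def)
  have "inj_on g E" by (rule inj_on_inverseI[of _ \<tau>]) (rule g(3))
  moreover have "vec.span E = E" using E(1) vec.span_eq_iff by blast
  ultimately have d2: "vec.dim (g ` E) = vec.dim E"
    by (intro dim_vlinear_image[OF g(2)]) (simp only:)
  have "?\<delta> ` U \<inter> g ` E \<subseteq> {0}"
  proof
    fix v assume "v \<in> ?\<delta> ` U \<inter> g ` E"
    then obtain u e where v: "v = ?\<delta> u" "v = g e" "e \<in> E" by blast
    then have "g e = vjoin u u" by simp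
    then have "vfst (g e) = u" "vsnd (g e) = u" by simp_all
    then have "?q e e = 0"
      using gQ[OF v(3)] by (simp add: vec.linear_0[OF lin(2)])
    then have "\<not> 0 < Re (?q e e)" by simp
    then have "e = 0" using E(4) v(3) by blast
    then show "v \<in> {0}" using v(2) g0 by simp
  qed
  then have d3: "vec.dim (?\<delta> ` U \<inter> g ` E) = 0" using vec.dim_eq_0 by blast
  \<comment> \<open>\<open>h\<close> is nonpositive on \<open>N\<close> and nonnegative on
    \<open>M\<close>. On the intersection all contributions vanish, and the equality cases confine
    it to the triple intersection; the ambient space has dimension 2 CARD('p).\<close>
  define N where "N = {x + y |x y. x \<in> ?\<delta> ` U \<and> y \<in> g ` E}"
  define M where "M = {vjoin x y |x y. x \<in> U1 \<and> y \<in> U2}"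
  have dN: "vec.dim N = vec.dim U + vec.dim E"
    using vec.dim_sums_Int[OF s] d1 d2 d3 unfolding N_def by linarith
  have dM: "vec.dim M = vec.dim U1 + vec.dim U2"
    unfolding M_def by (rule dim_vjoin[OF U1(1) U2(1)])
  have sN: "vec.subspace N" unfolding N_def by (rule vec.subspace_sums[OF s])
  have sM: "vec.subspace M" unfolding M_def by (rule subspace_vjoin[OF U1(1) U2(1)])
  have "N \<inter> M \<subseteq> ?\<delta> ` {x. a x = b x \<and> a x = k x}"
  proof
    fix v assume v: "v \<in> N \<inter> M"
    then obtain u e where ue: "v = ?\<delta> u + g e" "u \<in> U" "e \<in> E" unfolding N_def by blast
    obtain x y where xy: "v = vjoin x y" "x \<in> U1" "y \<in> U2" using v unfolding M_def by blast
    have h: "Re (h v) = Re (w (a x) (b x)) + Re (w (b y) (k y))" by (simp add: h_def xy)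
    have "Re (w (a x) (b x)) \<ge> 0" "Re (w (b y) (k y)) \<ge> 0" "Re (w (a u) (k u)) \<le> 0"
      using U1(3) U2(3) U(3) xy(2,3) ue(2) by force+
    then have zero: "Re (w (a x) (b x)) = 0" "Re (w (b y) (k y)) = 0" "Re (w (a u) (k u)) = 0"
      "Re (?q e e) = 0"
      using h h_sum[OF ue(3), of u] Qnn[OF ue(3)] ue(1) by auto
    then have "\<not> 0 < Re (?q e e)" by simp
    then have "e = 0" using E(4) ue(3) by blast
    then have "v = ?\<delta> u" using ue g0 by simp
    moreover from this have "x = u" "y = u" using xy by auto
    moreover have "a u = k u" "a x = b x" using U(3) U1(3) ue(2) xy(2) zero by force+
    ultimately show "v \<in> ?\<delta> ` {x. a x = b x \<and> a x = k x}" by auto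
  qed
  then have "vec.dim (N \<inter> M) \<le> vec.dim (?\<delta> ` {x. a x = b x \<and> a x = k x})" by (rule vec.dim_subset)
  also have "\<dots> = vec.dim {x. a x = b x \<and> a x = k x}"
    by (rule dim_vlinear_image[OF l\<delta>]) (simp add: inj_on_def)
  also have "\<dots> = vec.dim (range a \<inter> range b \<inter> range k)" by (rule chart_dim_rad3[OF ab bk])
  finally have "vec.dim (N \<inter> M) \<le> vec.dim (range a \<inter> range b \<inter> range k)" .
  moreover have "vec.dim {x + y |x y. x \<in> N \<and> y \<in> M} \<le> vec.dim (UNIV :: (complex^('p + 'p)) set)"
    by (rule vec.dim_subset) simp
  then have "vec.dim {x + y |x y. x \<in> N \<and> y \<in> M} \<le> 2 * CARD('p)"
    unfolding vec_dim_card by simp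
  ultimately have "vec.dim N + vec.dim M \<le> 2 * CARD('p) + vec.dim (range a \<inter> range b \<inter> range k)"
    using vec.dim_sums_Int[OF sN sM] by linarith
  moreover have "pos_index UNIV (\<lambda>x y. w (a x) (k y)) + pos_index UNIV (\<lambda>x y. - w (a x) (k y))
      + vec.dim (range a \<inter> range k) = CARD('p)"
    using F.index_sum unfolding F.neg_index_def rad chart_dim_rad[OF ak] N .
  ultimately show ?thesis using dN dM U(2) U1(2) U2(2) E(3) by linarith
qed


lemma chart_uminus:
  assumes "chart \<rho> a b" shows "symp.chart (\<lambda>x y. - w x y) \<rho> a b"
  unfolding symp.chart_def[OF symp_uminus] using assms by (simp add: chart_def)

text \<open>\<open>chart_triple_le\<close> gives one inequality for w and one for -w. Adding them
  and inserting the index sums with the bounds for the triple domain and its radical leaves no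
  slack, so each of them is an equality.\<close>

theorem chart_triple_index:
  fixes a b k :: "complex^'p \<Rightarrow> complex^'v"
  assumes ab: "chart \<rho> a b" and bk: "chart \<rho> b k" and card: "CARD('v) = 2 * CARD('p)"
  shows "triple_index w (range a) (range b) (range k)
    = int (pos_index UNIV (\<lambda>x y. - w (a x) (b y))) - int (pos_index UNIV (\<lambda>x y. - w (a x) (k y)))
      + int (pos_index UNIV (\<lambda>x y. - w (b x) (k y)))"
proof -
  note ak = chart_trans[OF ab bk]
  have lag: "lagrangian w (range a)" "lagrangian w (range b)" "lagrangian w (range k)"
    using chart_lagrangian[OF _ card] ab chart_sym[OF ab] chart_sym[OF bk] by auto
  let ?V = "range a \<inter> plus_set (range b) (range k)"
  let ?Q = "triple_form w (range b) (range k)"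
  interpret m: symp "\<lambda>x y. - w x y" by (rule symp_uminus)
  interpret F: herm_form UNIV "\<lambda>x y. w (a x) (k y)" by (rule chart_herm[OF ak])
  interpret G: herm_form UNIV "\<lambda>x y. w (b x) (k y)" by (rule chart_herm[OF bk])
  interpret H: herm_form UNIV "\<lambda>x y. w (a x) (b y)" by (rule chart_herm[OF ab])
  interpret Q: herm_form ?V ?Q by (rule herm_triple_form[OF lag])
  have "triple_form (\<lambda>x y. - w x y) (range b) (range k) x x = - ?Q x x" if x: "x \<in> ?V" for x
  proof -
    obtain y z where "x = y + z" "y \<in> range b" "z \<in> range k" using x by (auto simp: plus_set_def)
    moreover have "lagrangian (\<lambda>x y. - w x y) (range b)" "lagrangian (\<lambda>x y. - w x y) (range k)"
      using lag by (auto simp: lagrangian_def)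
    ultimately show ?thesis
      using triple_form_eval[OF lag(2,3)] m.triple_form_eval by simp
  qed
  then have "pos_index ?V (triple_form (\<lambda>x y. - w x y) (range b) (range k)) = Q.neg_index"
    unfolding Q.neg_index_def by (rule pos_index_cong)
  then have "pos_index UNIV (\<lambda>x y. w (a x) (k y)) + Q.neg_index + vec.dim (range a \<inter> range k)
    \<le> pos_index UNIV (\<lambda>x y. w (a x) (b y)) + pos_index UNIV (\<lambda>x y. w (b x) (k y))
      + vec.dim (range a \<inter> range b \<inter> range k)"
    using m.chart_triple_le[OF chart_uminus[OF ab] chart_uminus[OF bk] card] by simp
  moreover note chart_triple_le[OF ab bk card] dim_triple_domain[OF lag] dim_triple_rad[OF lag]
    Q.index_sum
    F.index_sum[unfolded F.neg_index_def chart_rad[OF ak card] chart_dim_rad[OF ak] vec_dim_card]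
    G.index_sum[unfolded G.neg_index_def chart_rad[OF bk card] chart_dim_rad[OF bk] vec_dim_card]
    H.index_sum[unfolded H.neg_index_def chart_rad[OF ab card] chart_dim_rad[OF ab] vec_dim_card]
  moreover have "vec.dim (range a) = CARD('p)" using lag card by (simp add: lagrangian_def)
  ultimately show ?thesis unfolding triple_index_def by linarith
qed

end

section \<open>The concrete symplectic form and its continuity\<close>

lemma sum_UNIV_Plus:
  "(\<Sum>k\<in>(UNIV :: ('a::finite + 'b::finite) set). f k) = (\<Sum>i\<in>UNIV. f (Inl i)) + (\<Sum>j\<in>UNIV. f (Inr j))"
  by (subst UNIV_Plus_UNIV[symmetric], subst sum.Plus) auto

lemma hinner_split: "hinner a b = hinner (vfst a) (vfst b) + hinner (vsnd a) (vsnd b)"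
  unfolding hinner_def sum_UNIV_Plus by (simp add: vfst_def vsnd_def)

lemma block_mat_mult:
  fixes A :: "'a::comm_semiring_1^'n^'m"
  shows "block_mat A B C D *v v = vjoin (A *v vfst v + B *v vsnd v) (C *v vfst v + D *v vsnd v)"
  unfolding vec_eq_iff matrix_vector_mult_def sum_UNIV_Plus
  by (auto simp: block_mat_def vjoin_def vfst_def vsnd_def split: sum.split)

lemma J_mat_mult: "J_mat *v v = vjoin (- vsnd v) (vfst v)"
proof -
  have "(- mat 1) *v x = - x" for x :: "complex^'n"
    using matrix_vector_mul_lid[of x] unfolding vec_eq_iff matrix_vector_mult_def by (simp add: sum_negf)
  then show ?thesis unfolding J_mat_def block_mat_mult by simp
qed

text \<open>For a = (y1, x1) and b = (y2, x2) this is the Lagrange bracket <y1, x2> - <x1, y2> of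
  the second-order operator.\<close>

lemma omega_alt: "omega a b = hinner (vfst a) (vsnd b) - hinner (vsnd a) (vfst b)"
  unfolding omega_def J_mat_mult
  by (subst hinner_split) (simp add: hinner_def sum_negf)

lemma hinner_add_left: "hinner (a + b) c = hinner a c + hinner b c"
  and hinner_add_right: "hinner c (a + b) = hinner c a + hinner c b"
  and hinner_scale_left: "hinner (k *s a) b = k * hinner a b"
  and hinner_scale_right: "hinner a (k *s b) = cnj k * hinner a b"
  and hinner_cnj: "cnj (hinner a b) = hinner b a"
  by (simp_all add: hinner_def sum.distrib sum_distrib_left algebra_simps cnj_sum)

lemma hinner_self: "hinner a a = of_real ((norm a)\<^sup>2)"
proof -
  have "hinner a a = (\<Sum>i\<in>UNIV. of_real ((norm (a $ i))\<^sup>2))"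
    unfolding hinner_def by (intro sum.cong refl complex_norm_square[symmetric])
  also have "\<dots> = of_real (\<Sum>i\<in>UNIV. (norm (a $ i))\<^sup>2)" by (rule of_real_sum[symmetric])
  also have "(\<Sum>i\<in>UNIV. (norm (a $ i))\<^sup>2) = (norm a)\<^sup>2"
    by (simp add: norm_vec_def L2_set_def sum_nonneg)
  finally show ?thesis .
qed

lemma hinner_zero [simp]: "hinner 0 a = 0" "hinner a 0 = 0"
  by (simp_all add: hinner_def)

lemma hinner_minus_left: "hinner (- a) b = - hinner a b"
  and hinner_minus_right: "hinner a (- b) = - hinner a b"
  by (simp_all add: hinner_def sum_negf)

lemma hinner_diff_left: "hinner (a - b) c = hinner a c - hinner b c"
  and hinner_diff_right: "hinner c (a - b) = hinner c a - hinner c b"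
  by (simp_all add: hinner_def sum_subtractf algebra_simps)

lemma continuous_on_hinner [continuous_intros]:
  "continuous_on S f \<Longrightarrow> continuous_on S g \<Longrightarrow> continuous_on S (\<lambda>x. hinner (f x) (g x))"
  unfolding hinner_def by (intro continuous_intros)

lemma continuous_on_vfst [continuous_intros]:
  "continuous_on S f \<Longrightarrow> continuous_on S (\<lambda>x. vfst (f x))"
  and continuous_on_vsnd [continuous_intros]:
  "continuous_on S f \<Longrightarrow> continuous_on S (\<lambda>x. vsnd (f x))"
  unfolding vfst_def vsnd_def by (auto intro!: continuous_on_vec_lambda continuous_on_component)

lemma continuous_on_vjoin [continuous_intros]:
  assumes "continuous_on S f" "continuous_on S g"
  shows "continuous_on S (\<lambda>x. vjoin (f x) (g x))"
  unfolding vjoin_def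
proof (rule continuous_on_vec_lambda)
  show "continuous_on S (\<lambda>x. case k of Inl i \<Rightarrow> f x $ i | Inr j \<Rightarrow> g x $ j)" for k
    using assms by (cases k) (auto intro!: continuous_intros)
qed

lemma continuous_on_omega2 [continuous_intros]:
  "continuous_on S f \<Longrightarrow> continuous_on S g \<Longrightarrow> continuous_on S (\<lambda>x. omega2 (f x) (g x))"
  unfolding omega2_def omega_alt by (intro continuous_intros)

text \<open>Passage between the real scalars of the topology and the complex scalars of
  \<open>vec.subspace\<close>; boundedness of complex linear maps and closedness of complex
  subspaces rest on it.\<close>

lemma scaleR_vec_complex: "r *\<^sub>R x = complex_of_real r *s x"
  unfolding vec_eq_iff by (simp add: scaleR_conv_of_real[where 'a = complex])

lemma vlinear_real_linear:
  assumes "vlinear (f :: complex^'m \<Rightarrow> complex^'n)" shows "linear f"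
  by (rule linearI) (simp_all add: scaleR_vec_complex vec.linear_add[OF assms] vec.linear_scale[OF assms])

lemma vlinear_continuous:
  assumes "vlinear (f :: complex^'m \<Rightarrow> complex^'n)" "continuous_on S h"
  shows "continuous_on S (\<lambda>x. f (h x))"
proof -
  have "bounded_linear f"
    using vlinear_real_linear[OF assms(1)] linear_conv_bounded_linear by blast
  then show ?thesis using assms(2) by (rule bounded_linear.continuous_on)
qed

lemma vec_subspace_real:
  assumes "vec.subspace (S :: (complex^'m) set)" shows "subspace S"
  using assms by (auto simp: vec.subspace_def subspace_def scaleR_vec_complex)

lemma symp_omega2: "symp (omega2 :: complex^(('n::finite + 'n) + ('n + 'n)) \<Rightarrow> _)"
proof
  fix x y z :: "complex^(('n + 'n) + ('n + 'n))" and c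
  show "omega2 (x + y) z = omega2 x z + omega2 y z"
    by (simp add: omega2_def omega_alt hinner_add_left)
  show "omega2 (c *s x) y = c * omega2 x y"
    by (simp add: omega2_def omega_alt hinner_scale_left algebra_simps)
  show "omega2 y x = - cnj (omega2 x y)"
    by (simp add: omega2_def omega_alt hinner_cnj)
  assume nd: "\<And>y. omega2 x y = 0"
  \<comment> \<open>Chosen so that \<open>omega2 x ?y\<close> is the squared norm of x; the two
    halves are rotated in opposite directions because of the opposite signs in -\<omega> \<oplus>
    \<omega>.\<close>
  let ?y = "vjoin (vjoin (vsnd (vfst x)) (- vfst (vfst x))) (vjoin (- vsnd (vsnd x)) (vfst (vsnd x)))"
  have "hinner (vfst (vfst x)) (vfst (vfst x)) + hinner (vsnd (vfst x)) (vsnd (vfst x))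
      + (hinner (vfst (vsnd x)) (vfst (vsnd x)) + hinner (vsnd (vsnd x)) (vsnd (vsnd x))) = 0"
    using nd[of ?y] by (simp add: omega2_def omega_alt hinner_minus_right add.commute)
  then have "(norm (vfst (vfst x)))\<^sup>2 + (norm (vsnd (vfst x)))\<^sup>2
      + ((norm (vfst (vsnd x)))\<^sup>2 + (norm (vsnd (vsnd x)))\<^sup>2) = 0"
    unfolding hinner_self of_real_add[symmetric] of_real_eq_0_iff .
  then have "vfst (vfst x) = 0" "vsnd (vfst x) = 0" "vfst (vsnd x) = 0" "vsnd (vsnd x) = 0"
    by (simp_all add: add_nonneg_eq_0_iff)
  then have "vfst x = 0" "vsnd x = 0"
    using vjoin_vfst_vsnd[of "vfst x"] vjoin_vfst_vsnd[of "vsnd x"] by simp_all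
  then show "x = 0" using vjoin_vfst_vsnd[of x] by simp
qed

interpretation om: symp "omega2 :: complex^(('n::finite + 'n) + ('n + 'n)) \<Rightarrow> _"
  by (rule symp_omega2)

text \<open>The parameters at which positivity fails somewhere on \<open>K\<close> form the
  projection of a closed set along a compact factor, hence a closed set, and it misses
  \<open>l0\<close>.\<close>

lemma tube_pos:
  fixes F :: "real \<times> 'b::euclidean_space \<Rightarrow> real"
  assumes "continuous_on UNIV F" "compact K" "\<And>k. k \<in> K \<Longrightarrow> F (l0, k) > 0"
  shows "\<exists>\<epsilon>>0. \<forall>l. \<bar>l - l0\<bar> < \<epsilon> \<longrightarrow> (\<forall>k\<in>K. F (l, k) > 0)"
proof -
  have "closed {x. F x \<le> 0}"
    by (rule closed_Collect_le[OF assms(1) continuous_on_const])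
  then have "closed {x. F (snd x, fst x) \<le> 0}"
    using closed_vimage[of "{x. F x \<le> 0}" "\<lambda>x. (snd x, fst x)"]
    by (simp add: vimage_def continuous_intros)
  then have "closed {l. \<exists>k. k \<in> K \<and> (k, l) \<in> {x. F (snd x, fst x) \<le> 0}}"
    by (rule closed_compact_projection[OF assms(2)])
  then have "open (- {l. \<exists>k. k \<in> K \<and> (k, l) \<in> {x. F (snd x, fst x) \<le> 0}})" by blast
  moreover have "l0 \<in> - {l. \<exists>k. k \<in> K \<and> (k, l) \<in> {x. F (snd x, fst x) \<le> 0}}"
    using assms(3) by (auto simp: not_le)
  ultimately obtain e where e: "e > 0"
    "ball l0 e \<subseteq> - {l. \<exists>k. k \<in> K \<and> (k, l) \<in> {x. F (snd x, fst x) \<le> 0}}"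
    by (rule openE)
  have "F (l, k) > 0" if "\<bar>l - l0\<bar> < e" "k \<in> K" for l k
  proof -
    have "l \<in> ball l0 e" using that by (simp add: dist_real_def abs_minus_commute)
    then show ?thesis using e(2) that(2) by (force simp: not_le)
  qed
  then show ?thesis using e(1) by blast
qed

section \<open>Monotone families of Lagrangian graphs\<close>

text \<open>Lets positivity be tested in other coordinates: below, \<open>S\<close> passes from the
  parameter v of a moving graph to the parameter of a fixed chart.\<close>

lemma pos_index_pullback_le:
  fixes S :: "complex^'p \<Rightarrow> complex^'m"
  assumes "herm_form UNIV q" "vlinear S" "inj S" "vec.subspace W"
    "\<And>v. v \<in> W \<Longrightarrow> v \<noteq> 0 \<Longrightarrow> Re (q (S v) (S v)) > 0"
  shows "vec.dim W \<le> pos_index UNIV q"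
proof -
  interpret herm_form UNIV q by fact
  have pos: "Re (q x x) > 0" if "x \<in> S ` W" "x \<noteq> 0" for x
    using that assms(5) vec.linear_0[OF assms(2)] by blast
  have "vec.dim (S ` W) \<le> pos_index UNIV q"
  proof (rule dim_nonneg_le_pos_index)
    show "vec.subspace (S ` W)" by (rule vec.linear_subspace_image[OF assms(2,4)])
    show "Re (q x x) \<ge> 0" if "x \<in> S ` W" for x
      using pos[OF that] zero_left[of 0] by (cases "x = 0") auto
    show "S ` W \<inter> rad \<subseteq> {0}"
    proof
      fix x assume x: "x \<in> S ` W \<inter> rad"
      then have "q x x = 0" by (simp add: rad_def)
      then show "x \<in> {0}" using pos[of x] x by auto
    qed
  qed simp
  moreover have "vec.dim (S ` W) = vec.dim W"
    by (rule dim_vlinear_image[OF assms(2)]) (use assms(3) in \<open>auto simp: inj_on_def\<close>)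
  ultimately show ?thesis by simp
qed

lemma norm_normalize: "v \<noteq> 0 \<Longrightarrow> norm (complex_of_real (1 / norm v) *s v) = 1"
  by (simp only: scaleR_vec_complex[symmetric]) simp

lemma (in symp) scale_real:
  "w (complex_of_real r *s x) (complex_of_real r *s y) = of_real (r\<^sup>2) * w x y"
  by (simp add: scale_left scale_right power2_eq_square)

lemma Re_of_real_mult: "Re (complex_of_real r * z) = r * Re z"
  by simp

text \<open>What the counting argument uses of the flows. In the application \<open>g\<close> is the
  L2 pairing of two solutions with parameters l and m, and \<open>rel\<close> is the integrated
  Lagrange identity. For l = m, \<open>g\<close> is the crossing form; otherwise it is a difference
  quotient of the symplectic pairing.\<close>

locale crossing =
  fixes \<Gamma> :: "real \<Rightarrow> complex^('n::finite + 'n)^('n + 'n)"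
    and g :: "real \<Rightarrow> real \<Rightarrow> complex^('n + 'n) \<Rightarrow> complex^('n + 'n) \<Rightarrow> complex"
  assumes rel: "omega (\<Gamma> l *v u) (\<Gamma> m *v v) - omega u v = of_real (m - l) * g l m u v"
    and contG: "continuous_on UNIV (\<lambda>(l, v). \<Gamma> l *v v)"
    and contg: "continuous_on UNIV (\<lambda>(l, m, u, v). g l m u v)"
    and gpos: "u \<noteq> 0 \<Longrightarrow> Re (g l l u u) > 0"
begin

definition e :: "real \<Rightarrow> complex^('n + 'n) \<Rightarrow> complex^(('n + 'n) + ('n + 'n))" where
  "e l v = vjoin v (\<Gamma> l *v v)"

lemma Gr_range: "Gr (\<Gamma> l) = range (e l)"
  by (auto simp: Gr_def e_def)

lemma e_lin: "vlinear (e l)"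
  by (rule vlinearI) (simp_all add: e_def vjoin_add vjoin_scale matrix_vector_right_distrib vec.scale)

lemma vfst_e [simp]: "vfst (e l v) = v" and vsnd_e [simp]: "vsnd (e l v) = \<Gamma> l *v v"
  by (simp_all add: e_def)

lemma e_inj: "inj (e l)"
  by (rule inj_on_inverseI[of _ vfst]) simp

lemma om_e: "omega2 (e l u) (e m v) = of_real (m - l) * g l m u v"
  using rel[of l u m v] by (simp add: omega2_def e_def)

lemma cont_e [continuous_intros]:
  assumes "continuous_on S f" "continuous_on S h"
  shows "continuous_on S (\<lambda>x. e (f x) (h x))"
proof -
  have "continuous_on S (\<lambda>x. case (f x, h x) of (l, v) \<Rightarrow> \<Gamma> l *v v)"
    by (rule continuous_on_compose2[OF contG]) (auto intro!: continuous_intros assms)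
  then show ?thesis unfolding e_def by (auto intro!: continuous_intros assms)
qed

lemma cont_g [continuous_intros]:
  assumes "continuous_on S f1" "continuous_on S f2" "continuous_on S f3" "continuous_on S f4"
  shows "continuous_on S (\<lambda>x. g (f1 x) (f2 x) (f3 x) (f4 x))"
proof -
  have "continuous_on S (\<lambda>x. case (f1 x, f2 x, f3 x, f4 x) of (l, m, u, v) \<Rightarrow> g l m u v)"
    by (rule continuous_on_compose2[OF contg]) (auto intro!: continuous_intros assms)
  then show ?thesis by simp
qed

lemma dim_UNIV_p: "vec.dim (UNIV :: (complex^('n + 'n)) set) = CARD('n + 'n)"
  by (simp only: vec_dim_card)

lemma lagrangian_Gr: "lagrangian omega2 (Gr (\<Gamma> l))"
proof -
  have "vec.dim (range (e l)) = vec.dim (UNIV :: (complex^('n + 'n)) set)"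
    by (rule dim_vlinear_image[OF e_lin]) (use e_inj in \<open>auto simp: inj_on_def\<close>)
  moreover have "vec.subspace (range (e l))"
    by (rule vec.linear_subspace_image[OF e_lin vec.subspace_UNIV])
  ultimately show ?thesis unfolding Gr_range lagrangian_def dim_UNIV_p by (auto simp: om_e)
qed

text \<open>If e l v and e l0 u both lie in \<beta>, then (l0 - l) g l l0 v u = 0, so g vanishes
  there for l \<noteq> l0. Crossings accumulating at l0 would yield, by compactness, a unit vector v
  with e l0 v in \<beta> and g l0 l0 v v = 0, against \<open>gpos\<close>.\<close>

lemma isolated_crossing:
  assumes "lagrangian omega2 \<beta>"
  shows "\<exists>\<epsilon>>0. \<forall>l. l \<noteq> l0 \<longrightarrow> \<bar>l - l0\<bar> < \<epsilon> \<longrightarrow> Gr (\<Gamma> l) \<inter> \<beta> = {0}"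
proof -
  have s: "vec.subspace \<beta>" using assms by (simp add: lagrangian_def)
  \<comment> \<open>Pairs (v, l) satisfying the closed conditions that a crossing forces. At l = l0
    the vector v itself is among the u.\<close>
  define T where "T = {x. e (snd x) (fst x) \<in> \<beta>} \<inter>
    (\<Inter>u\<in>{u. e l0 u \<in> \<beta>}. {x. g (snd x) l0 (fst x) u = 0})"
  have "closed T"
    unfolding T_def
  proof (intro closed_Int closed_INT ballI)
    have "closed \<beta>" by (rule closed_subspace[OF vec_subspace_real[OF s]])
    then have "closed ((\<lambda>x. e (snd x) (fst x)) -` \<beta>)"
      by (rule closed_vimage) (intro continuous_intros)
    then show "closed {x. e (snd x) (fst x) \<in> \<beta>}" by (simp add: vimage_def)
    show "closed {x. g (snd x) l0 (fst x) u = 0}" for u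
      by (intro closed_Collect_eq continuous_intros)
  qed
  then have "closed {l. \<exists>v. v \<in> sphere 0 1 \<and> (v, l) \<in> T}"
    by (rule closed_compact_projection[OF compact_sphere])
  then have "open (- {l. \<exists>v. v \<in> sphere 0 1 \<and> (v, l) \<in> T})" by blast
  moreover have "l0 \<in> - {l. \<exists>v. v \<in> sphere 0 1 \<and> (v, l) \<in> T}"
  proof -
    have False if v: "v \<in> sphere 0 1" "(v, l0) \<in> T" for v
    proof -
      have "g l0 l0 v v = 0" using v(2) by (simp add: T_def)
      moreover have "v \<noteq> 0" using v(1) by auto
      ultimately show False using gpos[of v l0] by simp
    qed
    then show ?thesis by blast
  qed
  ultimately obtain \<epsilon> where \<epsilon>: "\<epsilon> > 0" "ball l0 \<epsilon> \<subseteq> - {l. \<exists>v. v \<in> sphere 0 1 \<and> (v, l) \<in> T}"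
    by (rule openE)
  have "z = 0" if l: "l \<noteq> l0" "\<bar>l - l0\<bar> < \<epsilon>" and z: "z \<in> Gr (\<Gamma> l) \<inter> \<beta>" for l z
  proof (rule ccontr)
    assume "z \<noteq> 0"
    obtain v where v: "z = e l v" using z by (auto simp: Gr_range)
    have "v \<noteq> 0" using \<open>z \<noteq> 0\<close> v vec.linear_0[OF e_lin] by metis
    let ?v = "of_real (1 / norm v) *s v"
    have ev: "e l ?v \<in> \<beta>"
      unfolding vec.linear_scale[OF e_lin] using z v by (intro vec.subspace_scale[OF s]) auto
    have "g l l0 ?v u = 0" if "e l0 u \<in> \<beta>" for u
    proof -
      have "omega2 (e l ?v) (e l0 u) = 0" using ev that assms by (auto simp: lagrangian_def)
      then show ?thesis unfolding om_e using l by simp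
    qed
    then have "(?v, l) \<in> T" using ev by (simp add: T_def)
    moreover have "?v \<in> sphere 0 1"
      using norm_normalize[OF \<open>v \<noteq> 0\<close>] by simp
    moreover have "l \<in> ball l0 \<epsilon>" using l by (simp add: dist_real_def abs_minus_commute)
    ultimately show False using \<epsilon>(2) by blast
  qed
  moreover have "0 \<in> Gr (\<Gamma> l) \<inter> \<beta>" for l
    using vec.subspace_0[OF s] lagrangian_Gr[of l] vec.subspace_0 by (auto simp: lagrangian_def)
  ultimately show ?thesis using \<epsilon>(1) by blast
qed

end

text \<open>\<open>T\<close> inverts \<Gamma> l0 - \<Gamma> m, which is possible when the two graphs
  are transversal. It normalises the projection \<pi> along Gr (\<Gamma> m) so that \<pi> (e l0 v) =
  v.\<close>

locale crossing_chart = crossing \<Gamma> g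
  for \<Gamma> :: "real \<Rightarrow> complex^('n::finite + 'n)^('n + 'n)" and g +
  fixes l0 m :: real and T :: "complex^('n + 'n) \<Rightarrow> complex^('n + 'n)"
  assumes T: "vlinear T" "\<And>v. T (\<Gamma> l0 *v v - \<Gamma> m *v v) = v" "\<And>x. T x = 0 \<Longrightarrow> x = 0"
begin

definition \<pi> :: "complex^(('n + 'n) + ('n + 'n)) \<Rightarrow> complex^('n + 'n)" where
  "\<pi> z = T (vsnd z - \<Gamma> m *v vfst z)"

lemma pi_lin: "vlinear \<pi>"
proof (rule vlinearI)
  fix x y :: "complex^(('n + 'n) + ('n + 'n))" and c
  have "vsnd (x + y) - \<Gamma> m *v vfst (x + y) = (vsnd x - \<Gamma> m *v vfst x) + (vsnd y - \<Gamma> m *v vfst y)"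
    by (simp add: matrix_vector_right_distrib)
  then show "\<pi> (x + y) = \<pi> x + \<pi> y" by (simp only: \<pi>_def vec.linear_add[OF T(1)])
  have "vsnd (c *s x) - \<Gamma> m *v vfst (c *s x) = c *s (vsnd x - \<Gamma> m *v vfst x)"
    by (simp add: vec.scale vec.scale_right_diff_distrib)
  then show "\<pi> (c *s x) = c *s \<pi> x" by (simp only: \<pi>_def vec.linear_scale[OF T(1)])
qed

lemma pi_zero_iff: "\<pi> z = 0 \<longleftrightarrow> z \<in> Gr (\<Gamma> m)"
proof
  assume "\<pi> z = 0"
  then have "vsnd z = \<Gamma> m *v vfst z" using T(3) unfolding \<pi>_def by force
  then have "z = e m (vfst z)" by (metis e_def vjoin_vfst_vsnd)
  then show "z \<in> Gr (\<Gamma> m)" by (auto simp: Gr_range)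
next
  assume "z \<in> Gr (\<Gamma> m)"
  then show "\<pi> z = 0" by (auto simp: Gr_range \<pi>_def vec.linear_0[OF T(1)])
qed

lemma pi_e0 [simp]: "\<pi> (e l0 v) = v"
  by (simp add: \<pi>_def T(2))

text \<open>A section of \<pi> over a Lagrangian subspace. Two sections differ by elements of the
  kernel Gr (\<Gamma> m), so any two lifts are compatible in the sense of
  \<open>chart\<close>.\<close>

definition lift :: "(complex^('n + 'n) \<Rightarrow> complex^(('n + 'n) + ('n + 'n)))
    \<Rightarrow> (complex^(('n + 'n) + ('n + 'n))) set \<Rightarrow> bool" where
  "lift d \<delta> \<longleftrightarrow> vlinear d \<and> range d = \<delta> \<and> (\<forall>x. \<pi> (d x) = x) \<and> lagrangian omega2 \<delta>"

lemma lift_e0: "lift (e l0) (Gr (\<Gamma> l0))"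
  by (simp add: lift_def e_lin Gr_range lagrangian_Gr[unfolded Gr_range])

text \<open>Transversality to the kernel makes \<pi> injective on \<delta>, equality of dimensions
  makes it onto, and a linear right inverse with values in \<delta> is the lift.\<close>

lemma lift_exists:
  assumes "lagrangian omega2 \<delta>" "Gr (\<Gamma> m) \<inter> \<delta> = {0}"
  shows "\<exists>d. lift d \<delta>"
proof -
  have s: "vec.subspace \<delta>" and dim: "vec.dim \<delta> = CARD('n + 'n)"
    using assms by (auto simp: lagrangian_def)
  have "inj_on \<pi> \<delta>"
  proof (rule inj_onI)
    fix x y assume "x \<in> \<delta>" "y \<in> \<delta>" "\<pi> x = \<pi> y"
    then have "\<pi> (x - y) = 0" "x - y \<in> \<delta>"
      using vec.linear_diff[OF pi_lin] vec.subspace_diff[OF s] by auto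
    then have "x - y = 0" using pi_zero_iff assms(2) by blast
    then show "x = y" by simp
  qed
  moreover have "vec.span \<delta> = \<delta>" using s vec.span_eq_iff by blast
  ultimately have "inj_on \<pi> (vec.span \<delta>)" by (simp only:)
  then have "vec.dim (\<pi> ` \<delta>) = CARD('n + 'n)"
    using dim_vlinear_image[OF pi_lin, of \<delta>] dim by (simp only:)
  then have "\<pi> ` \<delta> = UNIV"
    using vec.subspace_dim_equal[of "\<pi> ` \<delta>" UNIV] vec.linear_subspace_image[OF pi_lin s] dim_UNIV_p
    by simp
  then obtain d where d: "range d \<subseteq> \<delta>" "vlinear d" "\<forall>x. \<pi> (d x) = x"
    using vec.linear_exists_right_inverse_on[OF pi_lin s] by auto
  have "inj d" by (rule inj_on_inverseI[of _ \<pi>]) (simp add: d(3))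
  then have "vec.dim (range d) = vec.dim (UNIV :: (complex^('n + 'n)) set)"
    by (intro dim_vlinear_image[OF d(2)]) (auto simp: inj_on_def)
  then have "vec.dim (range d) = vec.dim \<delta>" using dim dim_UNIV_p by simp
  then have "range d = \<delta>"
    using vec.subspace_dim_equal[OF vec.linear_subspace_image[OF d(2) vec.subspace_UNIV] s d(1)] by simp
  then show ?thesis using d assms by (auto simp: lift_def)
qed

lemma lift_chart:
  assumes "lift a \<alpha>" "lift d \<delta>"
  shows "om.chart (Gr (\<Gamma> m)) a d"
proof -
  have "\<pi> (a x - d x) = 0" for x
    using assms by (simp add: lift_def vec.linear_diff[OF pi_lin])
  then have "a x - d x \<in> Gr (\<Gamma> m)" for x by (simp add: pi_zero_iff)
  moreover have "x = 0" if "a x \<in> Gr (\<Gamma> m)" for x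
    using assms that by (simp add: lift_def pi_zero_iff[symmetric])
  moreover have "\<forall>r\<in>Gr (\<Gamma> m). \<forall>s\<in>Gr (\<Gamma> m). omega2 r s = 0" "vec.subspace (Gr (\<Gamma> m))"
    using lagrangian_Gr[of m] by (simp_all add: lagrangian_def)
  moreover have "omega2 (a x) (a y) = 0" "omega2 (d x) (d y) = 0" for x y
    using assms by (auto simp: lift_def lagrangian_def)
  ultimately show ?thesis using assms unfolding om.chart_def lift_def by blast
qed

lemma card_double: "CARD(('n + 'n) + ('n + 'n)) = 2 * CARD('n + 'n)"
  by simp

lemma lift_Gr_eq:
  assumes "lift a (Gr (\<Gamma> l))" shows "a x = e l (vfst (a x))" "\<pi> (e l (vfst (a x))) = x"
proof -
  have "a x \<in> range (e l)" using assms by (auto simp: lift_def Gr_range)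
  then show "a x = e l (vfst (a x))" by auto
  then show "\<pi> (e l (vfst (a x))) = x" using assms by (metis lift_def)
qed

lemma lift_Gr_e:
  assumes "lift a (Gr (\<Gamma> l))" shows "a (\<pi> (e l v)) = e l v"
proof -
  have "e l v \<in> range a" using assms by (simp add: lift_def Gr_range)
  then obtain y where y: "e l v = a y" by blast
  then have "\<pi> (e l v) = y" using assms by (simp add: lift_def)
  then show ?thesis using y by simp
qed

text \<open>Lower semicontinuity of either index, \<open>s\<close> selecting the sign. The vector v
  parametrises the graph, where continuity in l is explicit; homogeneity reduces positivity to the
  compact unit sphere of \<open>W\<close>.\<close>

lemma index_semicont:
  assumes "lift d \<delta>" "vec.subspace W" and s: "s \<in> {1, -1 :: real}"
    and pos: "\<And>v. v \<in> W \<Longrightarrow> v \<noteq> 0 \<Longrightarrow> s * Re (omega2 (e l0 v) (d v)) > 0"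
  shows "\<exists>\<epsilon>>0. \<forall>l. \<bar>l - l0\<bar> < \<epsilon> \<longrightarrow> (\<forall>v\<in>W. v \<noteq> 0 \<longrightarrow> s * Re (omega2 (e l v) (d (\<pi> (e l v)))) > 0)"
proof -
  have dl: "vlinear d" using assms by (simp add: lift_def)
  let ?F = "\<lambda>x. s * Re (omega2 (e (fst x) (snd x)) (d (\<pi> (e (fst x) (snd x)))))"
  have "compact (sphere 0 1 \<inter> W)"
    using closed_subspace[OF vec_subspace_real[OF assms(2)]] by (intro compact_Int_closed compact_sphere)
  moreover have "continuous_on UNIV ?F"
    by (intro continuous_intros vlinear_continuous[OF dl] vlinear_continuous[OF pi_lin])
  moreover have "?F (l0, v) > 0" if "v \<in> sphere 0 1 \<inter> W" for v
  proof -
    have "v \<noteq> 0" using that by auto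
    then show ?thesis using pos[of v] that by simp
  qed
  ultimately obtain \<epsilon> where \<epsilon>: "\<epsilon> > 0" "\<And>l v. \<bar>l - l0\<bar> < \<epsilon> \<Longrightarrow> v \<in> sphere 0 1 \<inter> W \<Longrightarrow> ?F (l, v) > 0"
    using tube_pos[of ?F "sphere 0 1 \<inter> W" l0] by blast
  have "?F (l, v) > 0" if l: "\<bar>l - l0\<bar> < \<epsilon>" and v: "v \<in> W" "v \<noteq> 0" for l v
  proof -
    let ?c = "complex_of_real (1 / norm v)"
    have "?c *s v \<in> sphere 0 1 \<inter> W"
      using v(1) vec.subspace_scale[OF assms(2)] norm_normalize[OF v(2)] by simp
    then have "?F (l, ?c *s v) > 0" using \<epsilon>(2) l by blast
    moreover have "?F (l, ?c *s v) = (1 / norm v)\<^sup>2 * ?F (l, v)"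
      by (simp only: fst_conv snd_conv vec.linear_scale[OF e_lin] vec.linear_scale[OF pi_lin]
          vec.linear_scale[OF dl] om.scale_real Re_of_real_mult mult.left_commute)
    ultimately have "0 < (1 / norm v)\<^sup>2 * ?F (l, v)" by (simp only:)
    then show ?thesis by (rule zero_less_mult_pos) (use v(2) in simp)
  qed
  then show ?thesis using \<epsilon>(1) by auto
qed

end

context crossing_chart
begin

text \<open>Semicontinuity keeps both indices from dropping, and off l0 the form is nondegenerate.
  By the cocycle identity the form at l is the one at l0 plus (l0 - l) times something positive, so
  the nullity at l0 goes to the negative index for l > l0 and to the positive one for l <
  l0.\<close>

lemma local_index:
  assumes d: "lift d \<delta>"
  shows "\<exists>\<epsilon>>0. \<forall>l a. \<bar>l - l0\<bar> < \<epsilon> \<longrightarrow> lift a (Gr (\<Gamma> l)) \<longrightarrow>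
    pos_index UNIV (\<lambda>x y. - omega2 (a x) (d y))
      = pos_index UNIV (\<lambda>x y. - omega2 (e l0 x) (d y)) + (if l > l0 then vec.dim (Gr (\<Gamma> l0) \<inter> \<delta>) else 0)"
proof -
  let ?P = "CARD('n + 'n)"
  have dl: "vlinear d" and lag: "lagrangian omega2 \<delta>" and rd: "range d = \<delta>"
    using d by (auto simp: lift_def)
  have UP: "vec.dim (UNIV :: (complex^('n + 'n)) set) = ?P" by (simp only: vec_dim_card)
  note ch0 = lift_chart[OF lift_e0 d]
  interpret h0: herm_form UNIV "\<lambda>x y. omega2 (e l0 x) (d y)" by (rule om.chart_herm[OF ch0])
  interpret h0m: herm_form UNIV "\<lambda>x y. - omega2 (e l0 x) (d y)" by (rule h0.uminus)
  let ?nz = "pos_index UNIV (\<lambda>x y. - omega2 (e l0 x) (d y))"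
  let ?pz = "pos_index UNIV (\<lambda>x y. omega2 (e l0 x) (d y))"
  have sum0: "?pz + ?nz + vec.dim (Gr (\<Gamma> l0) \<inter> \<delta>) = ?P"
    using h0.index_sum unfolding h0.neg_index_def om.chart_rad[OF ch0 card_double]
      om.chart_dim_rad[OF ch0] UP rd Gr_range .
  obtain Wn where Wn: "vec.subspace Wn" "vec.dim Wn = ?nz"
    "\<forall>x\<in>Wn. x \<noteq> 0 \<longrightarrow> Re (- omega2 (e l0 x) (d x)) > 0"
    using h0m.pos_subspace by blast
  obtain Wp where Wp: "vec.subspace Wp" "vec.dim Wp = ?pz"
    "\<forall>x\<in>Wp. x \<noteq> 0 \<longrightarrow> Re (omega2 (e l0 x) (d x)) > 0"
    using h0.pos_subspace by blast
  obtain Xn where Xn: "vec.subspace Xn" "vec.dim Xn + ?pz = ?P"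
    "\<forall>x\<in>Xn. Re (omega2 (e l0 x) (d x)) \<le> 0"
    using h0.nonpos_subspace unfolding UP by blast
  obtain Xp where Xp: "vec.subspace Xp" "vec.dim Xp + ?nz = ?P"
    "\<forall>x\<in>Xp. Re (- omega2 (e l0 x) (d x)) \<le> 0"
    using h0m.nonpos_subspace unfolding UP by blast
  obtain \<epsilon>1 where e1: "\<epsilon>1 > 0" "\<And>l v. \<bar>l - l0\<bar> < \<epsilon>1 \<Longrightarrow> v \<in> Wn \<Longrightarrow> v \<noteq> 0 \<Longrightarrow>
      -1 * Re (omega2 (e l v) (d (\<pi> (e l v)))) > 0"
    using index_semicont[OF d Wn(1), of "-1"] Wn(3) by auto
  obtain \<epsilon>2 where e2: "\<epsilon>2 > 0" "\<And>l v. \<bar>l - l0\<bar> < \<epsilon>2 \<Longrightarrow> v \<in> Wp \<Longrightarrow> v \<noteq> 0 \<Longrightarrow>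
      1 * Re (omega2 (e l v) (d (\<pi> (e l v)))) > 0"
    using index_semicont[OF d Wp(1), of 1] Wp(3) by auto
  obtain \<epsilon>3 where e3: "\<epsilon>3 > 0" "\<And>l. l \<noteq> l0 \<Longrightarrow> \<bar>l - l0\<bar> < \<epsilon>3 \<Longrightarrow> Gr (\<Gamma> l) \<inter> \<delta> = {0}"
    using isolated_crossing[OF lag, of l0] by blast
  \<comment> \<open>At l = l0 the two vectors coincide because \<pi> (e l0 v) = v, so positivity of
    the crossing form persists nearby.\<close>
  let ?G = "\<lambda>x. Re (g (fst x) l0 (snd x) (\<pi> (e (fst x) (snd x))))"
  have "continuous_on UNIV ?G"
    by (intro continuous_intros vlinear_continuous[OF pi_lin])
  moreover have "?G (l0, v) > 0" if "v \<in> sphere 0 1" for v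
  proof -
    have "v \<noteq> 0" using that by auto
    then show ?thesis using gpos by simp
  qed
  ultimately obtain \<epsilon>4 where e4: "\<epsilon>4 > 0"
    "\<And>l v. \<bar>l - l0\<bar> < \<epsilon>4 \<Longrightarrow> v \<in> sphere 0 1 \<Longrightarrow> ?G (l, v) > 0"
    using tube_pos[of ?G "sphere 0 1" l0] compact_sphere by blast
  have main: "pos_index UNIV (\<lambda>x y. - omega2 (a x) (d y))
      = ?nz + (if l > l0 then vec.dim (Gr (\<Gamma> l0) \<inter> \<delta>) else 0)"
    if l: "\<bar>l - l0\<bar> < \<epsilon>1" "\<bar>l - l0\<bar> < \<epsilon>2" "\<bar>l - l0\<bar> < \<epsilon>3" "\<bar>l - l0\<bar> < \<epsilon>4" and a: "lift a (Gr (\<Gamma> l))" for l a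
  proof (cases "l = l0")
    case True
    have "a x = e l0 x" for x using lift_Gr_e[OF a[unfolded True], of x] by simp
    then show ?thesis using True by simp
  next
    case False
    note ch = lift_chart[OF a d]
    interpret h: herm_form UNIV "\<lambda>x y. omega2 (a x) (d y)" by (rule om.chart_herm[OF ch])
    interpret hm: herm_form UNIV "\<lambda>x y. - omega2 (a x) (d y)" by (rule h.uminus)
    let ?n = "pos_index UNIV (\<lambda>x y. - omega2 (a x) (d y))"
    let ?p = "pos_index UNIV (\<lambda>x y. omega2 (a x) (d y))"
    have "range a \<inter> range d = {0}"
      using e3(2)[OF False l(3)] a rd by (simp add: lift_def)
    then have sum: "?p + ?n = ?P"
      using h.index_sum unfolding h.neg_index_def om.chart_rad[OF ch card_double]
        om.chart_dim_rad[OF ch] UP by simp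
    \<comment> \<open>The parameter of the graph point e l v in the fixed chart.\<close>
    define S where "S v = \<pi> (e l v)" for v
    have Sl: "vlinear S"
      by (intro vlinearI) (simp_all add: S_def vec.linear_add[OF e_lin] vec.linear_scale[OF e_lin]
          vec.linear_add[OF pi_lin] vec.linear_scale[OF pi_lin])
    have aS: "a (S v) = e l v" for v unfolding S_def by (rule lift_Gr_e[OF a])
    have Si: "inj S" by (rule inj_on_inverseI[of _ "\<lambda>x. vfst (a x)"]) (simp add: aS)
    have n: "?nz \<le> ?n"
      unfolding Wn(2)[symmetric]
      by (rule pos_index_pullback_le[OF hm.herm_form_axioms Sl Si Wn(1)])
        (use e1(2)[OF l(1)] in \<open>simp add: aS S_def[symmetric]\<close>)
    have p: "?pz \<le> ?p"
      unfolding Wp(2)[symmetric]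
      by (rule pos_index_pullback_le[OF h.herm_form_axioms Sl Si Wp(1)])
        (use e2(2)[OF l(2)] in \<open>simp add: aS S_def[symmetric]\<close>)
    have G: "Re (g l l0 v (S v)) > 0" if "v \<noteq> 0" for v
    proof -
      let ?c = "complex_of_real (1 / norm v)"
      have "?c *s v \<in> sphere 0 1" using norm_normalize[OF that] by simp
      then have pos: "Re (g l l0 (?c *s v) (S (?c *s v))) > 0" using e4(2)[OF l(4)] unfolding S_def by force
      \<comment> \<open>The homogeneity of \<open>g\<close> is inherited from \<open>omega2\<close>
        through \<open>om_e\<close>, by cancelling the nonzero factor l0 - l.\<close>
      have nz: "complex_of_real (l0 - l) \<noteq> 0" using False by simp
      have "of_real (l0 - l) * g l l0 (?c *s v) (S (?c *s v))
          = of_real ((1 / norm v)\<^sup>2) * (of_real (l0 - l) * g l l0 v (S v))"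
        unfolding om_e[symmetric] vec.linear_scale[OF Sl] vec.linear_scale[OF e_lin] by (rule om.scale_real)
      then have "of_real (l0 - l) * g l l0 (?c *s v) (S (?c *s v))
          = of_real (l0 - l) * (of_real ((1 / norm v)\<^sup>2) * g l l0 v (S v))"
        by (simp only: mult.left_commute)
      then have "g l l0 (?c *s v) (S (?c *s v)) = of_real ((1 / norm v)\<^sup>2) * g l l0 v (S v)"
        by (rule mult_left_cancel[OF nz, THEN iffD1])
      then have "Re (g l l0 (?c *s v) (S (?c *s v))) = (1 / norm v)\<^sup>2 * Re (g l l0 v (S v))"
        by (simp only: Re_of_real_mult)
      then have "0 < (1 / norm v)\<^sup>2 * Re (g l l0 v (S v))" using pos by (simp only:)
      then show ?thesis by (rule zero_less_mult_pos) (use that in simp)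
    qed
    have diff: "\<exists>c>0. Re (omega2 (a x) (d x)) = (l0 - l) * c + Re (omega2 (e l0 x) (d x))" if "x \<noteq> 0" for x
    proof -
      define v where "v = vfst (a x)"
      have av: "a x = e l v" "S v = x" using lift_Gr_eq[OF a, of x] by (simp_all add: v_def S_def)
      have "v \<noteq> 0" using av that vec.linear_0[OF Sl] by metis
      have "omega2 (a x) (d x) = omega2 (a x) (e l0 x) + omega2 (e l0 x) (d x)"
        by (rule om.chart_cocycle[OF lift_chart[OF a lift_e0] ch0])
      also have "omega2 (a x) (e l0 x) = of_real (l0 - l) * g l l0 v (S v)"
        unfolding av(1) om_e av(2) ..
      finally have "Re (omega2 (a x) (d x)) = (l0 - l) * Re (g l l0 v (S v)) + Re (omega2 (e l0 x) (d x))"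
        by simp
      then show ?thesis using G[OF \<open>v \<noteq> 0\<close>] by blast
    qed
    show ?thesis
    proof (cases "l > l0")
      case True
      \<comment> \<open>\<open>Xn\<close> is nonpositive at l0, and its dimension is the negative
        index plus the nullity; the negative term (l0 - l) * c makes the form negative definite on
        it.\<close>
      have "vec.dim Xn \<le> ?n"
      proof (rule pos_index_pullback_le[OF hm.herm_form_axioms, of "\<lambda>x. x"])
        fix x assume x: "x \<in> Xn" "x \<noteq> 0"
        obtain c where "c > 0" "Re (omega2 (a x) (d x)) = (l0 - l) * c + Re (omega2 (e l0 x) (d x))"
          using diff[OF x(2)] by blast
        moreover have "(l0 - l) * c < 0" using True \<open>c > 0\<close> by (simp add: mult_neg_pos)
        ultimately show "Re (- omega2 (a x) (d x)) > 0" using Xn(3) x(1) by fastforce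
      qed (auto intro!: vlinearI Xn(1))
      then show ?thesis using n p sum sum0 Xn(2) True by simp
    next
      case False
      then have "l < l0" using \<open>l \<noteq> l0\<close> by simp
      have "vec.dim Xp \<le> ?p"
      proof (rule pos_index_pullback_le[OF h.herm_form_axioms, of "\<lambda>x. x"])
        fix x assume x: "x \<in> Xp" "x \<noteq> 0"
        obtain c where "c > 0" "Re (omega2 (a x) (d x)) = (l0 - l) * c + Re (omega2 (e l0 x) (d x))"
          using diff[OF x(2)] by blast
        moreover have "(l0 - l) * c > 0" using \<open>l < l0\<close> \<open>c > 0\<close> by simp
        ultimately show "Re (omega2 (a x) (d x)) > 0" using Xp(3) x(1) by fastforce
      qed (auto intro!: vlinearI Xp(1))
      then show ?thesis using n p sum sum0 Xp(2) False by simp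
    qed
  qed
  show ?thesis
    by (rule exI[of _ "min (min \<epsilon>1 \<epsilon>2) (min \<epsilon>3 \<epsilon>4)"]) (use e1(1) e2(1) e3(1) e4(1) main in auto)
qed

end

section \<open>Jumps of the triple index along the path and their summation\<close>

context crossing
begin

text \<open>Of the three terms of \<open>chart_triple_index\<close> the last is independent of l;
  the other two are governed by \<open>local_index\<close>.\<close>

lemma local_jump:
  assumes "lagrangian omega2 \<beta>" "lagrangian omega2 \<kappa>"
  shows "\<exists>\<epsilon>>0. \<forall>l. \<bar>l - l0\<bar> < \<epsilon> \<longrightarrow>
    triple_index omega2 (Gr (\<Gamma> l)) \<beta> \<kappa> = triple_index omega2 (Gr (\<Gamma> l0)) \<beta> \<kappa>
      + (if l > l0 then int (vec.dim (Gr (\<Gamma> l0) \<inter> \<beta>)) - int (vec.dim (Gr (\<Gamma> l0) \<inter> \<kappa>)) else 0)"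
proof -
  obtain \<epsilon>1 where e1: "\<epsilon>1 > 0" "\<And>l. l \<noteq> l0 \<Longrightarrow> \<bar>l - l0\<bar> < \<epsilon>1 \<Longrightarrow> Gr (\<Gamma> l) \<inter> \<beta> = {0}"
    using isolated_crossing[OF assms(1), of l0] by blast
  obtain \<epsilon>2 where e2: "\<epsilon>2 > 0" "\<And>l. l \<noteq> l0 \<Longrightarrow> \<bar>l - l0\<bar> < \<epsilon>2 \<Longrightarrow> Gr (\<Gamma> l) \<inter> \<kappa> = {0}"
    using isolated_crossing[OF assms(2), of l0] by blast
  obtain \<epsilon>3 where e3: "\<epsilon>3 > 0" "\<And>l. l \<noteq> l0 \<Longrightarrow> \<bar>l - l0\<bar> < \<epsilon>3 \<Longrightarrow> Gr (\<Gamma> l) \<inter> Gr (\<Gamma> l0) = {0}"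
    using isolated_crossing[OF lagrangian_Gr, of l0 l0] by blast
  \<comment> \<open>Half the smallest radius puts m off l0, yet close enough that its graph is
    transversal to \<beta>, to \<kappa> and to Gr (\<Gamma> l0).\<close>
  define m where "m = l0 + min (min \<epsilon>1 \<epsilon>2) \<epsilon>3 / 2"
  have m: "m \<noteq> l0" "\<bar>m - l0\<bar> < \<epsilon>1" "\<bar>m - l0\<bar> < \<epsilon>2" "\<bar>m - l0\<bar> < \<epsilon>3"
    using e1(1) e2(1) e3(1) by (auto simp: m_def)
  obtain \<epsilon>4 where e4: "\<epsilon>4 > 0" "\<And>l. l \<noteq> l0 \<Longrightarrow> \<bar>l - l0\<bar> < \<epsilon>4 \<Longrightarrow> Gr (\<Gamma> l) \<inter> Gr (\<Gamma> m) = {0}"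
    using isolated_crossing[OF lagrangian_Gr, of l0 m] by blast
  have M: "Gr (\<Gamma> m) \<inter> Gr (\<Gamma> l) = {0}" if "\<bar>l - l0\<bar> < \<epsilon>4" for l
    using e4(2)[of l] e3(2)[OF m(1,4)] that by (cases "l = l0") auto
  let ?D = "\<lambda>v. \<Gamma> l0 *v v - \<Gamma> m *v v"
  have Dl: "vlinear ?D"
    by (intro vlinearI) (simp_all add: matrix_vector_right_distrib vec.scale vec.scale_right_diff_distrib)
  have D0: "v = 0" if "?D v = 0" for v
  proof -
    have "e l0 v = e m v" using that by (simp add: e_def)
    then have "e m v \<in> Gr (\<Gamma> m) \<inter> Gr (\<Gamma> l0)" by (metis Gr_range IntI rangeI)
    then have "e m v = 0" using M[of l0] e4(1) by auto
    then show "v = 0" by (metis vfst_e vfst_zero)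
  qed
  then have Dinj: "inj ?D" using vec.linear_inj_iff_eq_0[OF Dl] by blast
  then obtain T where T: "vlinear T" "T \<circ> ?D = id"
    using vec.linear_injective_left_inverse[OF Dl] by blast
  have "surj ?D" using vec.linear_inj_imp_surj[OF Dl Dinj] .
  interpret crossing_chart \<Gamma> g l0 m T
  proof (intro crossing_chart.intro crossing_chart_axioms.intro crossing_axioms)
    show "vlinear T" by fact
    show TD: "T (?D v) = v" for v using fun_cong[OF T(2), of v] by simp
    show "x = 0" if "T x = 0" for x
    proof -
      obtain v where "x = ?D v" using surjD[OF \<open>surj ?D\<close>, of x] by blast
      then show ?thesis using TD[of v] that vec.linear_0[OF Dl] by simp
    qed
  qed
  obtain b where b: "lift b \<beta>" using lift_exists[OF assms(1) e1(2)[OF m(1,2)]] by blast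
  obtain k where k: "lift k \<kappa>" using lift_exists[OF assms(2) e2(2)[OF m(1,3)]] by blast
  obtain \<epsilon>5 where e5: "\<epsilon>5 > 0" "\<And>l a. \<bar>l - l0\<bar> < \<epsilon>5 \<Longrightarrow> lift a (Gr (\<Gamma> l)) \<Longrightarrow>
    pos_index UNIV (\<lambda>x y. - omega2 (a x) (b y))
      = pos_index UNIV (\<lambda>x y. - omega2 (e l0 x) (b y)) + (if l > l0 then vec.dim (Gr (\<Gamma> l0) \<inter> \<beta>) else 0)"
    using local_index[OF b] by blast
  obtain \<epsilon>6 where e6: "\<epsilon>6 > 0" "\<And>l a. \<bar>l - l0\<bar> < \<epsilon>6 \<Longrightarrow> lift a (Gr (\<Gamma> l)) \<Longrightarrow>
    pos_index UNIV (\<lambda>x y. - omega2 (a x) (k y))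
      = pos_index UNIV (\<lambda>x y. - omega2 (e l0 x) (k y)) + (if l > l0 then vec.dim (Gr (\<Gamma> l0) \<inter> \<kappa>) else 0)"
    using local_index[OF k] by blast
  have ti: "triple_index omega2 (Gr (\<Gamma> l)) \<beta> \<kappa>
      = int (pos_index UNIV (\<lambda>x y. - omega2 (a x) (b y))) - int (pos_index UNIV (\<lambda>x y. - omega2 (a x) (k y)))
      + int (pos_index UNIV (\<lambda>x y. - omega2 (b x) (k y)))" if "lift a (Gr (\<Gamma> l))" for l a
    using om.chart_triple_index[OF lift_chart[OF that b] lift_chart[OF b k] card_double] that b k
    by (simp only: lift_def)
  have main: "triple_index omega2 (Gr (\<Gamma> l)) \<beta> \<kappa> = triple_index omega2 (Gr (\<Gamma> l0)) \<beta> \<kappa>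
      + (if l > l0 then int (vec.dim (Gr (\<Gamma> l0) \<inter> \<beta>)) - int (vec.dim (Gr (\<Gamma> l0) \<inter> \<kappa>)) else 0)"
    if l: "\<bar>l - l0\<bar> < \<epsilon>4" "\<bar>l - l0\<bar> < \<epsilon>5" "\<bar>l - l0\<bar> < \<epsilon>6" for l
  proof -
    obtain a where a: "lift a (Gr (\<Gamma> l))" using lift_exists[OF lagrangian_Gr M[OF l(1)]] by blast
    show ?thesis
      unfolding ti[OF a] ti[OF lift_e0] e5(2)[OF l(2) a] e6(2)[OF l(3) a] by simp
  qed
  show ?thesis
  proof (intro exI[of _ "min \<epsilon>4 (min \<epsilon>5 \<epsilon>6)"] conjI allI impI)
    show "0 < min \<epsilon>4 (min \<epsilon>5 \<epsilon>6)" using e4(1) e5(1) e6(1) by simp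
    fix l assume "\<bar>l - l0\<bar> < min \<epsilon>4 (min \<epsilon>5 \<epsilon>6)"
    then have "\<bar>l - l0\<bar> < \<epsilon>4" "\<bar>l - l0\<bar> < \<epsilon>5" "\<bar>l - l0\<bar> < \<epsilon>6" by simp_all
    then show "triple_index omega2 (Gr (\<Gamma> l)) \<beta> \<kappa> = triple_index omega2 (Gr (\<Gamma> l0)) \<beta> \<kappa>
      + (if l > l0 then int (vec.dim (Gr (\<Gamma> l0) \<inter> \<beta>)) - int (vec.dim (Gr (\<Gamma> l0) \<inter> \<kappa>)) else 0)"
      by (rule main)
  qed
qed

text \<open>Bolzano's bisection principle: the jump formula is additive over adjacent intervals and
  holds on all short intervals around each point, hence from \<open>C\<close> to 0. Nothing crosses
  at or below \<open>C\<close>, so the count from there is the full count.\<close>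

theorem crossing_count:
  assumes "lagrangian omega2 \<beta>" "lagrangian omega2 \<kappa>" "C < 0"
    and "\<And>l. l \<le> C \<Longrightarrow> Gr (\<Gamma> l) \<inter> \<beta> = {0}" "\<And>l. l \<le> C \<Longrightarrow> Gr (\<Gamma> l) \<inter> \<kappa> = {0}"
    and "triple_index omega2 (Gr (\<Gamma> C)) \<beta> \<kappa> = 0"
  defines "cr \<equiv> \<lambda>\<Lambda>. {l. l < 0 \<and> Gr (\<Gamma> l) \<inter> \<Lambda> \<noteq> {0}}"
  shows "finite (cr \<beta>)" "finite (cr \<kappa>)"
    "(\<Sum>l\<in>cr \<beta>. int (vec.dim (Gr (\<Gamma> l) \<inter> \<beta>))) - (\<Sum>l\<in>cr \<kappa>. int (vec.dim (Gr (\<Gamma> l) \<inter> \<kappa>)))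
      = triple_index omega2 (Gr (\<Gamma> 0)) \<beta> \<kappa>"
proof -
  \<comment> \<open>Half-open intervals [a, b) match continuity from the left: a crossing
    contributes once b exceeds it, adjacent intervals share no crossing, and l = 0 stays out of the
    count.\<close>
  define N where "N \<Lambda> a b = {l\<in>{a..<b}. Gr (\<Gamma> l) \<inter> \<Lambda> \<noteq> {0}}" for \<Lambda> and a b :: real
  define s where "s \<Lambda> a b = (\<Sum>l\<in>N \<Lambda> a b. int (vec.dim (Gr (\<Gamma> l) \<inter> \<Lambda>)))" for \<Lambda> and a b :: real
  define f where "f l = triple_index omega2 (Gr (\<Gamma> l)) \<beta> \<kappa>" for l
  let ?P = "\<lambda>a b. a \<le> b \<longrightarrow> finite (N \<beta> a b) \<and> finite (N \<kappa> a b) \<and> f b - f a = s \<beta> a b - s \<kappa> a b"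
  have "?P C 0"
  proof (rule Bolzano[of C 0 ?P])
    show "C \<le> 0" using assms by simp
    fix a b c :: real assume ab: "?P a b" and bc: "?P b c" and le: "a \<le> b" "b \<le> c"
    have N: "N \<Lambda> a c = N \<Lambda> a b \<union> N \<Lambda> b c" "N \<Lambda> a b \<inter> N \<Lambda> b c = {}" for \<Lambda>
      using le by (auto simp: N_def)
    have "s \<Lambda> a c = s \<Lambda> a b + s \<Lambda> b c" if "finite (N \<Lambda> a b)" "finite (N \<Lambda> b c)" for \<Lambda>
      unfolding s_def N(1) using that N(2) by (intro sum.union_disjoint) auto
    then show "?P a c" using ab bc le N(1) by auto
  next
    fix x :: real assume "C \<le> x" "x \<le> 0"
    obtain \<epsilon>1 where e1: "\<epsilon>1 > 0" "\<And>l. l \<noteq> x \<Longrightarrow> \<bar>l - x\<bar> < \<epsilon>1 \<Longrightarrow> Gr (\<Gamma> l) \<inter> \<beta> = {0}"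
      using isolated_crossing[OF assms(1), of x] by blast
    obtain \<epsilon>2 where e2: "\<epsilon>2 > 0" "\<And>l. l \<noteq> x \<Longrightarrow> \<bar>l - x\<bar> < \<epsilon>2 \<Longrightarrow> Gr (\<Gamma> l) \<inter> \<kappa> = {0}"
      using isolated_crossing[OF assms(2), of x] by blast
    obtain \<epsilon>3 where e3: "\<epsilon>3 > 0" "\<And>l. \<bar>l - x\<bar> < \<epsilon>3 \<Longrightarrow> f l = f x
      + (if l > x then int (vec.dim (Gr (\<Gamma> x) \<inter> \<beta>)) - int (vec.dim (Gr (\<Gamma> x) \<inter> \<kappa>)) else 0)"
      using local_jump[OF assms(1,2), of x] unfolding f_def by blast
    have N: "N \<Lambda> a b \<subseteq> {x}" "s \<Lambda> a b = (if x < b then int (vec.dim (Gr (\<Gamma> x) \<inter> \<Lambda>)) else 0)"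
      if "\<And>l. l \<noteq> x \<Longrightarrow> \<bar>l - x\<bar> < \<epsilon> \<Longrightarrow> Gr (\<Gamma> l) \<inter> \<Lambda> = {0}" "a \<le> x" "x \<le> b" "b - a < \<epsilon>"
      for \<Lambda> a b \<epsilon>
    proof -
      show sub: "N \<Lambda> a b \<subseteq> {x}"
      proof
        fix l assume l: "l \<in> N \<Lambda> a b"
        then have "\<bar>l - x\<bar> < \<epsilon>" using that by (auto simp: N_def)
        then show "l \<in> {x}" using l that(1) by (auto simp: N_def)
      qed
      show "s \<Lambda> a b = (if x < b then int (vec.dim (Gr (\<Gamma> x) \<inter> \<Lambda>)) else 0)"
      proof (cases "x \<in> N \<Lambda> a b")
        case True
        then have "N \<Lambda> a b = {x}" using sub by blast
        then show ?thesis using True by (auto simp: s_def N_def)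
      next
        case False
        then have "N \<Lambda> a b = {}" using sub by blast
        moreover have "x < b \<Longrightarrow> Gr (\<Gamma> x) \<inter> \<Lambda> = {0}" using False that by (auto simp: N_def)
        ultimately show ?thesis by (auto simp: s_def)
      qed
    qed
    show "\<exists>d>0. \<forall>a b. a \<le> x \<and> x \<le> b \<and> b - a < d \<longrightarrow> ?P a b"
    proof (intro exI[of _ "min (min \<epsilon>1 \<epsilon>2) \<epsilon>3"] conjI allI impI)
      show "0 < min (min \<epsilon>1 \<epsilon>2) \<epsilon>3" using e1(1) e2(1) e3(1) by simp
      fix a b assume h: "a \<le> x \<and> x \<le> b \<and> b - a < min (min \<epsilon>1 \<epsilon>2) \<epsilon>3"
      have b: "N \<beta> a b \<subseteq> {x}" "s \<beta> a b = (if x < b then int (vec.dim (Gr (\<Gamma> x) \<inter> \<beta>)) else 0)"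
        using N[where \<Lambda> = \<beta> and \<epsilon> = \<epsilon>1 and a = a and b = b, OF e1(2)] h by auto
      have k: "N \<kappa> a b \<subseteq> {x}" "s \<kappa> a b = (if x < b then int (vec.dim (Gr (\<Gamma> x) \<inter> \<kappa>)) else 0)"
        using N[where \<Lambda> = \<kappa> and \<epsilon> = \<epsilon>2 and a = a and b = b, OF e2(2)] h by auto
      show "finite (N \<beta> a b)" "finite (N \<kappa> a b)" using b(1) k(1) finite_subset by blast+
      have "f a = f x" using e3(2)[of a] h by simp
      moreover have "f b = f x + (if b > x then int (vec.dim (Gr (\<Gamma> x) \<inter> \<beta>)) - int (vec.dim (Gr (\<Gamma> x) \<inter> \<kappa>)) else 0)"
        using e3(2)[of b] h by simp
      ultimately show "f b - f a = s \<beta> a b - s \<kappa> a b" using b(2) k(2) by simp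
    qed
  qed
  then have P: "finite (N \<beta> C 0)" "finite (N \<kappa> C 0)" "f 0 - f C = s \<beta> C 0 - s \<kappa> C 0"
    using assms(3) by auto
  have crN: "cr \<Lambda> = N \<Lambda> C 0" if nc: "\<And>l. l \<le> C \<Longrightarrow> Gr (\<Gamma> l) \<inter> \<Lambda> = {0}" for \<Lambda>
  proof (intro equalityI subsetI)
    fix l assume l: "l \<in> cr \<Lambda>"
    then have "\<not> l \<le> C" using nc[of l] by (auto simp: cr_def)
    then show "l \<in> N \<Lambda> C 0" using l by (simp add: cr_def N_def)
  qed (simp add: cr_def N_def)
  then have "cr \<beta> = N \<beta> C 0" "cr \<kappa> = N \<kappa> C 0"
    using assms(4,5) by (simp_all only:)
  then show "finite (cr \<beta>)" "finite (cr \<kappa>)"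
    "(\<Sum>l\<in>cr \<beta>. int (vec.dim (Gr (\<Gamma> l) \<inter> \<beta>))) - (\<Sum>l\<in>cr \<kappa>. int (vec.dim (Gr (\<Gamma> l) \<inter> \<kappa>)))
      = triple_index omega2 (Gr (\<Gamma> 0)) \<beta> \<kappa>"
    using P assms(6) by (simp_all add: s_def f_def)
qed

end

section \<open>Linear differential equations depending on a parameter\<close>

text \<open>Turns the upper limit into an ordinary parameter of an integral over the fixed interval
  [0, 1], so that joint continuity follows from continuity of parameter integrals.\<close>

lemma integral_rescale:
  fixes f :: "real \<Rightarrow> 'b::banach"
  assumes "0 \<le> t" "continuous_on {0..t} f"
  shows "integral {0..t} f = integral {0..1} (\<lambda>r. t *\<^sub>R f (t * r))"
proof (cases "t = 0")
  case False
  then have t: "t > 0" using assms by simp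
  have "f integrable_on cbox 0 t" using assms(2) by (simp add: integrable_continuous_real)
  then have "(f has_integral integral {0..t} f) (cbox 0 t)" by (simp add: has_integral_integral)
  then have "((\<lambda>r. f (t *\<^sub>R r + 0)) has_integral (1 / (\<bar>t\<bar> ^ DIM(real))) *\<^sub>R integral {0..t} f)
      ((\<lambda>x. (1 / t) *\<^sub>R x + - ((1 / t) *\<^sub>R 0)) ` cbox 0 t)"
    using False by (intro has_integral_affinity) auto
  moreover have "(\<lambda>x. (1 / t) *\<^sub>R x + - ((1 / t) *\<^sub>R 0)) ` cbox 0 t = {0..1}"
  proof -
    have "(*) (1 / t) ` {0..t} = {0..1}" using t image_mult_atLeastAtMost[of "1 / t" 0 t] by simp
    then show ?thesis by (simp add: image_def)
  qed
  ultimately have "((\<lambda>r. f (t * r)) has_integral (1 / t) *\<^sub>R integral {0..t} f) {0..1}"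
    using t by simp
  then have "((\<lambda>r. t *\<^sub>R f (t * r)) has_integral t *\<^sub>R (1 / t) *\<^sub>R integral {0..t} f) {0..1}"
    by (rule has_integral_cmul)
  then have "((\<lambda>r. t *\<^sub>R f (t * r)) has_integral integral {0..t} f) {0..1}" using False by simp
  then show ?thesis by (rule integral_unique[symmetric])
qed simp

lemma continuous_on_integral_upper:
  fixes F :: "'l::topological_space \<Rightarrow> real \<Rightarrow> 'b::banach"
  assumes "continuous_on (U \<times> {0..T}) (\<lambda>(l, t). F l t)"
  shows "continuous_on (U \<times> {0..T}) (\<lambda>(l, t). integral {0..t} (F l))"
proof -
  have le: "a * b \<le> T" if "0 \<le> a" "a \<le> T" "0 \<le> b" "b \<le> 1" for a b :: real
    using that mult_left_le[of b a] by linarith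
  have "continuous_on ((U \<times> {0..T}) \<times> cbox 0 1) (\<lambda>x. case (fst (fst x), snd (fst x) * snd x) of (l, t) \<Rightarrow> F l t)"
    by (rule continuous_on_compose2[OF assms]) (auto intro!: continuous_intros le)
  then have "continuous_on ((U \<times> {0..T}) \<times> cbox 0 1) (\<lambda>x. F (fst (fst x)) (snd (fst x) * snd x))"
    by simp
  then have "continuous_on ((U \<times> {0..T}) \<times> cbox 0 1) (\<lambda>x. snd (fst x) *\<^sub>R F (fst (fst x)) (snd (fst x) * snd x))"
    by (intro continuous_intros)
  then have "continuous_on ((U \<times> {0..T}) \<times> cbox 0 1) (\<lambda>(x, r). snd x *\<^sub>R F (fst x) (snd x * r))"
    by (simp add: case_prod_unfold)
  then have "continuous_on (U \<times> {0..T}) (\<lambda>x. integral (cbox 0 1) (\<lambda>r. snd x *\<^sub>R F (fst x) (snd x * r)))"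
    by (rule integral_continuous_on_param)
  moreover have "integral (cbox 0 1) (\<lambda>r. snd x *\<^sub>R F (fst x) (snd x * r)) = integral {0..snd x} (F (fst x))"
    if "x \<in> U \<times> {0..T}" for x
  proof -
    have "continuous_on {0..snd x} (\<lambda>s. case (fst x, s) of (l, t) \<Rightarrow> F l t)"
      by (rule continuous_on_compose2[OF assms]) (use that in \<open>auto intro!: continuous_intros\<close>)
    then show ?thesis using that by (subst integral_rescale) auto
  qed
  ultimately have "continuous_on (U \<times> {0..T}) (\<lambda>x. integral {0..snd x} (F (fst x)))"
    by (rule continuous_on_eq)
  then show ?thesis by (simp add: case_prod_unfold)
qed

text \<open>Picard iteration for all l simultaneously. A single series in (l, t) gives joint
  continuity of the solution, which the crossing argument requires.\<close>

lemma linear_ode_param: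
  fixes prod :: "'a::real_normed_vector \<Rightarrow> 'b::banach \<Rightarrow> 'b" and A :: "real \<Rightarrow> real \<Rightarrow> 'a"
  assumes "bounded_bilinear prod" "T > 0"
    and contA: "continuous_on (UNIV \<times> {0..T}) (\<lambda>(l, t). A l t)"
  shows "\<exists>Z. continuous_on (UNIV \<times> {0..T}) (\<lambda>(l, t). Z l t) \<and>
    (\<forall>l. Z l 0 = u0 \<and> (\<forall>t\<in>{0..T}. (Z l has_vector_derivative prod (A l t) (Z l t)) (at t within {0..T})))"
proof -
  interpret bounded_bilinear prod by fact
  obtain K where K: "K > 0" "\<And>a b. norm (prod a b) \<le> norm a * norm b * K"
    using pos_bounded by blast
  \<comment> \<open>These are the terms, not the partial sums, of the Picard series; term k is
    bounded by norm u0 times (C t)^k / k! as long as l stays in a bounded set.\<close>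
  define Y where "Y = rec_nat (\<lambda>l t. u0) (\<lambda>k y l t. integral {0..t} (\<lambda>s. prod (A l s) (y l s)))"
  have Y0: "Y 0 l t = u0" and YS: "Y (Suc k) l t = integral {0..t} (\<lambda>s. prod (A l s) (Y k l s))" for k l t
    by (simp_all add: Y_def)
  have contP: "continuous_on (UNIV \<times> {0..T}) (\<lambda>(l, s). prod (A l s) (y l s))"
    if "continuous_on (UNIV \<times> {0..T}) (\<lambda>(l, t). y l t)" for y
    using continuous_on[OF contA that] by (simp add: case_prod_beta)
  have contY: "continuous_on (UNIV \<times> {0..T}) (\<lambda>(l, t). Y k l t)" for k
  proof (induction k)
    case (Suc k)
    then show ?case unfolding YS by (intro continuous_on_integral_upper contP)
  qed (simp add: Y0)
  have sec: "continuous_on {0..T} (y l)" if "continuous_on (UNIV \<times> {0..T}) (\<lambda>(l, t). y l t)" for y :: "real \<Rightarrow> real \<Rightarrow> 'c::topological_space" and l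
  proof -
    have "continuous_on {0..T} (\<lambda>s. case (l, s) of (l, t) \<Rightarrow> y l t)"
      by (rule continuous_on_compose2[OF that]) (auto intro!: continuous_intros)
    then show ?thesis by simp
  qed
  have bound: "\<exists>C\<ge>0. \<forall>l\<in>{-r..r}. \<forall>t\<in>{0..T}. \<forall>k. norm (Y k l t) \<le> norm u0 * ((C * t) ^ k / fact k)" for r
  proof -
    have "compact ((\<lambda>(l, t). A l t) ` ({-r..r} \<times> {0..T}))"
      by (intro compact_continuous_image continuous_on_subset[OF contA] compact_Times) auto
    then have "bounded ((\<lambda>(l, t). A l t) ` ({-r..r} \<times> {0..T}))" by (rule compact_imp_bounded)
    then obtain M where M': "M > 0" "\<forall>x\<in>(\<lambda>(l, t). A l t) ` ({-r..r} \<times> {0..T}). norm x \<le> M"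
      unfolding bounded_pos by blast
    then have M: "M > 0" "\<And>l t. l \<in> {-r..r} \<Longrightarrow> t \<in> {0..T} \<Longrightarrow> norm (A l t) \<le> M" by auto
    define C where "C = M * K"
    have C: "C > 0" using M K by (simp add: C_def)
    have "norm (Y k l t) \<le> norm u0 * ((C * t) ^ k / fact k)" if l: "l \<in> {-r..r}" and t: "t \<in> {0..T}" for l t k
      using t
    proof (induction k arbitrary: t)
      case (Suc k)
      have sub: "{0..t} \<subseteq> {0..T}" using Suc by auto
      have "((\<lambda>s. norm u0 * (C ^ Suc k * s ^ k / fact k)) has_integral
          norm u0 * (C ^ Suc k * t ^ Suc k / fact (Suc k)) - norm u0 * (C ^ Suc k * 0 ^ Suc k / fact (Suc k))) {0..t}"
      proof (rule fundamental_theorem_of_calculus)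
        show "((\<lambda>s. norm u0 * (C ^ Suc k * s ^ Suc k / fact (Suc k))) has_vector_derivative
          norm u0 * (C ^ Suc k * s ^ k / fact k)) (at s within {0..t})" for s
        proof -
          let ?c = "norm u0 * C ^ Suc k / fact (Suc k)"
          have "((\<lambda>s. ?c * s ^ Suc k) has_real_derivative ?c * (real (Suc k) * s ^ k)) (at s within {0..t})"
            using DERIV_cmult[OF DERIV_pow[of "Suc k" s "{0..t}"], of ?c] by simp
          moreover have "?c * (real (Suc k) * s ^ k) = norm u0 * (C ^ Suc k * s ^ k / fact k)"
          proof -
            have "?c * real (Suc k) = norm u0 * C ^ Suc k / fact k"
              by (simp add: fact_Suc del: of_nat_Suc)
            then show ?thesis by (simp add: mult.assoc[symmetric] del: of_nat_Suc fact_Suc)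
          qed
          moreover have "(\<lambda>s. ?c * s ^ Suc k) = (\<lambda>s. norm u0 * (C ^ Suc k * s ^ Suc k / fact (Suc k)))"
            by (simp add: fun_eq_iff)
          ultimately show ?thesis
            unfolding has_real_derivative_iff_has_vector_derivative[symmetric] by (simp only:)
        qed
      qed (use Suc in auto)
      then have I: "((\<lambda>s. norm u0 * (C ^ Suc k * s ^ k / fact k)) has_integral
          norm u0 * ((C * t) ^ Suc k / fact (Suc k))) {0..t}"
        unfolding power_mult_distrib by (simp only: power_0_Suc mult_zero_right div_0 diff_zero)
      have "norm (Y (Suc k) l t) \<le> integral {0..t} (\<lambda>s. norm u0 * (C ^ Suc k * s ^ k / fact k))"
        unfolding YS
      proof (rule integral_norm_bound_integral)
        show "(\<lambda>s. prod (A l s) (Y k l s)) integrable_on {0..t}"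
          by (intro integrable_continuous_real continuous_on_subset[OF sec[OF contP[OF contY]] sub])
        show "(\<lambda>s. norm u0 * (C ^ Suc k * s ^ k / fact k)) integrable_on {0..t}" using I by blast
        fix s assume s: "s \<in> {0..t}"
        then have sT: "s \<in> {0..T}" using sub by blast
        have "norm (prod (A l s) (Y k l s)) \<le> norm (A l s) * norm (Y k l s) * K" by (rule K(2))
        also have "\<dots> \<le> M * (norm u0 * ((C * s) ^ k / fact k)) * K"
          using M(2)[OF l sT] Suc.IH[OF sT] K(1) M(1) by (intro mult_right_mono mult_mono) auto
        also have "\<dots> = norm u0 * (C ^ Suc k * s ^ k / fact k)"
          by (simp add: C_def power_mult_distrib field_simps)
        finally show "norm (prod (A l s) (Y k l s)) \<le> norm u0 * (C ^ Suc k * s ^ k / fact k)" .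
      qed
      then show ?case unfolding integral_unique[OF I] .
    qed (simp add: Y0)
    then show ?thesis using C by (intro exI[of _ C]) auto
  qed
  define Z where "Z l t = (\<Sum>k. Y k l t)" for l t
  have ul: "uniform_limit ({-r..r} \<times> {0..T}) (\<lambda>n (l, t). \<Sum>k<n. Y k l t) (\<lambda>(l, t). Z l t) sequentially" for r
  proof -
    obtain C where C: "C \<ge> 0" "\<forall>l\<in>{-r..r}. \<forall>t\<in>{0..T}. \<forall>k. norm (Y k l t) \<le> norm u0 * ((C * t) ^ k / fact k)"
      using bound by blast
    have "uniform_limit ({-r..r} \<times> {0..T}) (\<lambda>n x. \<Sum>k<n. (\<lambda>(l, t). Y k l t) x) (\<lambda>x. \<Sum>k. (\<lambda>(l, t). Y k l t) x) sequentially"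
    proof (rule Weierstrass_m_test)
      show "summable (\<lambda>k. norm u0 * ((C * T) ^ k / fact k))"
        using summable_exp[of "C * T"] by (intro summable_mult) (simp add: divide_inverse mult.commute)
      fix k and x :: "real \<times> real" assume x: "x \<in> {-r..r} \<times> {0..T}"
      then have "norm (Y k (fst x) (snd x)) \<le> norm u0 * ((C * snd x) ^ k / fact k)" using C(2) by auto
      also have "\<dots> \<le> norm u0 * ((C * T) ^ k / fact k)"
        using x C(1) by (intro mult_left_mono divide_right_mono power_mono) auto
      finally show "norm ((\<lambda>(l, t). Y k l t) x) \<le> norm u0 * ((C * T) ^ k / fact k)" by (simp add: case_prod_beta)
    qed
    then show ?thesis by (simp add: Z_def case_prod_unfold)
  qed
  have contS: "continuous_on (UNIV \<times> {0..T}) (\<lambda>(l, t). \<Sum>k<n. Y k l t)" for n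
    using contY unfolding case_prod_beta by (intro continuous_on_sum) auto
  have contZr: "continuous_on ({-r..r} \<times> {0..T}) (\<lambda>(l, t). Z l t)" for r
    by (rule uniform_limit_theorem[OF _ ul])
      (auto intro!: always_eventually continuous_on_subset[OF contS])
  have contZ: "continuous_on (UNIV \<times> {0..T}) (\<lambda>(l, t). Z l t)"
    unfolding continuous_on_eq_continuous_within
  proof
    fix x :: "real \<times> real" assume x: "x \<in> UNIV \<times> {0..T}"
    \<comment> \<open>The uniform bounds hold on bounded strips. The strip reaching one unit beyond
      the absolute value of \<open>fst x\<close> is a neighbourhood of x in the domain, and
      continuity is local.\<close>
    let ?r = "\<bar>fst x\<bar> + 1"
    have "at x within UNIV \<times> {0..T} = at x within {-?r..?r} \<times> {0..T}"
      by (rule at_within_nhd[of x "{-?r<..<?r} \<times> UNIV"]) (auto intro!: open_Times simp: mem_Times_iff)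
    moreover have "continuous (at x within {-?r..?r} \<times> {0..T}) (\<lambda>(l, t). Z l t)"
    proof -
      have "x \<in> {-?r..?r} \<times> {0..T}" using x by (auto simp: mem_Times_iff)
      then show ?thesis using contZr[of ?r] unfolding continuous_on_eq_continuous_within by blast
    qed
    ultimately show "continuous (at x within UNIV \<times> {0..T}) (\<lambda>(l, t). Z l t)" by simp
  qed
  have contPZ: "continuous_on {0..T} (\<lambda>s. prod (A l s) (Z l s))" for l
    by (rule sec[OF contP[OF contZ]])
  have eq: "Z l t = u0 + integral {0..t} (\<lambda>s. prod (A l s) (Z l s))" if t: "t \<in> {0..T}" for l t
  proof -
    let ?S = "\<lambda>n t. \<Sum>k<n. Y k l t"
    have sub: "{0..t} \<subseteq> {0..T}" using t by auto
    have ulT: "uniform_limit {0..T} ?S (Z l) sequentially"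
    proof (rule uniform_limitI)
      fix e :: real assume "e > 0"
      have "l \<in> {-\<bar>l\<bar>..\<bar>l\<bar>}" by auto
      then show "\<forall>\<^sub>F n in sequentially. \<forall>x\<in>{0..T}. dist (?S n x) (Z l x) < e"
        using uniform_limitD[OF ul[of "\<bar>l\<bar>"] \<open>e > 0\<close>] by (auto elim!: eventually_mono)
    qed
    have bA: "bounded (A l ` {0..T})"
      by (intro compact_imp_bounded compact_continuous_image sec[OF contA]) auto
    have bZ: "bounded (Z l ` {0..T})"
      by (intro compact_imp_bounded compact_continuous_image sec[OF contZ]) auto
    have "uniform_limit {0..T} (\<lambda>n s. prod (A l s) (?S n s)) (\<lambda>s. prod (A l s) (Z l s)) sequentially"
      by (rule bounded_uniform_limit[OF uniform_limit_const ulT bZ bA])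
    then have ul2: "uniform_limit {0..t} (\<lambda>n s. prod (A l s) (?S n s)) (\<lambda>s. prod (A l s) (Z l s)) sequentially"
      using sub by (rule uniform_limit_on_subset)
    have contn: "continuous_on {0..t} (\<lambda>s. prod (A l s) (?S n s))" for n
      using continuous_on_subset[OF sec[OF contP[OF contS[of n]]] sub] .
    obtain I J where IJ: "\<And>n. ((\<lambda>s. prod (A l s) (?S n s)) has_integral I n) {0..t}"
      "((\<lambda>s. prod (A l s) (Z l s)) has_integral J) {0..t}" "I \<longlonglongrightarrow> J"
      by (rule uniform_limit_integral[OF ul2 contn]) auto
    \<comment> \<open>Integrating the terms 0 to n - 1 produces the terms 1 to n, hence the partial
      sum with shifted index.\<close>
    have "?S (Suc n) t = u0 + I n" for n
    proof -
      have "I n = integral {0..t} (\<lambda>s. \<Sum>k<n. prod (A l s) (Y k l s))"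
        using IJ(1)[of n] by (simp add: integral_unique sum_right)
      also have "\<dots> = (\<Sum>k<n. integral {0..t} (\<lambda>s. prod (A l s) (Y k l s)))"
        by (intro integral_sum integrable_continuous_real continuous_on_subset[OF sec[OF contP[OF contY]] sub]) auto
      finally show ?thesis unfolding sum.lessThan_Suc_shift by (simp add: Y0 YS)
    qed
    then have "(\<lambda>n. ?S (Suc n) t) \<longlonglongrightarrow> u0 + J" using IJ(3) by (auto intro!: tendsto_intros)
    moreover have "(\<lambda>n. ?S (Suc n) t) \<longlonglongrightarrow> Z l t"
      by (rule LIMSEQ_Suc) (rule tendsto_uniform_limitI[OF ulT t])
    ultimately have "Z l t = u0 + J" using LIMSEQ_unique by blast
    then show ?thesis using IJ(2) by (simp add: integral_unique)
  qed
  have "Z l 0 = u0" for l using eq[of 0] assms(2) by simp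
  moreover have "(Z l has_vector_derivative prod (A l t) (Z l t)) (at t within {0..T})" if t: "t \<in> {0..T}" for l t
  proof -
    have "((\<lambda>t. integral {0..t} (\<lambda>s. prod (A l s) (Z l s))) has_vector_derivative prod (A l t) (Z l t)) (at t within {0..T})"
      by (rule integral_has_vector_derivative[OF contPZ t])
    then have "((\<lambda>t. u0 + integral {0..t} (\<lambda>s. prod (A l s) (Z l s))) has_vector_derivative prod (A l t) (Z l t)) (at t within {0..T})"
      by (auto intro!: derivative_eq_intros)
    then show ?thesis
      by (rule has_vector_derivative_transform[OF t, rotated]) (use eq in auto)
  qed
  ultimately show ?thesis using contZ by blast
qed

section \<open>The coefficients along the critical point\<close>

text \<open>Directions w with \<open>fst w = 0\<close> keep whole lines inside the slab, so
  derivatives in u and v are two-sided also at t = 0 and t = T, although differentiability is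
  relative to the slab.\<close>

locale C2_slab =
  fixes T :: real and L :: "real \<Rightarrow> real^'n \<Rightarrow> real^'n \<Rightarrow> real"
    and f' :: "real \<times> (real^'n) \<times> (real^'n) \<Rightarrow> (real \<times> (real^'n) \<times> (real^'n)) \<Rightarrow>\<^sub>L real"
    and f'' :: "real \<times> (real^'n) \<times> (real^'n) \<Rightarrow>
      (real \<times> (real^'n) \<times> (real^'n)) \<Rightarrow>\<^sub>L ((real \<times> (real^'n) \<times> (real^'n)) \<Rightarrow>\<^sub>L real)"
  assumes d1: "p \<in> {0..T} \<times> UNIV \<Longrightarrow>
      ((\<lambda>(t, u, v). L t u v) has_derivative blinfun_apply (f' p)) (at p within {0..T} \<times> UNIV)"
    and d2: "p \<in> {0..T} \<times> UNIV \<Longrightarrow>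
      (f' has_derivative blinfun_apply (f'' p)) (at p within {0..T} \<times> UNIV)"
    and c2: "continuous_on ({0..T} \<times> UNIV) f''"
begin

abbreviation f where "f \<equiv> \<lambda>(t, u, v). L t u v"

lemma mem_line: "p \<in> {0..T} \<times> UNIV \<Longrightarrow> fst w = 0 \<Longrightarrow> p + s *\<^sub>R w \<in> {0..T} \<times> UNIV"
  by (auto simp: mem_Times_iff)

lemma deriv_line:
  assumes "(F has_derivative F') (at (p + s *\<^sub>R w) within {0..T} \<times> UNIV)" "p \<in> {0..T} \<times> UNIV" "fst w = 0"
  shows "((\<lambda>s. F (p + s *\<^sub>R w)) has_derivative (\<lambda>h. F' (h *\<^sub>R w))) (at s)"
proof -
  have "((\<lambda>s. p + s *\<^sub>R w) has_derivative (\<lambda>h. h *\<^sub>R w)) (at s)"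
    by (auto intro!: derivative_eq_intros)
  moreover have "(F has_derivative F') (at (p + s *\<^sub>R w) within range (\<lambda>s. p + s *\<^sub>R w))"
    using assms(1) by (rule has_derivative_subset) (use mem_line[OF assms(2,3)] in blast)
  ultimately show ?thesis using has_derivative_in_compose by fastforce
qed

lemma deriv1:
  assumes "p \<in> {0..T} \<times> UNIV" "fst w = 0"
  shows "((\<lambda>s. f (p + s *\<^sub>R w)) has_real_derivative f' (p + s *\<^sub>R w) w) (at s)"
  using deriv_line[OF d1[OF mem_line[OF assms]] assms, of s]
  by (rule has_derivative_imp_has_field_derivative) (simp add: blinfun.scaleR_right mult.commute)

lemma deriv2:
  assumes "p \<in> {0..T} \<times> UNIV" "fst w = 0"
  shows "((\<lambda>s. f' (p + s *\<^sub>R w) z) has_real_derivative f'' (p + s *\<^sub>R w) w z) (at s)"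
proof -
  have "((\<lambda>s. f' (p + s *\<^sub>R w) z) has_derivative (\<lambda>h. f'' (p + s *\<^sub>R w) (h *\<^sub>R w) z)) (at s)"
    using deriv_line[OF d2[OF mem_line[OF assms]] assms, of s]
    by (rule bounded_linear.has_derivative[OF blinfun.bounded_linear_left])
  then show ?thesis
    by (rule has_derivative_imp_has_field_derivative)
      (simp add: blinfun.scaleR_right blinfun.scaleR_left mult.commute)
qed

text \<open>Mean value theorem twice: along w for the difference in direction z, then along z. The
  left-hand side is symmetric in w and z, which is exploited next.\<close>

lemma second_difference:
  assumes p: "p \<in> {0..T} \<times> UNIV" and w: "fst w = 0" "fst z = 0" and h: "h > 0"
  shows "\<exists>a b. 0 \<le> a \<and> a \<le> h \<and> 0 \<le> b \<and> b \<le> h \<and>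
    f (p + h *\<^sub>R w + h *\<^sub>R z) - f (p + h *\<^sub>R w) - f (p + h *\<^sub>R z) + f p
      = h * (h * f'' (p + a *\<^sub>R w + b *\<^sub>R z) z w)"
proof -
  have "\<exists>a>0. a < h \<and> (f (p + h *\<^sub>R z + h *\<^sub>R w) - f (p + h *\<^sub>R w)) - (f (p + h *\<^sub>R z + 0 *\<^sub>R w) - f (p + 0 *\<^sub>R w))
      = (h - 0) * (f' (p + h *\<^sub>R z + a *\<^sub>R w) w - f' (p + a *\<^sub>R w) w)"
    by (rule MVT2[OF h, of "\<lambda>s. f (p + h *\<^sub>R z + s *\<^sub>R w) - f (p + s *\<^sub>R w)"
          "\<lambda>s. f' (p + h *\<^sub>R z + s *\<^sub>R w) w - f' (p + s *\<^sub>R w) w"])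
      (rule DERIV_diff[OF deriv1[OF mem_line[OF p w(2)] w(1)] deriv1[OF p w(1)]])
  then obtain a where a: "0 < a" "a < h" "f (p + h *\<^sub>R z + h *\<^sub>R w) - f (p + h *\<^sub>R w) - (f (p + h *\<^sub>R z) - f p)
      = h * (f' (p + h *\<^sub>R z + a *\<^sub>R w) w - f' (p + a *\<^sub>R w) w)"
    by auto
  have "\<exists>b>0. b < h \<and> f' (p + a *\<^sub>R w + h *\<^sub>R z) w - f' (p + a *\<^sub>R w + 0 *\<^sub>R z) w
      = (h - 0) * f'' (p + a *\<^sub>R w + b *\<^sub>R z) z w"
    by (rule MVT2[OF h]) (rule deriv2[OF mem_line[OF p w(1)] w(2)])
  then obtain b where b: "0 < b" "b < h" "f' (p + a *\<^sub>R w + h *\<^sub>R z) w - f' (p + a *\<^sub>R w) w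
      = h * f'' (p + a *\<^sub>R w + b *\<^sub>R z) z w"
    by auto
  have comm: "p + h *\<^sub>R z + s *\<^sub>R w = p + s *\<^sub>R w + h *\<^sub>R z" for s by (simp add: algebra_simps)
  have "f (p + h *\<^sub>R w + h *\<^sub>R z) - f (p + h *\<^sub>R w) - f (p + h *\<^sub>R z) + f p
      = h * (h * f'' (p + a *\<^sub>R w + b *\<^sub>R z) z w)"
    using a(3) b(3) unfolding comm by simp
  then show ?thesis using a b by (intro exI[of _ a] exI[of _ b]) auto
qed

text \<open>Schwarz's theorem: evaluating the second difference in both orders gives equal values of
  \<open>f''\<close> at intermediate points, which tend to p as the step shrinks.\<close>

lemma second_derivative_symmetric:
  assumes p: "p \<in> {0..T} \<times> UNIV" and w: "fst w = 0" "fst z = 0"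
  shows "f'' p w z = f'' p z w"
proof -
  have "\<exists>a b c d. 0 \<le> a \<and> a \<le> h \<and> 0 \<le> b \<and> b \<le> h \<and> 0 \<le> c \<and> c \<le> h \<and> 0 \<le> d \<and> d \<le> h \<and>
      f'' (p + a *\<^sub>R w + b *\<^sub>R z) z w = f'' (p + c *\<^sub>R w + d *\<^sub>R z) w z" if h: "h > 0" for h
  proof -
    obtain a b where ab: "0 \<le> a" "a \<le> h" "0 \<le> b" "b \<le> h"
      "f (p + h *\<^sub>R w + h *\<^sub>R z) - f (p + h *\<^sub>R w) - f (p + h *\<^sub>R z) + f p
        = h * (h * f'' (p + a *\<^sub>R w + b *\<^sub>R z) z w)"
      using second_difference[OF p w h] by blast
    obtain d c where cd: "0 \<le> d" "d \<le> h" "0 \<le> c" "c \<le> h"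
      "f (p + h *\<^sub>R z + h *\<^sub>R w) - f (p + h *\<^sub>R z) - f (p + h *\<^sub>R w) + f p
        = h * (h * f'' (p + d *\<^sub>R z + c *\<^sub>R w) w z)"
      using second_difference[OF p w(2,1) h] by blast
    have eq: "p + h *\<^sub>R z + h *\<^sub>R w = p + h *\<^sub>R w + h *\<^sub>R z" "p + d *\<^sub>R z + c *\<^sub>R w = p + c *\<^sub>R w + d *\<^sub>R z"
      by (simp_all add: algebra_simps)
    have "h * (h * f'' (p + a *\<^sub>R w + b *\<^sub>R z) z w) = h * (h * f'' (p + c *\<^sub>R w + d *\<^sub>R z) w z)"
      using ab(5) cd(5)[unfolded eq] by linarith
    then have "f'' (p + a *\<^sub>R w + b *\<^sub>R z) z w = f'' (p + c *\<^sub>R w + d *\<^sub>R z) w z" using h by simp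
    then show ?thesis using ab cd by blast
  qed
  then have "\<forall>n. \<exists>a b c d. 0 \<le> a \<and> a \<le> inverse (real (Suc n)) \<and> 0 \<le> b \<and> b \<le> inverse (real (Suc n)) \<and>
      0 \<le> c \<and> c \<le> inverse (real (Suc n)) \<and> 0 \<le> d \<and> d \<le> inverse (real (Suc n)) \<and>
      f'' (p + a *\<^sub>R w + b *\<^sub>R z) z w = f'' (p + c *\<^sub>R w + d *\<^sub>R z) w z"
    by simp
  then obtain a b c d where *: "\<And>n. 0 \<le> a n \<and> a n \<le> inverse (real (Suc n)) \<and> 0 \<le> b n \<and> b n \<le> inverse (real (Suc n)) \<and>
      0 \<le> c n \<and> c n \<le> inverse (real (Suc n)) \<and> 0 \<le> d n \<and> d n \<le> inverse (real (Suc n)) \<and>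
      f'' (p + a n *\<^sub>R w + b n *\<^sub>R z) z w = f'' (p + c n *\<^sub>R w + d n *\<^sub>R z) w z"
    by metis
  have lim0: "s \<longlonglongrightarrow> 0" if "\<And>n. 0 \<le> s n \<and> s n \<le> inverse (real (Suc n))" for s :: "nat \<Rightarrow> real"
    by (rule tendsto_sandwich[OF _ _ tendsto_const LIMSEQ_inverse_real_of_nat]) (use that in auto)
  have lim: "(\<lambda>n. f'' (p + s n *\<^sub>R w + r n *\<^sub>R z) y y') \<longlonglongrightarrow> f'' p y y'"
    if "s \<longlonglongrightarrow> 0" "r \<longlonglongrightarrow> 0" for s r y y'
  proof -
    have "(\<lambda>n. p + s n *\<^sub>R w + r n *\<^sub>R z) \<longlonglongrightarrow> p + 0 *\<^sub>R w + 0 *\<^sub>R z"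
      by (intro tendsto_intros that)
    then have "(\<lambda>n. p + s n *\<^sub>R w + r n *\<^sub>R z) \<longlonglongrightarrow> p" by simp
    then have "(\<lambda>n. f'' (p + s n *\<^sub>R w + r n *\<^sub>R z)) \<longlonglongrightarrow> f'' p"
      by (rule continuous_on_tendsto_compose[OF c2])
        (use p mem_line[OF mem_line[OF p w(1)] w(2)] in auto)
    then show ?thesis by (intro tendsto_intros)
  qed
  have "(\<lambda>n. f'' (p + a n *\<^sub>R w + b n *\<^sub>R z) z w) \<longlonglongrightarrow> f'' p z w" by (intro lim lim0) (use * in auto)
  moreover have "(\<lambda>n. f'' (p + c n *\<^sub>R w + d n *\<^sub>R z) w z) \<longlonglongrightarrow> f'' p w z" by (intro lim lim0) (use * in auto)
  ultimately show ?thesis using * LIMSEQ_unique by simp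
qed

lemma pd_u_eq: "t \<in> {0..T} \<Longrightarrow> pd_u i L t u v = f' (t, u, v) (0, axis i 1, 0)"
  using deriv1[of "(t, u, v)" "(0, axis i 1, 0)" 0]
  unfolding pd_u_def by (intro DERIV_imp_deriv) simp

lemma pd_v_eq: "t \<in> {0..T} \<Longrightarrow> pd_v i L t u v = f' (t, u, v) (0, 0, axis i 1)"
  using deriv1[of "(t, u, v)" "(0, 0, axis i 1)" 0]
  unfolding pd_v_def by (intro DERIV_imp_deriv) simp

lemma D2_eq:
  assumes t: "t \<in> {0..T}"
  shows "D2_vv L t u v $ i $ j = f'' (t, u, v) (0, 0, axis i 1) (0, 0, axis j 1)"
    and "D2_vu L t u v $ i $ j = f'' (t, u, v) (0, 0, axis i 1) (0, axis j 1, 0)"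
    and "D2_uu L t u v $ i $ j = f'' (t, u, v) (0, axis i 1, 0) (0, axis j 1, 0)"
proof -
  have "D2_vv L t u v $ i $ j = deriv (\<lambda>s. pd_v j L t u (v + s *\<^sub>R axis i 1)) 0"
    by (simp add: D2_vv_def pd_v_def[of i])
  also have "\<dots> = f'' (t, u, v) (0, 0, axis i 1) (0, 0, axis j 1)"
    unfolding pd_v_eq[OF t]
    using deriv2[of "(t, u, v)" "(0, 0, axis i 1)" "(0, 0, axis j 1)" 0] t
    by (intro DERIV_imp_deriv) simp
  finally show "D2_vv L t u v $ i $ j = f'' (t, u, v) (0, 0, axis i 1) (0, 0, axis j 1)" .
  have "D2_vu L t u v $ i $ j = deriv (\<lambda>s. pd_u j L t u (v + s *\<^sub>R axis i 1)) 0"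
    by (simp add: D2_vu_def pd_v_def[of i])
  also have "\<dots> = f'' (t, u, v) (0, 0, axis i 1) (0, axis j 1, 0)"
    unfolding pd_u_eq[OF t]
    using deriv2[of "(t, u, v)" "(0, 0, axis i 1)" "(0, axis j 1, 0)" 0] t
    by (intro DERIV_imp_deriv) simp
  finally show "D2_vu L t u v $ i $ j = f'' (t, u, v) (0, 0, axis i 1) (0, axis j 1, 0)" .
  have "D2_uu L t u v $ i $ j = deriv (\<lambda>s. pd_u j L t (u + s *\<^sub>R axis i 1) v) 0"
    by (simp add: D2_uu_def pd_u_def[of i])
  also have "\<dots> = f'' (t, u, v) (0, axis i 1, 0) (0, axis j 1, 0)"
    unfolding pd_u_eq[OF t]
    using deriv2[of "(t, u, v)" "(0, axis i 1, 0)" "(0, axis j 1, 0)" 0] t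
    by (intro DERIV_imp_deriv) simp
  finally show "D2_uu L t u v $ i $ j = f'' (t, u, v) (0, axis i 1, 0) (0, axis j 1, 0)" .
qed

lemma coefficients:
  assumes "continuous_on {0..T} x" "continuous_on {0..T} v"
  shows "continuous_on {0..T} (\<lambda>t. D2_vv L t (x t) (v t))"
    and "continuous_on {0..T} (\<lambda>t. D2_vu L t (x t) (v t))"
    and "continuous_on {0..T} (\<lambda>t. D2_uu L t (x t) (v t))"
    and "t \<in> {0..T} \<Longrightarrow> transpose (D2_vv L t (x t) (v t)) = D2_vv L t (x t) (v t)"
    and "t \<in> {0..T} \<Longrightarrow> transpose (D2_uu L t (x t) (v t)) = D2_uu L t (x t) (v t)"
proof -
  have c: "continuous_on {0..T} (\<lambda>t. f'' (t, x t, v t) y z)" for y z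
  proof -
    have "continuous_on {0..T} (\<lambda>t. f'' (t, x t, v t))"
      by (rule continuous_on_compose2[OF c2]) (auto intro!: continuous_intros assms)
    then show ?thesis by (intro continuous_intros)
  qed
  have m: "continuous_on {0..T} M" if "\<And>i j. continuous_on {0..T} (\<lambda>t. M t $ i $ j)" for M :: "real \<Rightarrow> real^'n^'n"
  proof -
    have "continuous_on {0..T} (\<lambda>t. \<chi> i j. M t $ i $ j)"
      by (intro continuous_on_vec_lambda that)
    then show ?thesis by simp
  qed
  show "continuous_on {0..T} (\<lambda>t. D2_vv L t (x t) (v t))"
    by (rule m, rule continuous_on_eq[OF c]) (simp add: D2_eq(1))
  show "continuous_on {0..T} (\<lambda>t. D2_vu L t (x t) (v t))"
    by (rule m, rule continuous_on_eq[OF c]) (simp add: D2_eq(2))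
  show "continuous_on {0..T} (\<lambda>t. D2_uu L t (x t) (v t))"
    by (rule m, rule continuous_on_eq[OF c]) (simp add: D2_eq(3))
  show "transpose (D2_vv L t (x t) (v t)) = D2_vv L t (x t) (v t)" if "t \<in> {0..T}" for t
    using that by (simp add: transpose_def vec_eq_iff D2_eq second_derivative_symmetric)
  show "transpose (D2_uu L t (x t) (v t)) = D2_uu L t (x t) (v t)" if "t \<in> {0..T}" for t
    using that by (simp add: transpose_def vec_eq_iff D2_eq second_derivative_symmetric)
qed

end

section \<open>Matrices\<close>

lemma continuous_on_matrix:
  assumes "\<And>i j. continuous_on S (\<lambda>x. M x $ i $ j)"
  shows "continuous_on S (M :: 'b::topological_space \<Rightarrow> 'a::real_normed_vector^'n^'m)"
proof -
  have "continuous_on S (\<lambda>x. \<chi> i j. M x $ i $ j)" by (intro continuous_on_vec_lambda assms)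
  then show ?thesis by simp
qed

lemma continuous_on_matrix_mult [continuous_intros]:
  fixes F :: "'b::topological_space \<Rightarrow> 'a::{real_normed_field}^'n^'m" and G :: "'b \<Rightarrow> 'a^'p^'n"
  assumes "continuous_on S F" "continuous_on S G"
  shows "continuous_on S (\<lambda>x. F x ** G x)"
  by (rule continuous_on_matrix) (auto simp: matrix_matrix_mult_def intro!: continuous_intros assms)

lemma continuous_on_matrix_vector_mult [continuous_intros]:
  fixes F :: "'b::topological_space \<Rightarrow> 'a::{real_normed_field}^'n^'m" and G :: "'b \<Rightarrow> 'a^'n"
  assumes "continuous_on S F" "continuous_on S G"
  shows "continuous_on S (\<lambda>x. F x *v G x)"
  unfolding matrix_vector_mult_def by (intro continuous_on_vec_lambda continuous_intros assms)

lemma continuous_on_cmat [continuous_intros]: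
  "continuous_on S F \<Longrightarrow> continuous_on S (\<lambda>x. cmat (F x))"
  by (rule continuous_on_matrix) (auto simp: cmat_def intro!: continuous_intros)

lemma continuous_on_transpose [continuous_intros]:
  fixes F :: "'b::topological_space \<Rightarrow> 'a::real_normed_vector^'n^'m"
  shows "continuous_on S F \<Longrightarrow> continuous_on S (\<lambda>x. transpose (F x))"
  by (rule continuous_on_matrix) (auto simp: transpose_def intro!: continuous_intros)

lemma continuous_on_block_mat [continuous_intros]:
  fixes A :: "'b::topological_space \<Rightarrow> 'a::real_normed_vector^'n^'m"
  assumes "continuous_on S A" "continuous_on S B" "continuous_on S C" "continuous_on S D"
  shows "continuous_on S (\<lambda>x. block_mat (A x) (B x) (C x) (D x))"
proof (rule continuous_on_matrix)
  fix i j
  show "continuous_on S (\<lambda>x. block_mat (A x) (B x) (C x) (D x) $ i $ j)"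
    using assms by (cases i; cases j) (auto simp: block_mat_def intro!: continuous_intros)
qed

lemma bounded_bilinear_matrix_mult:
  "bounded_bilinear ((**) :: complex^'n^'m \<Rightarrow> complex^'p^'n \<Rightarrow> complex^'p^'m)"
  unfolding bilinear_conv_bounded_bilinear[symmetric] bilinear_def
  by (auto intro!: linearI simp: matrix_matrix_mult_def vec_eq_iff sum.distrib scaleR_sum_right algebra_simps)

lemma bounded_bilinear_matrix_vector_mult:
  "bounded_bilinear ((*v) :: complex^'n^'m \<Rightarrow> complex^'n \<Rightarrow> complex^'m)"
  unfolding bilinear_conv_bounded_bilinear[symmetric] bilinear_def
  by (auto intro!: linearI simp: matrix_vector_mult_def vec_eq_iff sum.distrib scaleR_sum_right algebra_simps)

lemma bounded_bilinear_hinner: "bounded_bilinear (hinner :: complex^'n \<Rightarrow> complex^'n \<Rightarrow> complex)"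
  unfolding bilinear_conv_bounded_bilinear[symmetric] bilinear_def
  by (auto intro!: linearI simp: hinner_add_left hinner_add_right scaleR_vec_complex hinner_scale_left
      hinner_scale_right scaleR_conv_of_real)

lemma cmat_mult: "cmat (A ** B) = cmat A ** cmat B"
  by (simp add: cmat_def matrix_matrix_mult_def vec_eq_iff)

lemma cmat_diff: "cmat (A - B) = cmat A - cmat B"
  and cmat_minus: "cmat (- A) = - cmat A"
  by (simp_all add: cmat_def vec_eq_iff)

lemma cmat_mat: "cmat (l *\<^sub>R mat 1) *v x = complex_of_real l *s x"
proof -
  have "complex_of_real (l * (if i = j then 1 else 0)) * x $ j = (if i = j then of_real l * x $ j else 0)" for i j
    by simp
  then show ?thesis
    unfolding cmat_def mat_def matrix_vector_mult_def vec_eq_iff by simp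
qed

lemma cmat_block: "cmat (block_mat A B C D) = block_mat (cmat A) (cmat B) (cmat C) (cmat D)"
  by (auto simp: cmat_def block_mat_def vec_eq_iff split: sum.split)

lemma cmat_one: "cmat (mat 1) = mat 1"
  by (simp add: cmat_def mat_def vec_eq_iff)

lemma hinner_cmat: "hinner (cmat A *v x) y = hinner x (cmat (transpose A) *v y)"
proof -
  have "hinner (cmat A *v x) y = (\<Sum>i\<in>UNIV. \<Sum>j\<in>UNIV. complex_of_real (A $ i $ j) * x $ j * cnj (y $ i))"
    by (simp add: hinner_def cmat_def matrix_vector_mult_def sum_distrib_right)
  also have "\<dots> = (\<Sum>j\<in>UNIV. \<Sum>i\<in>UNIV. complex_of_real (A $ i $ j) * x $ j * cnj (y $ i))"
    by (rule sum.swap)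
  also have "\<dots> = hinner x (cmat (transpose A) *v y)"
    by (simp add: hinner_def cmat_def matrix_vector_mult_def transpose_def cnj_sum sum_distrib_left
        mult.assoc mult.left_commute)
  finally show ?thesis .
qed

lemma matrix_vector_minus_left: "(- A) *v (x :: 'a::comm_ring_1^'n) = - (A *v x)"
  by (simp add: matrix_vector_mult_def vec_eq_iff sum_negf)

lemma Re_hinner_cmat:
  "Re (hinner (cmat A *v x) x) = (A *v (\<chi> i. Re (x $ i))) \<bullet> (\<chi> i. Re (x $ i)) + (A *v (\<chi> i. Im (x $ i))) \<bullet> (\<chi> i. Im (x $ i))"
  by (simp add: hinner_def cmat_def matrix_vector_mult_def inner_vec_def sum_distrib_right
      sum.distrib[symmetric] algebra_simps)

lemma norm_hinner_le: "norm (hinner a b) \<le> norm a * norm b"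
proof -
  have "norm (hinner a b) \<le> (\<Sum>i\<in>UNIV. \<bar>norm (a $ i)\<bar> * \<bar>norm (b $ i)\<bar>)"
    unfolding hinner_def by (rule order_trans[OF norm_sum]) (simp add: norm_mult)
  also have "\<dots> \<le> norm a * norm b"
    unfolding norm_vec_def by (rule L2_set_mult_ineq)
  finally show ?thesis .
qed

section \<open>The linear Hamiltonian system\<close>

locale linear_system =
  fixes T :: real and P Q R :: "real \<Rightarrow> real^'n::finite^'n"
  assumes T: "T > 0"
    and contP: "continuous_on {0..T} P" and contQ: "continuous_on {0..T} Q" and contR: "continuous_on {0..T} R"
    and symP: "t \<in> {0..T} \<Longrightarrow> transpose (P t) = P t" and symR: "t \<in> {0..T} \<Longrightarrow> transpose (R t) = R t"
    and posP: "t \<in> {0..T} \<Longrightarrow> w \<noteq> 0 \<Longrightarrow> (P t *v w) \<bullet> w > 0"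
begin

text \<open>Minimum of a positive continuous function on [0, T] times the unit sphere. Uniformity in
  t serves both the continuity of the inverse of P and the energy bound.\<close>

lemma elliptic: "\<exists>c>0. \<forall>t\<in>{0..T}. \<forall>w. (P t *v w) \<bullet> w \<ge> c * (norm w)\<^sup>2"
proof -
  let ?F = "\<lambda>x. (P (fst x) *v snd x) \<bullet> snd x"
  have "continuous_on ({0..T} \<times> sphere 0 1) (\<lambda>x. P (fst x))"
    by (rule continuous_on_compose2[OF contP]) (auto intro!: continuous_intros)
  then have cont: "continuous_on ({0..T} \<times> sphere 0 1) ?F" by (intro continuous_intros)
  have "{0..T} \<times> sphere (0::real^'n) 1 \<noteq> {}" using T by (auto simp: sphere_eq_empty)
  then obtain x where x: "x \<in> {0..T} \<times> sphere 0 1" "\<forall>y\<in>{0..T} \<times> sphere 0 1. ?F x \<le> ?F y"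
    using continuous_attains_inf[OF compact_Times[OF compact_Icc compact_sphere] _ cont] by blast
  have "snd x \<noteq> 0" using x(1) by auto
  then have c: "?F x > 0" using posP x(1) by (auto simp: mem_Times_iff)
  have "(P t *v w) \<bullet> w \<ge> ?F x * (norm w)\<^sup>2" if t: "t \<in> {0..T}" for t w
  proof (cases "w = 0")
    case False
    have "(t, (1 / norm w) *\<^sub>R w) \<in> {0..T} \<times> sphere 0 1" using False t by simp
    then have "?F x \<le> ?F (t, (1 / norm w) *\<^sub>R w)" using x(2) by blast
    also have "\<dots> = ((P t *v w) \<bullet> w) / (norm w)\<^sup>2"
      by (simp add: matrix_vector_mult_scaleR power2_eq_square)
    finally show ?thesis using False by (simp add: field_simps)
  qed simp
  then show ?thesis using c by blast
qed

definition Pi where "Pi t = matrix_inv (P t)"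

lemma P_inv:
  assumes "t \<in> {0..T}" shows "Pi t ** P t = mat 1" "P t ** Pi t = mat 1"
proof -
  have "w = 0" if "P t *v w = 0" for w using posP[OF assms, of w] that by (cases "w = 0") auto
  then have "invertible (P t)"
    unfolding invertible_left_inverse matrix_left_invertible_ker by blast
  then show "Pi t ** P t = mat 1" "P t ** Pi t = mat 1"
    unfolding Pi_def matrix_inv_def invertible_def by (metis (mono_tags, lifting) someI_ex)+
qed

text \<open>Ellipticity bounds the inverse uniformly, and the resolvent identity turns differences
  of inverses into differences of P.\<close>

lemma contPi: "continuous_on {0..T} Pi"
proof -
  obtain c where c: "c > 0" "\<And>t w. t \<in> {0..T} \<Longrightarrow> (P t *v w) \<bullet> w \<ge> c * (norm w)\<^sup>2"
    using elliptic by blast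
  have bd: "norm (Pi t *v w) \<le> norm w / c" if "t \<in> {0..T}" for t w
  proof -
    let ?u = "Pi t *v w"
    have w: "P t *v ?u = w" using P_inv[OF that] by (simp add: matrix_vector_mul_assoc)
    have "c * (norm ?u * norm ?u) \<le> norm w * norm ?u"
      using c(2)[OF that, of ?u] norm_cauchy_schwarz[of w ?u] unfolding w power2_eq_square by linarith
    then have "c * norm ?u \<le> norm w"
      by (cases "norm ?u = 0") (auto simp: mult.assoc[symmetric] mult_le_cancel_right)
    then show ?thesis using c(1) by (simp add: field_simps)
  qed
  have "continuous_on {0..T} (\<lambda>t. Pi t *v w)" for w
    unfolding continuous_on_eq_continuous_within continuous_within
  proof
    fix t0 assume t0: "t0 \<in> {0..T}"
    let ?v = "Pi t0 *v w"
    have lim: "((\<lambda>t. (P t0 - P t) *v ?v) \<longlongrightarrow> (P t0 - P t0) *v ?v) (at t0 within {0..T})"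
    proof -
      have "continuous_on {0..T} (\<lambda>t. (P t0 - P t) *v ?v)" by (intro continuous_intros contP)
      then show ?thesis using t0 unfolding continuous_on by blast
    qed
    have "((\<lambda>t. norm ((P t0 - P t) *v ?v) / c) \<longlongrightarrow> norm ((P t0 - P t0) *v ?v) / c) (at t0 within {0..T})"
      using c(1) by (intro tendsto_intros lim) auto
    then have l0: "((\<lambda>t. norm ((P t0 - P t) *v ?v) / c) \<longlongrightarrow> 0) (at t0 within {0..T})" by simp
    have "((\<lambda>t. Pi t *v w - Pi t0 *v w) \<longlongrightarrow> 0) (at t0 within {0..T})"
    proof (rule Lim_null_comparison[OF _ l0])
      have "norm (Pi t *v w - Pi t0 *v w) \<le> norm ((P t0 - P t) *v ?v) / c" if "t \<in> {0..T}" for t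
      proof -
        have "P t0 *v ?v = w" using P_inv[OF t0] by (simp add: matrix_vector_mul_assoc)
        moreover have "Pi t *v (P t *v ?v) = ?v"
          using P_inv(1)[OF that] matrix_vector_mul_assoc[of "Pi t" "P t" ?v] by simp
        ultimately have "Pi t *v ((P t0 - P t) *v ?v) = Pi t *v w - Pi t0 *v w"
          by (simp add: matrix_vector_mult_diff_rdistrib matrix_vector_mult_diff_distrib)
        then show ?thesis using bd[OF that, of "(P t0 - P t) *v ?v"] by simp
      qed
      then show "\<forall>\<^sub>F t in at t0 within {0..T}. norm (Pi t *v w - Pi t0 *v w) \<le> norm ((P t0 - P t) *v ?v) / c"
        by (auto simp: eventually_at_filter)
    qed
    then show "((\<lambda>t. Pi t *v w) \<longlongrightarrow> Pi t0 *v w) (at t0 within {0..T})"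
      by (simp add: Lim_null[symmetric])
  qed
  note cw = this
  show ?thesis
  proof (rule continuous_on_matrix)
    fix i j
    have "continuous_on {0..T} (\<lambda>t. (Pi t *v axis j 1) $ i)" by (intro continuous_intros cw)
    then show "continuous_on {0..T} (\<lambda>t. Pi t $ i $ j)"
      by (simp add: matrix_vector_mul_component inner_axis)
  qed
qed

text \<open>The derivative of \<xi> recovered from z = (y, \<xi>) by solving y = P \<eta> + Q
  \<xi>.\<close>

definition eta :: "real \<Rightarrow> complex^('n + 'n) \<Rightarrow> complex^'n" where
  "eta t z = cmat (Pi t) *v (vfst z - cmat (Q t) *v vsnd z)"

text \<open>The eigenvalue equation for l, written as a first-order system for (y, \<xi>).\<close>

definition rhs :: "real \<Rightarrow> real \<Rightarrow> complex^('n + 'n) \<Rightarrow> complex^('n + 'n)" where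
  "rhs l t z = vjoin (cmat (transpose (Q t)) *v eta t z + cmat (R t) *v vsnd z - complex_of_real l *s vsnd z) (eta t z)"

text \<open>Coefficient matrix of that system in Hamiltonian form; at l = 0 it is the one of the
  given fundamental solution.\<close>

definition A :: "real \<Rightarrow> real \<Rightarrow> complex^('n + 'n)^('n + 'n)" where
  "A l t = J_mat ** cmat (B_mat (P t) (Q t) (R t - l *\<^sub>R mat 1))"

lemma A_rhs: "A l t *v z = rhs l t z"
proof -
  let ?y = "vfst z" and ?x = "vsnd z"
  have e: "eta t z = cmat (Pi t) *v ?y - cmat (Pi t) *v (cmat (Q t) *v ?x)"
    by (simp add: eta_def matrix_vector_mult_diff_distrib)
  have "cmat (B_mat (P t) (Q t) (R t - l *\<^sub>R mat 1)) *v z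
      = vjoin (eta t z) (- (cmat (transpose (Q t)) *v eta t z) - (cmat (R t) *v ?x - complex_of_real l *s ?x))"
    unfolding B_mat_def cmat_block block_mat_mult Pi_def[symmetric] e
    by (simp add: cmat_mult cmat_diff cmat_minus cmat_mat matrix_vector_minus_left
        matrix_vector_mult_diff_rdistrib matrix_vector_mult_diff_distrib matrix_vector_mul_assoc[symmetric])
  then show ?thesis
    unfolding A_def matrix_vector_mul_assoc[symmetric] by (simp add: J_mat_mult rhs_def)
qed

lemma contA: "continuous_on (UNIV \<times> {0..T}) (\<lambda>(l, t). A l t)"
proof -
  have c: "continuous_on (UNIV \<times> {0..T}) (\<lambda>x. M (snd x))" if "continuous_on {0..T} M" for M :: "real \<Rightarrow> real^'n^'n"
    by (rule continuous_on_compose2[OF that]) (auto intro!: continuous_intros)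
  show ?thesis
    unfolding A_def B_mat_def Pi_def[symmetric] case_prod_beta
    by (intro continuous_intros c contQ contR contPi)
qed

lemma contA0: "continuous_on {0..T} (\<lambda>t. A l t)"
proof -
  have "continuous_on {0..T} (\<lambda>t. case (l, t) of (l, t) \<Rightarrow> A l t)"
    by (rule continuous_on_compose2[OF contA]) (auto intro!: continuous_intros)
  then show ?thesis by simp
qed

definition sol :: "real \<Rightarrow> (real \<Rightarrow> complex^('n + 'n)) \<Rightarrow> bool" where
  "sol l z \<longleftrightarrow> (\<forall>t\<in>{0..T}. (z has_vector_derivative rhs l t (z t)) (at t within {0..T}))"

lemma y_eq:
  assumes "t \<in> {0..T}" shows "vfst z = cmat (P t) *v eta t z + cmat (Q t) *v vsnd z"
  using P_inv(2)[OF assms]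
  by (simp add: eta_def matrix_vector_mul_assoc cmat_mult[symmetric] cmat_one)

text \<open>Pointwise Lagrange identity: P and R are symmetric and Q is paired with its transpose,
  so everything cancels except the terms with l and m.\<close>

lemma omega_rhs:
  assumes "t \<in> {0..T}"
  shows "omega (rhs l t z) z' + omega z (rhs m t z') = of_real (m - l) * hinner (vsnd z) (vsnd z')"
proof -
  let ?e = "eta t z" and ?e' = "eta t z'" and ?x = "vsnd z" and ?x' = "vsnd z'"
  have P: "hinner (cmat (P t) *v ?e) ?e' = hinner ?e (cmat (P t) *v ?e')"
    using hinner_cmat[of "P t"] symP[OF assms] by simp
  have R: "hinner (cmat (R t) *v ?x) ?x' = hinner ?x (cmat (R t) *v ?x')"
    using hinner_cmat[of "R t"] symR[OF assms] by simp
  have Q: "hinner (cmat (transpose (Q t)) *v ?e) ?x' = hinner ?e (cmat (Q t) *v ?x')"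
    "hinner (cmat (Q t) *v ?x) ?e' = hinner ?x (cmat (transpose (Q t)) *v ?e')"
    using hinner_cmat[of "transpose (Q t)"] hinner_cmat[of "Q t"] by simp_all
  have m: "hinner ?x (of_real m *s ?x') = of_real m * hinner ?x ?x'" by (simp add: hinner_scale_right)
  show ?thesis
    unfolding omega_alt rhs_def vfst_vjoin vsnd_vjoin hinner_diff_left hinner_diff_right hinner_add_left hinner_add_right
      y_eq[OF assms, of z] y_eq[OF assms, of z'] P R Q hinner_scale_left m
    by (simp add: algebra_simps)
qed

lemma sol_deriv:
  assumes "sol l z" "t \<in> {0..T}"
  shows "((\<lambda>t. vfst (z t)) has_vector_derivative vfst (rhs l t (z t))) (at t within {0..T})"
    and "((\<lambda>t. vsnd (z t)) has_vector_derivative eta t (z t)) (at t within {0..T})"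
proof -
  have "linear (vfst :: complex^('n + 'n) \<Rightarrow> complex^'n)" "linear (vsnd :: complex^('n + 'n) \<Rightarrow> complex^'n)"
    by (auto intro!: linearI simp: scaleR_vec_complex)
  then have b: "bounded_linear (vfst :: complex^('n + 'n) \<Rightarrow> complex^'n)"
    "bounded_linear (vsnd :: complex^('n + 'n) \<Rightarrow> complex^'n)"
    using linear_conv_bounded_linear by blast+
  have z: "(z has_vector_derivative rhs l t (z t)) (at t within {0..T})" using assms by (simp add: sol_def)
  show "((\<lambda>t. vfst (z t)) has_vector_derivative vfst (rhs l t (z t))) (at t within {0..T})"
    by (rule bounded_linear.has_vector_derivative[OF b(1) z])
  show "((\<lambda>t. vsnd (z t)) has_vector_derivative eta t (z t)) (at t within {0..T})"
    using bounded_linear.has_vector_derivative[OF b(2) z] by (simp add: rhs_def)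
qed

lemma sol_cont: "sol l z \<Longrightarrow> continuous_on {0..T} z"
  unfolding sol_def by (rule continuous_on_vector_derivative) auto

lemma sol_identity:
  assumes "sol l z" "sol m z'" "t \<in> {0..T}"
  shows "omega (z t) (z' t) - omega (z 0) (z' 0)
    = of_real (m - l) * integral {0..t} (\<lambda>s. hinner (vsnd (z s)) (vsnd (z' s)))"
proof -
  have deriv: "((\<lambda>t. omega (z t) (z' t)) has_vector_derivative
      of_real (m - l) * hinner (vsnd (z s)) (vsnd (z' s))) (at s within {0..T})" if s: "s \<in> {0..T}" for s
  proof -
    note h = bounded_bilinear.has_vector_derivative[OF bounded_bilinear_hinner]
    have "((\<lambda>t. omega (z t) (z' t)) has_vector_derivative
      (hinner (vfst (z s)) (vsnd (rhs m s (z' s))) + hinner (vfst (rhs l s (z s))) (vsnd (z' s)))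
      - (hinner (vsnd (z s)) (vfst (rhs m s (z' s))) + hinner (vsnd (rhs l s (z s))) (vfst (z' s)))) (at s within {0..T})"
      unfolding omega_alt rhs_def vsnd_vjoin
      using h[OF sol_deriv(1)[OF assms(1) s] sol_deriv(2)[OF assms(2) s]]
        h[OF sol_deriv(2)[OF assms(1) s] sol_deriv(1)[OF assms(2) s]]
      unfolding rhs_def by (intro has_vector_derivative_diff) auto
    then show ?thesis
      unfolding omega_rhs[OF s, symmetric] omega_alt by (simp add: algebra_simps)
  qed
  have "((\<lambda>s. of_real (m - l) * hinner (vsnd (z s)) (vsnd (z' s))) has_integral
      omega (z t) (z' t) - omega (z 0) (z' 0)) {0..t}"
  proof (rule fundamental_theorem_of_calculus)
    fix s assume s: "s \<in> {0..t}"
    show "((\<lambda>t. omega (z t) (z' t)) has_vector_derivative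
      of_real (m - l) * hinner (vsnd (z s)) (vsnd (z' s))) (at s within {0..t})"
      by (rule has_vector_derivative_within_subset[OF deriv]) (use s assms(3) in auto)
  qed (use assms(3) in simp)
  then show ?thesis by (metis integral_mult_right integral_unique)
qed

end

lemma omega_nondeg:
  assumes "\<And>b. omega a b = 0" shows "a = 0"
proof -
  have "omega a (vjoin (- vsnd a) (vfst a)) = of_real ((norm (vfst a))\<^sup>2 + (norm (vsnd a))\<^sup>2)"
    by (simp add: omega_alt hinner_minus_right hinner_self)
  then have "(norm (vfst a))\<^sup>2 + (norm (vsnd a))\<^sup>2 = 0" using assms by (metis of_real_eq_0_iff)
  then have "vfst a = 0" "vsnd a = 0" by (simp_all add: add_nonneg_eq_0_iff)
  then show ?thesis using vjoin_vfst_vsnd[of a] by simp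
qed

lemma omega_diff_left: "omega (a - b) c = omega a c - omega b c"
  by (simp add: omega_alt hinner_diff_left)

context linear_system
begin

text \<open>One choice for all l at once, so that joint continuity in (l, t) is part of what is
  chosen.\<close>

definition Z :: "real \<Rightarrow> real \<Rightarrow> complex^('n + 'n)^('n + 'n)" where
  "Z = (SOME Z. continuous_on (UNIV \<times> {0..T}) (\<lambda>(l, t). Z l t) \<and>
    (\<forall>l. Z l 0 = mat 1 \<and> (\<forall>t\<in>{0..T}. (Z l has_vector_derivative A l t ** Z l t) (at t within {0..T}))))"

lemma Z: "continuous_on (UNIV \<times> {0..T}) (\<lambda>(l, t). Z l t)" "Z l 0 = mat 1"
  "t \<in> {0..T} \<Longrightarrow> (Z l has_vector_derivative A l t ** Z l t) (at t within {0..T})"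
  using someI_ex[OF linear_ode_param[OF bounded_bilinear_matrix_mult T contA, of "mat 1"]]
  unfolding Z_def by blast+

lemma sol_matrix:
  assumes "\<And>t. t \<in> {0..T} \<Longrightarrow> (M has_vector_derivative A l t ** M t) (at t within {0..T})"
  shows "sol l (\<lambda>t. M t *v v)"
  unfolding sol_def
proof
  fix t assume "t \<in> {0..T}"
  then have "((\<lambda>t. M t *v v) has_vector_derivative (A l t ** M t) *v v) (at t within {0..T})"
    by (intro bounded_linear.has_vector_derivative[OF bounded_bilinear.bounded_linear_left[OF
            bounded_bilinear_matrix_vector_mult]] assms)
  then show "((\<lambda>t. M t *v v) has_vector_derivative rhs l t (M t *v v)) (at t within {0..T})"
    by (simp add: matrix_vector_mul_assoc[symmetric] A_rhs)
qed

lemma Z_sol: "sol l (\<lambda>t. Z l t *v v)"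
  by (rule sol_matrix) (rule Z(3))

lemma Z0 [simp]: "Z l 0 *v v = v"
  by (simp add: Z(2))

lemma Z_symplectic: "t \<in> {0..T} \<Longrightarrow> omega (Z l t *v u) (Z l t *v v) = omega u v"
  using sol_identity[OF Z_sol[of l u] Z_sol[of l v]] by simp

text \<open>The symplectic pairing with the solutions Z l t v is constant in time. As Z l t
  preserves \<omega> it is bijective, so these solutions exhaust all test vectors at time t, and
  nondegeneracy identifies z t.\<close>

lemma sol_unique:
  assumes "sol l z" "t \<in> {0..T}"
  shows "z t = Z l t *v z 0"
proof -
  have "x = 0" if "Z l t *v x = 0" for x
  proof (rule omega_nondeg)
    fix b show "omega x b = 0"
      unfolding Z_symplectic[OF assms(2), symmetric, of x b l] that by (simp add: omega_alt)
  qed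
  then have "inj ((*v) (Z l t))" by (simp add: vec.inj_iff_eq_0)
  then have "surj ((*v) (Z l t))" by (rule vec.linear_inj_imp_surj[OF matrix_vector_mul_linear_gen])
  have "z t - Z l t *v z 0 = 0"
  proof (rule omega_nondeg)
    fix b
    obtain v where b: "b = Z l t *v v" using surjD[OF \<open>surj ((*v) (Z l t))\<close>] by blast
    have "omega (z t) b = omega (z 0) v"
      using sol_identity[OF assms(1) Z_sol[of l v] assms(2)] by (simp add: b)
    moreover have "omega (Z l t *v z 0) b = omega (z 0) v" unfolding b by (rule Z_symplectic[OF assms(2)])
    ultimately show "omega (z t - Z l t *v z 0) b = 0" by (simp add: omega_diff_left)
  qed
  then show ?thesis by simp
qed

text \<open>If \<xi> vanishes identically, so does its derivative at 0, and y = P \<eta> + Q \<xi>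
  is 0 there. This is what makes the crossing form definite.\<close>

lemma sol_vanish:
  assumes "sol l z" "\<And>t. t \<in> {0..T} \<Longrightarrow> vsnd (z t) = 0"
  shows "z 0 = 0"
proof -
  have t0: "0 \<in> {0..T}" using T by simp
  have "((\<lambda>t. vsnd (z t)) has_vector_derivative 0) (at 0 within {0..T})"
    by (rule has_vector_derivative_transform[OF t0, of _ "\<lambda>_. 0"]) (auto simp: assms(2))
  then have "eta 0 (z 0) = 0"
    using vector_derivative_unique_within_closed_interval[of 0 T 0 "\<lambda>t. vsnd (z t)"] T t0
      sol_deriv(2)[OF assms(1) t0] by simp
  then have "vfst (z 0) = 0" using y_eq[OF t0, of "z 0"] assms(2)[OF t0] by simp
  then show ?thesis using assms(2)[OF t0] vjoin_vfst_vsnd[of "z 0"] by simp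
qed

lemma sol_norm_pos:
  assumes "sol l z" "z 0 \<noteq> 0"
  shows "integral {0..T} (\<lambda>t. (norm (vsnd (z t)))\<^sup>2) > 0"
proof -
  have c: "continuous_on {0..T} (\<lambda>t. (norm (vsnd (z t)))\<^sup>2)"
    by (intro continuous_intros sol_cont[OF assms(1)])
  have "integral {0..T} (\<lambda>t. (norm (vsnd (z t)))\<^sup>2) \<noteq> 0"
    using integral_eq_0_iff[OF c T] sol_vanish[OF assms(1)] assms(2) by auto
  moreover have "integral {0..T} (\<lambda>t. (norm (vsnd (z t)))\<^sup>2) \<ge> 0"
    by (rule integral_nonneg) (auto intro: integrable_continuous_real c)
  ultimately show ?thesis by simp
qed

definition g :: "real \<Rightarrow> real \<Rightarrow> complex^('n + 'n) \<Rightarrow> complex^('n + 'n) \<Rightarrow> complex" where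
  "g l m u v = integral {0..T} (\<lambda>t. hinner (vsnd (Z l t *v u)) (vsnd (Z m t *v v)))"

lemma contZ:
  assumes "continuous_on S f" "continuous_on S h" "h ` S \<subseteq> {0..T}"
  shows "continuous_on S (\<lambda>x. Z (f x) (h x))"
proof -
  have "continuous_on S (\<lambda>x. case (f x, h x) of (l, t) \<Rightarrow> Z l t)"
    by (rule continuous_on_compose2[OF Z(1)]) (use assms in \<open>auto intro!: continuous_intros\<close>)
  then show ?thesis by simp
qed

text \<open>On the diagonal \<open>g\<close> is the squared L2 norm of \<xi>, positive by
  \<open>sol_norm_pos\<close>; its continuity comes from the joint continuity of \<open>Z\<close> by
  integrating over a compact interval.\<close>

lemma crossing_Z: "crossing (\<lambda>l. Z l T) g"
proof
  show "omega (Z l T *v u) (Z m T *v v) - omega u v = of_real (m - l) * g l m u v" for l m u v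
    using sol_identity[OF Z_sol[of l u] Z_sol[of m v], of T] T by (simp add: g_def)
  show "continuous_on UNIV (\<lambda>(l, v). Z l T *v v)"
    unfolding case_prod_beta using T by (intro continuous_intros contZ) auto
  show "continuous_on UNIV (\<lambda>(l, m, u, v). g l m u v)"
  proof -
    have "continuous_on (UNIV \<times> cbox 0 T) (\<lambda>(x, t). hinner (vsnd (Z (fst x) t *v fst (snd (snd x))))
        (vsnd (Z (fst (snd x)) t *v snd (snd (snd x)))))"
      unfolding case_prod_beta by (intro continuous_intros contZ) auto
    then have "continuous_on UNIV (\<lambda>x. integral (cbox 0 T) (\<lambda>t. hinner (vsnd (Z (fst x) t *v fst (snd (snd x))))
        (vsnd (Z (fst (snd x)) t *v snd (snd (snd x))))))"
      by (rule integral_continuous_on_param)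
    then show ?thesis by (simp add: g_def case_prod_unfold)
  qed
  show "Re (g l l u u) > 0" if "u \<noteq> 0" for l u
  proof -
    have "continuous_on {0..T} (\<lambda>t. hinner (vsnd (Z l t *v u)) (vsnd (Z l t *v u)))"
      by (intro continuous_intros sol_cont[OF Z_sol])
    then have int: "(\<lambda>t. hinner (vsnd (Z l t *v u)) (vsnd (Z l t *v u))) integrable_on {0..T}"
      by (rule integrable_continuous_real)
    have "Re (g l l u u) = integral {0..T} (\<lambda>t. Re (hinner (vsnd (Z l t *v u)) (vsnd (Z l t *v u))))"
      unfolding g_def using integral_linear[OF int bounded_linear_Re] by (simp only: o_def)
    then show ?thesis using sol_norm_pos[OF Z_sol, of l u] that by (simp add: hinner_self)
  qed
qed

lemma matrix_bound:
  assumes "continuous_on {0..T} (M :: real \<Rightarrow> real^'n^'n)"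
  shows "\<exists>q\<ge>0. \<forall>t\<in>{0..T}. \<forall>x. norm (cmat (M t) *v x) \<le> q * norm x"
proof -
  obtain K where K: "K > 0" "\<And>(B :: complex^'n^'n) x. norm (B *v x) \<le> norm B * norm x * K"
    using bounded_bilinear.pos_bounded[OF bounded_bilinear_matrix_vector_mult] by blast
  have "compact ((\<lambda>t. cmat (M t)) ` {0..T})"
    by (intro compact_continuous_image continuous_intros assms) auto
  then have "bounded ((\<lambda>t. cmat (M t)) ` {0..T})" by (rule compact_imp_bounded)
  then obtain b where b: "b > 0" "\<forall>x\<in>(\<lambda>t. cmat (M t)) ` {0..T}. norm x \<le> b"
    unfolding bounded_pos by blast
  have "norm (cmat (M t) *v x) \<le> (b * K) * norm x" if "t \<in> {0..T}" for t x
  proof -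
    have "norm (cmat (M t) *v x) \<le> norm (cmat (M t)) * norm x * K" by (rule K(2))
    also have "\<dots> \<le> b * norm x * K" using b that K(1) by (intro mult_right_mono) auto
    finally show ?thesis by (simp add: mult_ac)
  qed
  then show ?thesis using b(1) K(1) by (intro exI[of _ "b * K"]) auto
qed

lemma elliptic_complex:
  "\<exists>c>0. \<forall>t\<in>{0..T}. \<forall>w. Re (hinner (cmat (P t) *v w) w) \<ge> c * (norm w)\<^sup>2"
proof -
  obtain c where c: "c > 0" "\<And>t w. t \<in> {0..T} \<Longrightarrow> (P t *v w) \<bullet> w \<ge> c * (norm w)\<^sup>2"
    using elliptic by blast
  have "Re (hinner (cmat (P t) *v w) w) \<ge> c * (norm w)\<^sup>2" if "t \<in> {0..T}" for t w
  proof -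
    have "(norm w)\<^sup>2 = (norm (\<chi> i. Re (w $ i)))\<^sup>2 + (norm (\<chi> i. Im (w $ i)))\<^sup>2"
      by (simp add: norm_vec_def L2_set_def sum_nonneg cmod_power2 sum.distrib)
    then show ?thesis
      unfolding Re_hinner_cmat
      using c(2)[OF that, of "\<chi> i. Re (w $ i)"] c(2)[OF that, of "\<chi> i. Im (w $ i)"]
      by (simp add: distrib_left)
  qed
  then show ?thesis using c(1) by blast
qed

text \<open>
  The weight \<open>2t/T - 1\<close> runs from \<open>-1\<close> to \<open>1\<close>, so that differentiating
  \<open>Re \<langle>y, \<xi>\<rangle> - K (2t/T - 1) |\<xi>|\<^sup>2\<close> yields the energy and a trace inequality in one stroke.
\<close>

lemma energy:
  assumes "K \<ge> 0"
  shows "\<exists>C<0. \<forall>l\<le>C. \<forall>z. sol l z \<longrightarrow> z 0 \<noteq> 0 \<longrightarrow>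
    K * ((norm (vsnd (z 0)))\<^sup>2 + (norm (vsnd (z T)))\<^sup>2)
      < Re (hinner (vfst (z T)) (vsnd (z T))) - Re (hinner (vfst (z 0)) (vsnd (z 0)))"
proof -
  obtain c where c: "c > 0" "\<And>t w. t \<in> {0..T} \<Longrightarrow> Re (hinner (cmat (P t) *v w) w) \<ge> c * (norm w)\<^sup>2"
    using elliptic_complex by blast
  obtain q where q: "q \<ge> 0" "\<And>t x. t \<in> {0..T} \<Longrightarrow> norm (cmat (Q t) *v x) \<le> q * norm x"
    using matrix_bound[OF contQ] by blast
  obtain r where r: "r \<ge> 0" "\<And>t x. t \<in> {0..T} \<Longrightarrow> norm (cmat (R t) *v x) \<le> r * norm x"
    using matrix_bound[OF contR] by blast
  \<comment> \<open>The mixed terms in \<eta> and \<xi> come from Q, twice, and from the weight;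
    together they have coefficient 2 s. Completing the square with c costs s^2 / c, the other losses
    are r and 2 K / T, and the final -1 in \<open>C\<close> leaves |\<xi>|^2 to spare.\<close>
  define s where "s = q + K"
  define C where "C = - (r + 2 * K / T + s\<^sup>2 / c) - 1"
  have "2 * K / T \<ge> 0" "s\<^sup>2 / c \<ge> 0" using assms T c(1) by simp_all
  then have "C < 0" using r(1) by (simp add: C_def)
  moreover have "K * ((norm (vsnd (z 0)))\<^sup>2 + (norm (vsnd (z T)))\<^sup>2)
      < Re (hinner (vfst (z T)) (vsnd (z T))) - Re (hinner (vfst (z 0)) (vsnd (z 0)))"
    if l: "l \<le> C" and z: "sol l z" "z 0 \<noteq> 0" for l z
  proof -
    define \<Phi> where "\<Phi> t = Re (hinner (vfst (z t)) (vsnd (z t))) - K * (2 * t / T - 1) * Re (hinner (vsnd (z t)) (vsnd (z t)))" for t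
    define D where "D t = Re (hinner (vfst (z t)) (eta t (z t)) + hinner (vfst (rhs l t (z t))) (vsnd (z t)))
      - (K * (2 * t / T - 1) * Re (hinner (vsnd (z t)) (eta t (z t)) + hinner (eta t (z t)) (vsnd (z t)))
        + K * (2 / T) * Re (hinner (vsnd (z t)) (vsnd (z t))))" for t
    have "(\<Phi> has_vector_derivative D t) (at t within {0..T})" if t: "t \<in> {0..T}" for t
    proof -
      note h = bounded_bilinear.has_vector_derivative[OF bounded_bilinear_hinner]
      note re = bounded_linear.has_vector_derivative[OF bounded_linear_Re]
      have 1: "((\<lambda>t. Re (hinner (vfst (z t)) (vsnd (z t)))) has_vector_derivative
          Re (hinner (vfst (z t)) (eta t (z t)) + hinner (vfst (rhs l t (z t))) (vsnd (z t)))) (at t within {0..T})"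
        by (intro re h sol_deriv[OF z(1) t])
      have 2: "((\<lambda>t. Re (hinner (vsnd (z t)) (vsnd (z t)))) has_vector_derivative
          Re (hinner (vsnd (z t)) (eta t (z t)) + hinner (eta t (z t)) (vsnd (z t)))) (at t within {0..T})"
        by (intro re h sol_deriv[OF z(1) t])
      have 3: "((\<lambda>t. K * (2 * t / T - 1)) has_vector_derivative K * (2 / T)) (at t within {0..T})"
        unfolding has_real_derivative_iff_has_vector_derivative[symmetric]
        using T by (auto intro!: derivative_eq_intros)
      show ?thesis
        unfolding \<Phi>_def D_def
        by (intro has_vector_derivative_diff 1 bounded_bilinear.has_vector_derivative[OF bounded_bilinear_mult 3 2])
    qed
    then have I: "(D has_integral \<Phi> T - \<Phi> 0) {0..T}"
      using T by (intro fundamental_theorem_of_calculus) auto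
    have low: "(norm (vsnd (z t)))\<^sup>2 \<le> D t" if t: "t \<in> {0..T}" for t
    proof -
      let ?e = "eta t (z t)" and ?x = "vsnd (z t)"
      let ?a = "norm ?e" and ?b = "norm ?x"
      have Reb: "\<bar>Re (hinner a b)\<bar> \<le> norm a * norm b" for a b :: "complex^'n"
        using norm_hinner_le[of a b] abs_Re_le_cmod[of "hinner a b"] by linarith
      have e1: "Re (hinner (vfst (z t)) ?e) = Re (hinner (cmat (P t) *v ?e) ?e) + Re (hinner (cmat (Q t) *v ?x) ?e)"
        by (subst y_eq[OF t]) (simp add: hinner_add_left)
      have e2: "Re (hinner (vfst (rhs l t (z t))) ?x)
          = Re (hinner ?e (cmat (Q t) *v ?x)) + Re (hinner (cmat (R t) *v ?x) ?x) - l * ?b\<^sup>2"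
        using hinner_cmat[of "transpose (Q t)" ?e ?x]
        by (simp add: rhs_def hinner_diff_left hinner_add_left hinner_scale_left hinner_self)
      have Qb: "\<bar>Re (hinner (cmat (Q t) *v ?x) ?e)\<bar> \<le> q * ?b * ?a" "\<bar>Re (hinner ?e (cmat (Q t) *v ?x))\<bar> \<le> q * ?b * ?a"
        using Reb[of "cmat (Q t) *v ?x" ?e] Reb[of ?e "cmat (Q t) *v ?x"] mult_right_mono[OF q(2)[OF t, of ?x], of ?a]
        by (simp_all add: mult.commute)
      have Rb: "\<bar>Re (hinner (cmat (R t) *v ?x) ?x)\<bar> \<le> r * ?b\<^sup>2"
        using Reb[of "cmat (R t) *v ?x" ?x] mult_right_mono[OF r(2)[OF t, of ?x], of ?b]
        by (simp add: power2_eq_square mult.assoc)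
      have Kb: "K * (2 * t / T - 1) * Re (hinner ?x ?e + hinner ?e ?x) \<le> 2 * K * ?b * ?a"
      proof -
        have "\<bar>2 * t / T - 1\<bar> \<le> 1" using t T by (auto simp: abs_le_iff field_simps)
        then have "\<bar>K * (2 * t / T - 1)\<bar> \<le> K" using assms by (simp add: abs_mult mult_left_le)
        moreover have "\<bar>Re (hinner ?x ?e + hinner ?e ?x)\<bar> \<le> 2 * (?b * ?a)"
          using Reb[of ?x ?e] Reb[of ?e ?x] by (simp add: mult.commute)
        ultimately have "\<bar>K * (2 * t / T - 1)\<bar> * \<bar>Re (hinner ?x ?e + hinner ?e ?x)\<bar> \<le> K * (2 * (?b * ?a))"
          using assms by (intro mult_mono) auto
        then show ?thesis by (simp add: abs_mult[symmetric] mult_ac)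
      qed
      have sq: "0 \<le> c * ?a\<^sup>2 - 2 * s * ?b * ?a + s\<^sup>2 / c * ?b\<^sup>2"
      proof -
        have "c * ?a\<^sup>2 - 2 * s * ?b * ?a + s\<^sup>2 / c * ?b\<^sup>2 = (c * ?a - s * ?b)\<^sup>2 / c"
          using c(1) by (simp add: power2_eq_square field_simps)
        then show ?thesis using c(1) by simp
      qed
      have "D t \<ge> c * ?a\<^sup>2 - 2 * (q * ?b * ?a) - r * ?b\<^sup>2 - l * ?b\<^sup>2 - 2 * K * ?b * ?a - K * (2 / T) * ?b\<^sup>2"
        using c(2)[OF t, of ?e] Qb Rb Kb unfolding D_def plus_complex.sel e1 e2 hinner_self by simp
      also have "c * ?a\<^sup>2 - 2 * (q * ?b * ?a) - r * ?b\<^sup>2 - l * ?b\<^sup>2 - 2 * K * ?b * ?a - K * (2 / T) * ?b\<^sup>2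
          = (c * ?a\<^sup>2 - 2 * s * ?b * ?a + s\<^sup>2 / c * ?b\<^sup>2) + (C - l) * ?b\<^sup>2 + ?b\<^sup>2"
        by (simp add: s_def C_def algebra_simps)
      finally show ?thesis using sq l by (smt (verit) mult_nonneg_nonneg zero_le_power2)
    qed
    have c': "continuous_on {0..T} (\<lambda>t. (norm (vsnd (z t)))\<^sup>2)"
      by (intro continuous_intros sol_cont[OF z(1)])
    have "integral {0..T} (\<lambda>t. (norm (vsnd (z t)))\<^sup>2) \<le> integral {0..T} D"
      by (rule integral_le) (use I low in \<open>auto intro: integrable_continuous_real c'\<close>)
    then have "0 < \<Phi> T - \<Phi> 0" using sol_norm_pos[OF z] I by (simp add: integral_unique)
    then show ?thesis using T by (simp add: \<Phi>_def hinner_self algebra_simps)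
  qed
  ultimately show ?thesis by blast
qed

end

section \<open>Boundary conditions\<close>

lemma norm_split: "(norm v)\<^sup>2 = (norm (vfst v))\<^sup>2 + (norm (vsnd v))\<^sup>2" for v :: "complex^('m::finite + 'n::finite)"
proof -
  have "complex_of_real ((norm v)\<^sup>2) = of_real ((norm (vfst v))\<^sup>2 + (norm (vsnd v))\<^sup>2)"
    using hinner_split[of v v] unfolding hinner_self by simp
  then show ?thesis by (simp only: of_real_eq_iff)
qed

lemma norm_vfst_le: "norm (vfst v) \<le> norm v" and norm_vsnd_le: "norm (vsnd v) \<le> norm v"
  for v :: "complex^('m::finite + 'n::finite)"
  by (rule power2_le_imp_le; simp add: norm_split[of v])+

lemma Lambda_D_iff: "d \<in> Lambda_D \<longleftrightarrow> vsnd (vfst d) = 0 \<and> vsnd (vsnd d) = 0"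
  (is "?L \<longleftrightarrow> ?R")
proof
  assume ?R
  then have "vfst d = vjoin (vfst (vfst d)) 0" "vsnd d = vjoin (vfst (vsnd d)) 0"
    using vjoin_vfst_vsnd[of "vfst d"] vjoin_vfst_vsnd[of "vsnd d"] by simp_all
  then have "vfst d \<in> Lambda_Dn" "vsnd d \<in> Lambda_Dn" unfolding Lambda_Dn_def by blast+
  moreover have "d = vjoin (vfst d) (vsnd d)" by simp
  ultimately show ?L unfolding Lambda_D_def by blast
qed (auto simp: Lambda_D_def Lambda_Dn_def)

lemma lagrangian_Lambda_D:
  "lagrangian omega2 (Lambda_D :: (complex^(('n::finite + 'n) + ('n + 'n))) set)"
proof -
  have n: "(Lambda_Dn :: (complex^('n + 'n)) set) = {vjoin a b |a b. a \<in> UNIV \<and> b \<in> {0}}"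
    by (auto simp: Lambda_Dn_def)
  have s: "vec.subspace (Lambda_Dn :: (complex^('n + 'n)) set)"
    unfolding n by (rule subspace_vjoin) auto
  have "vec.dim (Lambda_Dn :: (complex^('n + 'n)) set) = vec.dim (UNIV :: (complex^'n) set) + vec.dim ({0} :: (complex^'n) set)"
    unfolding n by (rule dim_vjoin) auto
  then have d: "vec.dim (Lambda_Dn :: (complex^('n + 'n)) set) = CARD('n)"
    by (simp only: vec_dim_card) simp
  have "vec.dim (Lambda_D :: (complex^(('n + 'n) + ('n + 'n))) set) = CARD('n) + CARD('n)"
    unfolding Lambda_D_def dim_vjoin[OF s s] d ..
  moreover have "vec.subspace (Lambda_D :: (complex^(('n + 'n) + ('n + 'n))) set)"
    unfolding Lambda_D_def by (rule subspace_vjoin[OF s s])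
  moreover have "omega2 a b = 0" if "a \<in> Lambda_D" "b \<in> Lambda_D" for a b :: "complex^(('n + 'n) + ('n + 'n))"
    using that by (simp add: Lambda_D_iff omega2_def omega_alt)
  ultimately show ?thesis by (simp add: lagrangian_def)
qed

text \<open>For b = (z 0, z T) this is the boundary term of the energy: the Hermitian product of y
  and \<xi> at T minus its value at 0.\<close>

definition bform :: "complex^(('n::finite + 'n) + ('n + 'n)) \<Rightarrow> complex" where
  "bform b = hinner (vfst (vsnd b)) (vsnd (vsnd b)) - hinner (vfst (vfst b)) (vsnd (vfst b))"

text \<open>The boundary values of \<xi> without those of y; the kernel is
  \<open>Lambda_D\<close>.\<close>

definition trace :: "complex^(('n::finite + 'n) + ('n + 'n)) \<Rightarrow> complex^('n + 'n)" where
  "trace b = vjoin (vsnd (vfst b)) (vsnd (vsnd b))"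

text \<open>
  On a Lagrangian subspace the boundary form depends only on the boundary values of \<open>\<xi>\<close>, as the difference
  of two elements with the same values lies in \<open>\<Lambda>\<^sub>D\<close>.
\<close>

lemma boundary_bound:
  fixes \<beta> :: "(complex^(('n::finite + 'n) + ('n + 'n))) set"
  assumes "lagrangian omega2 \<beta>"
  shows "\<exists>K\<ge>0. \<forall>b\<in>\<beta>. \<bar>Re (bform b)\<bar> \<le> K * (norm (trace b))\<^sup>2"
proof -
  have s: "vec.subspace \<beta>" using assms by (simp add: lagrangian_def)
  have tl: "vlinear (trace :: complex^(('n + 'n) + ('n + 'n)) \<Rightarrow> _)"
    by (intro vlinearI) (simp_all add: trace_def vjoin_add vjoin_scale)
  \<comment> \<open>A linear lift of boundary values into \<beta> is automatically bounded, which
    turns dependence on the trace alone into a quadratic estimate.\<close>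
  have "\<exists>g. g ` UNIV \<subseteq> \<beta> \<and> vlinear g \<and> (\<forall>v\<in>trace ` \<beta>. trace (g v) = v)"
    by (rule vec.linear_exists_right_inverse_on[OF tl s])
  then obtain g where g: "range g \<subseteq> \<beta>" "vlinear g" "\<forall>v\<in>trace ` \<beta>. trace (g v) = v" by blast
  obtain M where M: "M > 0" "\<And>x. norm (g x) \<le> M * norm x"
    using linear_bounded_pos[OF vlinear_real_linear[OF g(2)]] by blast
  have "\<bar>Re (bform b)\<bar> \<le> (2 * M) * (norm (trace b))\<^sup>2" if b: "b \<in> \<beta>" for b
  proof -
    define b' where "b' = g (trace b)"
    have b': "b' \<in> \<beta>" "trace b' = trace b" using g b by (auto simp: b'_def)
    then have eq: "vsnd (vfst b') = vsnd (vfst b)" "vsnd (vsnd b') = vsnd (vsnd b)" by (simp_all add: trace_def)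
    have "b - b' \<in> \<beta>" using vec.subspace_diff[OF s b b'(1)] .
    then have "omega2 (b - b') b = 0" using assms b by (simp add: lagrangian_def)
    then have "bform b = bform b'"
      by (simp add: omega2_def omega_alt bform_def eq hinner_diff_left algebra_simps)
    moreover have "\<bar>Re (bform b')\<bar> \<le> 2 * (norm b' * norm (trace b))"
    proof -
      have h: "\<bar>Re (hinner x y)\<bar> \<le> norm b' * norm (trace b)" if "norm x \<le> norm b'" "norm y \<le> norm (trace b)" for x y :: "complex^'n"
      proof -
        have "\<bar>Re (hinner x y)\<bar> \<le> norm (hinner x y)" by (rule abs_Re_le_cmod)
        also have "\<dots> \<le> norm x * norm y" by (rule norm_hinner_le)
        also have "\<dots> \<le> norm b' * norm (trace b)" using that by (intro mult_mono) auto
        finally show ?thesis .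
      qed
      have n: "norm (vfst (vsnd b')) \<le> norm b'" "norm (vfst (vfst b')) \<le> norm b'"
        by (rule order_trans[OF norm_vfst_le norm_vsnd_le], rule order_trans[OF norm_vfst_le norm_vfst_le])
      have t: "norm (vsnd (vsnd b')) \<le> norm (trace b)" "norm (vsnd (vfst b')) \<le> norm (trace b)"
        unfolding eq using norm_vfst_le[of "trace b"] norm_vsnd_le[of "trace b"] by (simp_all add: trace_def)
      show ?thesis using h[OF n(1) t(1)] h[OF n(2) t(2)] by (simp add: bform_def)
    qed
    moreover have "norm b' * norm (trace b) \<le> M * norm (trace b) * norm (trace b)"
      using M(2)[of "trace b"] by (intro mult_right_mono) (simp_all add: b'_def)
    ultimately show ?thesis by (simp add: power2_eq_square mult.assoc)
  qed
  then show ?thesis using M(1) by (intro exI[of _ "2 * M"]) auto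
qed

context linear_system
begin

sublocale cr: crossing "\<lambda>l. Z l T" g
  by (rule crossing_Z)

text \<open>The boundary form of a nonzero point of the graph exceeds K times its squared trace,
  while on \<beta> it is at most that and on \<open>Lambda_D\<close> both are 0. Hence there are no
  intersections. For x = b + k in the domain of the triple form, x and b have the same trace, so the
  comparison makes the form negative.\<close>

lemma below:
  assumes "lagrangian omega2 \<beta>"
  shows "\<exists>C<0. \<forall>l\<le>C. Gr (Z l T) \<inter> \<beta> = {0} \<and> Gr (Z l T) \<inter> Lambda_D = {0} \<and>
    triple_index omega2 (Gr (Z l T)) \<beta> Lambda_D = 0"
proof -
  obtain K where K: "K \<ge> 0" "\<forall>b\<in>\<beta>. \<bar>Re (bform b)\<bar> \<le> K * (norm (trace b))\<^sup>2"
    using boundary_bound[OF assms] by blast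
  obtain C where C: "C < 0" "\<And>l z. l \<le> C \<Longrightarrow> sol l z \<Longrightarrow> z 0 \<noteq> 0 \<Longrightarrow>
    K * ((norm (vsnd (z 0)))\<^sup>2 + (norm (vsnd (z T)))\<^sup>2)
      < Re (hinner (vfst (z T)) (vsnd (z T))) - Re (hinner (vfst (z 0)) (vsnd (z 0)))"
    using energy[OF K(1)] by blast
  have E: "K * (norm (trace x))\<^sup>2 < Re (bform x)" if l: "l \<le> C" and x: "x \<in> Gr (Z l T)" "x \<noteq> 0" for l x
  proof -
    obtain u where u: "x = vjoin u (Z l T *v u)" using x(1) by (auto simp: Gr_def)
    have "u \<noteq> 0" using x(2) u by auto
    then show ?thesis
      using C(2)[OF l Z_sol[of l u]] unfolding norm_split[of "trace x"] by (simp add: u trace_def bform_def)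
  qed
  have "Gr (Z l T) \<inter> \<beta> = {0} \<and> Gr (Z l T) \<inter> Lambda_D = {0} \<and> triple_index omega2 (Gr (Z l T)) \<beta> Lambda_D = 0"
    if l: "l \<le> C" for l
  proof -
    have zero: "0 \<in> Gr (Z l T)" "0 \<in> \<beta>" "0 \<in> (Lambda_D :: (complex^(('n + 'n) + ('n + 'n))) set)"
      using cr.lagrangian_Gr[of l] assms lagrangian_Lambda_D vec.subspace_0 unfolding lagrangian_def by blast+
    have "x = 0" if "x \<in> Gr (Z l T)" "x \<in> \<beta>" for x
      using E[OF l that(1)] K(2) that(2) by fastforce
    then have 1: "Gr (Z l T) \<inter> \<beta> = {0}" using zero by blast
    have "x = 0" if x: "x \<in> Gr (Z l T)" "x \<in> Lambda_D" for x
    proof (rule ccontr)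
      assume "x \<noteq> 0"
      have "bform x = 0" "trace x = 0" using x(2) by (simp_all add: Lambda_D_iff bform_def trace_def)
      then show False using E[OF l x(1) \<open>x \<noteq> 0\<close>] by simp
    qed
    then have 2: "Gr (Z l T) \<inter> Lambda_D = {0}" using zero by blast
    let ?V = "Gr (Z l T) \<inter> plus_set \<beta> Lambda_D" and ?Q = "triple_form omega2 \<beta> Lambda_D"
    interpret Q: herm_form ?V ?Q
      by (rule om.herm_triple_form[OF cr.lagrangian_Gr assms lagrangian_Lambda_D])
    obtain W where W: "vec.subspace W" "W \<subseteq> ?V" "vec.dim W = pos_index ?V ?Q"
      "\<forall>x\<in>W. x \<noteq> 0 \<longrightarrow> Re (?Q x x) > 0"
      using Q.pos_subspace by blast
    have "x = 0" if x: "x \<in> W" for x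
    proof (rule ccontr)
      assume x0: "x \<noteq> 0"
      have xV: "x \<in> Gr (Z l T)" "x \<in> plus_set \<beta> Lambda_D" using x W(2) by auto
      obtain b k where bk: "x = b + k" "b \<in> \<beta>" "k \<in> Lambda_D" using xV(2) by (auto simp: plus_set_def)
      have k: "vsnd (vfst k) = 0" "vsnd (vsnd k) = 0" using bk(3) by (simp_all add: Lambda_D_iff)
      have "?Q x x = omega2 b k"
        unfolding bk(1) by (rule om.triple_form_eval[OF assms lagrangian_Lambda_D bk(2,3) bk(2,3)])
      \<comment> \<open>As k has zero trace, adding it to b changes the boundary form only by terms
        linear in k, and the real part of that change is -Re (omega2 b k).\<close>
      moreover have "Re (omega2 b k) = Re (bform b) - Re (bform x)"
      proof -
        have r: "Re (hinner c d) = Re (hinner d c)" for c d :: "complex^'n"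
          using hinner_cnj[of c d] by (metis cnj.simps(1))
        show ?thesis
          by (simp add: omega2_def omega_alt bform_def bk(1) k hinner_add_left r[of "vsnd (vfst b)"] r[of "vsnd (vsnd b)"])
      qed
      moreover have "trace x = trace b" using k by (simp add: trace_def bk(1))
      ultimately have "Re (?Q x x) < 0" using E[OF l xV(1) x0] K(2) bk(2) by fastforce
      then show False using W(4) x x0 by fastforce
    qed
    then have "vec.dim W = 0" using vec.dim_eq_0 by blast
    moreover have "Gr (Z l T) \<inter> \<beta> \<inter> Lambda_D = {0}" using 1 2 zero by blast
    ultimately show ?thesis using 1 2 W(3) by (simp add: triple_index_def)
  qed
  then show ?thesis using C(1) by blast
qed

theorem count:
  assumes "lagrangian omega2 \<beta>"
  defines "cr \<equiv> \<lambda>\<Lambda>. {l. l < 0 \<and> Gr (Z l T) \<inter> \<Lambda> \<noteq> {0}}"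
  shows "finite (cr \<beta>)" "finite (cr Lambda_D)"
    "(\<Sum>l\<in>cr \<beta>. int (vec.dim (Gr (Z l T) \<inter> \<beta>))) - (\<Sum>l\<in>cr Lambda_D. int (vec.dim (Gr (Z l T) \<inter> Lambda_D)))
      = triple_index omega2 (Gr (Z 0 T)) \<beta> Lambda_D"
proof -
  obtain C where C: "C < 0" "\<And>l. l \<le> C \<Longrightarrow> Gr (Z l T) \<inter> \<beta> = {0}" "\<And>l. l \<le> C \<Longrightarrow> Gr (Z l T) \<inter> Lambda_D = {0}"
    "triple_index omega2 (Gr (Z C T)) \<beta> Lambda_D = 0"
    using below[OF assms(1)] by blast
  note c = cr.crossing_count[OF assms(1) lagrangian_Lambda_D C]
  show "finite (cr \<beta>)" "finite (cr Lambda_D)"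
    "(\<Sum>l\<in>cr \<beta>. int (vec.dim (Gr (Z l T) \<inter> \<beta>))) - (\<Sum>l\<in>cr Lambda_D. int (vec.dim (Gr (Z l T) \<inter> Lambda_D)))
      = triple_index omega2 (Gr (Z 0 T)) \<beta> Lambda_D"
    using c by (simp_all add: cr_def)
qed

end

section \<open>Eigenfunctions\<close>

text \<open>A square integrable function on a bounded interval is integrable, by 2 |g| \<le> 1 +
  |g|^2, and its primitive is continuous.\<close>

lemma has_W12_deriv_continuous:
  assumes "has_W12_deriv T f g" shows "continuous_on {0..T} f"
proof -
  have sq: "g \<in> borel_measurable (lebesgue_on {0..T})" "integrable (lebesgue_on {0..T}) (\<lambda>t. (norm (g t))\<^sup>2)"
    using assms by (auto simp: has_W12_deriv_def square_integrable_def)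
  have "integrable (lebesgue_on {0..T}) (\<lambda>t. 1 + (norm (g t))\<^sup>2)"
    by (intro Bochner_Integration.integrable_add sq(2)) (rule continuous_imp_integrable_real, simp)
  then have "integrable (lebesgue_on {0..T}) g"
  proof (rule Bochner_Integration.integrable_bound[OF _ sq(1)])
    have "norm (g t) \<le> norm (1 + (norm (g t))\<^sup>2)" for t
    proof -
      have "2 * norm (g t) \<le> 1 + (norm (g t))\<^sup>2"
        using zero_le_power2[of "norm (g t) - 1"] by (simp add: power2_diff)
      moreover have "norm (1 + (norm (g t))\<^sup>2) = 1 + (norm (g t))\<^sup>2"
        using zero_le_power2[of "norm (g t)"] by (simp only: real_norm_def)
      ultimately show ?thesis using norm_ge_zero[of "g t"] by linarith
    qed
    then show "AE t in lebesgue_on {0..T}. norm (g t) \<le> norm (1 + (norm (g t))\<^sup>2)" by simp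
  qed
  then have "g integrable_on {0..T}" by (rule integrable_on_lebesgue_on) simp
  then have "continuous_on {0..T} (\<lambda>t. f 0 + integral {0..t} g)"
    by (intro continuous_intros indefinite_integral_continuous_1)
  moreover have "f 0 + integral {0..t} g = f t" if "t \<in> {0..T}" for t
    using assms that unfolding has_W12_deriv_def by metis
  ultimately show ?thesis by (rule continuous_on_eq)
qed

text \<open>Bootstrap from weak to classical: a null set does not affect the primitive, and the
  primitive of a continuous function is differentiable at every point of the interval.\<close>

lemma has_W12_deriv_classical:
  assumes "has_W12_deriv T f g" "AE t in lebesgue_on {0..T}. g t = h t" "continuous_on {0..T} h" "t \<in> {0..T}"
  shows "(f has_vector_derivative h t) (at t within {0..T})"
proof -
  have "AE t in lebesgue. t \<in> {0..T} \<longrightarrow> g t = h t"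
    using assms(2) AE_restrict_space_iff[of "{0..T}" lebesgue "\<lambda>t. g t = h t"] by simp
  then obtain N where N: "N \<in> null_sets lebesgue" "{t. \<not> (t \<in> {0..T} \<longrightarrow> g t = h t)} \<subseteq> N"
    unfolding eventually_ae_filter by auto
  then have neg: "negligible N" by (simp add: negligible_iff_null_sets)
  have eq: "f s = f 0 + integral {0..s} h" if "s \<in> {0..T}" for s
  proof -
    have "integral {0..s} g = integral {0..s} h"
      by (rule integral_spike[OF neg]) (use N(2) that in auto)
    moreover have "f s = f 0 + integral {0..s} g"
      using assms(1) that unfolding has_W12_deriv_def by blast
    ultimately show ?thesis by (simp only:)
  qed
  have "((\<lambda>s. f 0 + integral {0..s} h) has_vector_derivative 0 + h t) (at t within {0..T})"
    by (intro has_vector_derivative_add has_vector_derivative_const integral_has_vector_derivative assms)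
  then have d: "((\<lambda>s. f 0 + integral {0..s} h) has_vector_derivative h t) (at t within {0..T})" by simp
  show ?thesis by (rule has_vector_derivative_transform[OF assms(4) _ d]) (rule eq)
qed

lemma classical_has_W12_deriv:
  assumes "\<And>t. t \<in> {0..T} \<Longrightarrow> (f has_vector_derivative h t) (at t within {0..T})" "continuous_on {0..T} h"
  shows "has_W12_deriv T f h"
proof -
  have "f t = f 0 + integral {0..t} h" if t: "t \<in> {0..T}" for t
  proof -
    have "(h has_integral f t - f 0) {0..t}"
    proof (rule fundamental_theorem_of_calculus)
      fix s assume "s \<in> {0..t}"
      then show "(f has_vector_derivative h s) (at s within {0..t})"
        using t by (intro has_vector_derivative_within_subset[OF assms(1)]) auto
    qed (use t in simp)
    then show ?thesis by (simp add: integral_unique)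
  qed
  moreover have "square_integrable T h"
    unfolding square_integrable_def
    by (auto intro!: continuous_imp_measurable_on_sets_lebesgue continuous_imp_integrable_real continuous_intros assms(2))
  ultimately show ?thesis unfolding has_W12_deriv_def by blast
qed

context linear_system
begin

lemma cont_eta: "continuous_on {0..T} z \<Longrightarrow> continuous_on {0..T} (\<lambda>t. eta t (z t))"
  unfolding eta_def by (intro continuous_intros contPi contQ)

lemma cont_rhs: "continuous_on {0..T} z \<Longrightarrow> continuous_on {0..T} (\<lambda>t. rhs l t (z t))"
  unfolding A_rhs[symmetric] by (intro continuous_intros contA0)

text \<open>The solution component \<xi> in the encoding of \<open>eigenspace\<close>, where
  functions vanish outside [0, T].\<close>

definition ext :: "real \<Rightarrow> complex^('n + 'n) \<Rightarrow> real \<Rightarrow> complex^'n" where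
  "ext l v = (\<lambda>t. if t \<in> {0..T} then vsnd (Z l t *v v) else 0)"

lemma has_vector_derivative_vjoin:
  assumes "(f has_vector_derivative (f' :: complex^'n)) F" "(h has_vector_derivative (h' :: complex^'n)) F"
  shows "((\<lambda>t. vjoin (f t) (h t)) has_vector_derivative vjoin f' h') F"
proof -
  let ?a = "\<lambda>x :: complex^'n. vjoin x (0 :: complex^'n)" and ?b = "\<lambda>x :: complex^'n. vjoin (0 :: complex^'n) x"
  have "linear ?a" "linear ?b" by (auto intro!: linearI simp: vjoin_add scaleR_vec_complex vjoin_scale)
  then have "bounded_linear ?a" "bounded_linear ?b" using linear_conv_bounded_linear by blast+
  then have "((\<lambda>t. ?a (f t) + ?b (h t)) has_vector_derivative ?a f' + ?b h') F"
    by (intro has_vector_derivative_add bounded_linear.has_vector_derivative[OF _ assms(1)]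
        bounded_linear.has_vector_derivative[OF _ assms(2)])
  then show ?thesis by (simp add: vjoin_add)
qed

text \<open>Regularity is gained for z = (y, \<xi>): both components are continuous, hence so are
  the right-hand sides that agree almost everywhere with their weak derivatives, and z is a
  classical solution. The boundary condition then speaks of the pair of z 0 and Z l T applied to
  it.\<close>

lemma eigenspace_eq:
  "eigenspace T P Q R \<Lambda> l = ext l ` {v. vjoin v (Z l T *v v) \<in> \<Lambda>}"
proof (intro equalityI subsetI)
  fix \<xi> assume "\<xi> \<in> eigenspace T P Q R \<Lambda> l"
  then obtain \<eta> y y' where out: "\<And>t. t \<notin> {0..T} \<Longrightarrow> \<xi> t = 0"
    and W: "has_W12_deriv T \<xi> \<eta>" "has_W12_deriv T y y'"
    and ae1: "AE t in lebesgue_on {0..T}. y t = cmat (P t) *v \<eta> t + cmat (Q t) *v \<xi> t"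
    and bc: "vjoin (vjoin (y 0) (\<xi> 0)) (vjoin (y T) (\<xi> T)) \<in> \<Lambda>"
    and ae2: "AE t in lebesgue_on {0..T}. fun_scale (of_real l) \<xi> t
        = - y' t + cmat (transpose (Q t)) *v \<eta> t + cmat (R t) *v \<xi> t"
    unfolding eigenspace_def linearization_def by blast
  define z where "z t = vjoin (y t) (\<xi> t)" for t
  have cz: "continuous_on {0..T} z"
    unfolding z_def by (intro continuous_intros has_W12_deriv_continuous[OF W(1)] has_W12_deriv_continuous[OF W(2)])
  have sp: "space (lebesgue_on {0..T}) = {0..T}" by simp
  \<comment> \<open>Invertibility of P solves the relation between y and the weak derivative for the
    latter.\<close>
  have eta: "eta t (z t) = \<eta> t" if "t \<in> {0..T}" "y t = cmat (P t) *v \<eta> t + cmat (Q t) *v \<xi> t" for t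
    using P_inv(1)[OF that(1)] that(2)
    by (simp add: eta_def z_def matrix_vector_mul_assoc cmat_mult[symmetric] cmat_one)
  have e1: "AE t in lebesgue_on {0..T}. \<eta> t = eta t (z t)"
    using AE_space ae1 by eventually_elim (use eta sp in auto)
  have e2: "AE t in lebesgue_on {0..T}. y' t = vfst (rhs l t (z t))"
    using AE_space ae1 ae2
  proof eventually_elim
    case (elim t)
    then have "eta t (z t) = \<eta> t" using eta sp by auto
    then show ?case using elim(3) by (simp add: rhs_def z_def fun_scale_def algebra_simps)
  qed
  have "continuous_on {0..T} (\<lambda>t. vfst (rhs l t (z t)))" by (intro continuous_intros cont_rhs cz)
  then have "(z has_vector_derivative rhs l t (z t)) (at t within {0..T})" if "t \<in> {0..T}" for t
    using has_vector_derivative_vjoin[OF has_W12_deriv_classical[OF W(2) e2 _ that]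
        has_W12_deriv_classical[OF W(1) e1 cont_eta[OF cz] that]]
    by (simp add: z_def[abs_def] rhs_def)
  then have sol: "sol l z" by (simp add: sol_def)
  note zt = sol_unique[OF sol]
  have "\<xi> = ext l (z 0)"
  proof
    fix t show "\<xi> t = ext l (z 0) t"
      using out[of t] zt[of t, symmetric] by (simp add: ext_def z_def)
  qed
  moreover have "z T = Z l T *v z 0" using zt[of T] T by simp
  then have "vjoin (z 0) (Z l T *v z 0) \<in> \<Lambda>" using bc by (simp add: z_def)
  ultimately show "\<xi> \<in> ext l ` {v. vjoin v (Z l T *v v) \<in> \<Lambda>}" by blast
next
  fix \<xi> assume "\<xi> \<in> ext l ` {v. vjoin v (Z l T *v v) \<in> \<Lambda>}"
  then obtain v where v: "\<xi> = ext l v" "vjoin v (Z l T *v v) \<in> \<Lambda>" by blast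
  define z where "z t = Z l t *v v" for t
  have sol: "sol l z" unfolding z_def by (rule Z_sol)
  note cz = sol_cont[OF sol]
  have xi: "\<xi> t = vsnd (z t)" if "t \<in> {0..T}" for t using that by (simp add: v ext_def z_def)
  have "(\<xi> has_vector_derivative eta t (z t)) (at t within {0..T})" if t: "t \<in> {0..T}" for t
    by (rule has_vector_derivative_transform[OF t _ sol_deriv(2)[OF sol t]]) (rule xi)
  then have W1: "has_W12_deriv T \<xi> (\<lambda>t. eta t (z t))"
    by (rule classical_has_W12_deriv[OF _ cont_eta[OF cz]])
  have cv: "continuous_on {0..T} (\<lambda>t. vfst (rhs l t (z t)))" by (intro continuous_intros cont_rhs cz)
  have W2: "has_W12_deriv T (\<lambda>t. vfst (z t)) (\<lambda>t. vfst (rhs l t (z t)))"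
    by (rule classical_has_W12_deriv[OF sol_deriv(1)[OF sol] cv])
  have a1: "vfst (z t) = cmat (P t) *v eta t (z t) + cmat (Q t) *v \<xi> t" if "t \<in> {0..T}" for t
    using y_eq[OF that, of "z t"] xi[OF that] by simp
  have a2: "fun_scale (of_real l) \<xi> t = - vfst (rhs l t (z t)) + cmat (transpose (Q t)) *v eta t (z t) + cmat (R t) *v \<xi> t"
    if "t \<in> {0..T}" for t
    using xi[OF that] by (simp add: fun_scale_def rhs_def)
  have "vjoin (vjoin (vfst (z 0)) (\<xi> 0)) (vjoin (vfst (z T)) (\<xi> T)) \<in> \<Lambda>"
    using v(2) xi[of 0] xi[of T] T by (simp add: z_def)
  moreover have "AE t in lebesgue_on {0..T}. vfst (z t) = cmat (P t) *v eta t (z t) + cmat (Q t) *v \<xi> t"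
    by (rule AE_I2) (use a1 in auto)
  moreover have "AE t in lebesgue_on {0..T}. fun_scale (of_real l) \<xi> t
      = - vfst (rhs l t (z t)) + cmat (transpose (Q t)) *v eta t (z t) + cmat (R t) *v \<xi> t"
    by (rule AE_I2) (use a2 in auto)
  ultimately have "linearization T P Q R \<Lambda> \<xi> (fun_scale (of_real l) \<xi>)"
    using W1 W2 unfolding linearization_def by blast
  then show "\<xi> \<in> eigenspace T P Q R \<Lambda> l"
    by (simp add: eigenspace_def v(1) ext_def)
qed

lemma ext_inj: "inj (ext l)"
proof (rule injI)
  fix u v assume eq: "ext l u = ext l v"
  have "vsnd (Z l t *v (u - v)) = 0" if "t \<in> {0..T}" for t
    using fun_cong[OF eq, of t] that by (simp add: ext_def matrix_vector_mult_diff_distrib)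
  then have "Z l 0 *v (u - v) = 0" using sol_vanish[OF Z_sol] by blast
  then show "u = v" by simp
qed

lemma ext_linear: "Vector_Spaces.linear (*s) fun_scale (ext l)"
proof -
  interpret f: vector_space "fun_scale :: complex \<Rightarrow> (real \<Rightarrow> complex^'n) \<Rightarrow> _" by (rule vector_space_fun_scale)
  show ?thesis
    by unfold_locales (auto simp: ext_def fun_scale_def fun_eq_iff matrix_vector_right_distrib vec.scale)
qed

text \<open>The initial values whose boundary pair lies in \<Lambda> are mapped linearly and
  injectively both onto the eigenspace and onto Gr (Z l T) \<inter> \<Lambda>; the image of a basis
  of them is the finite spanning set.\<close>

lemma eigenspace_dim:
  assumes "vec.subspace \<Lambda>"
  shows "vector_space.dim fun_scale (eigenspace T P Q R \<Lambda> l) = vec.dim (Gr (Z l T) \<inter> \<Lambda>)"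
    and "\<exists>F. finite F \<and> eigenspace T P Q R \<Lambda> l \<subseteq> module.span fun_scale F"
    and "(\<exists>\<xi>\<in>eigenspace T P Q R \<Lambda> l. \<xi> \<noteq> 0) \<longleftrightarrow> Gr (Z l T) \<inter> \<Lambda> \<noteq> {0}"
proof -
  interpret f: vector_space "fun_scale :: complex \<Rightarrow> (real \<Rightarrow> complex^'n) \<Rightarrow> _" by (rule vector_space_fun_scale)
  interpret L: Vector_Spaces.linear "(*s)" fun_scale "ext l" by (rule ext_linear)
  define S where "S = {v. vjoin v (Z l T *v v) \<in> \<Lambda>}"
  have e: "cr.e l = (\<lambda>v. vjoin v (Z l T *v v))" by (rule ext) (simp add: cr.e_def)
  have S: "S = cr.e l -` \<Lambda>" by (auto simp: S_def e)
  have sS: "vec.subspace S" unfolding S by (rule vec.linear_subspace_vimage[OF cr.e_lin assms])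
  have im: "cr.e l ` S = Gr (Z l T) \<inter> \<Lambda>" by (auto simp: S cr.Gr_range)
  have "vec.dim (cr.e l ` S) = vec.dim S"
    by (rule dim_vlinear_image[OF cr.e_lin]) (use cr.e_inj in \<open>auto simp: inj_on_def\<close>)
  then have dS: "vec.dim (Gr (Z l T) \<inter> \<Lambda>) = vec.dim S" by (simp add: im)
  obtain B where B: "B \<subseteq> S" "vec.independent B" "S \<subseteq> vec.span B" "card B = vec.dim S"
    by (rule vec.basis_exists)
  have spB: "vec.span B = S" using B sS vec.span_minimal by blast
  have finB: "finite B" by (rule vec.finiteI_independent[OF B(2)])
  have inj: "inj_on (ext l) X" for X using ext_inj by (auto simp: inj_on_def)
  have E: "eigenspace T P Q R \<Lambda> l = f.span (ext l ` B)"
    unfolding eigenspace_eq L.span_image spB S_def ..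
  have "f.independent (ext l ` B)" by (rule L.independent_injective_image[OF B(2) inj])
  then have "f.dim (eigenspace T P Q R \<Lambda> l) = card (ext l ` B)"
    unfolding E by (rule f.dim_span_eq_card_independent)
  then show "f.dim (eigenspace T P Q R \<Lambda> l) = vec.dim (Gr (Z l T) \<inter> \<Lambda>)"
    using card_image[OF inj, of B] B(4) dS by simp
  show "\<exists>F. finite F \<and> eigenspace T P Q R \<Lambda> l \<subseteq> f.span F"
    using finB E by (intro exI[of _ "ext l ` B"]) simp
  have "(\<exists>\<xi>\<in>eigenspace T P Q R \<Lambda> l. \<xi> \<noteq> 0) \<longleftrightarrow> (\<exists>v\<in>S. v \<noteq> 0)"
  proof -
    have "ext l v = 0 \<longleftrightarrow> v = 0" for v using ext_inj L.zero by (metis injD)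
    then show ?thesis unfolding eigenspace_eq S_def[symmetric] by blast
  qed
  also have "\<dots> \<longleftrightarrow> (\<exists>x\<in>Gr (Z l T) \<inter> \<Lambda>. x \<noteq> 0)"
  proof -
    have "cr.e l v = 0 \<longleftrightarrow> v = 0" for v using cr.e_inj vec.linear_0[OF cr.e_lin] by (metis injD)
    then show ?thesis unfolding im[symmetric] by blast
  qed
  also have "\<dots> \<longleftrightarrow> Gr (Z l T) \<inter> \<Lambda> \<noteq> {0}"
  proof -
    have "0 \<in> Gr (Z l T) \<inter> \<Lambda>"
      unfolding im[symmetric] using vec.subspace_0[OF vec.linear_subspace_image[OF cr.e_lin sS]] .
    then show ?thesis by blast
  qed
  finally show "(\<exists>\<xi>\<in>eigenspace T P Q R \<Lambda> l. \<xi> \<noteq> 0) \<longleftrightarrow> Gr (Z l T) \<inter> \<Lambda> \<noteq> {0}" .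
qed

text \<open>\<open>count\<close> in spectral terms: negative eigenvalues are the crossing
  parameters, multiplicities the dimensions of intersection.\<close>

theorem morse_index_difference:
  assumes "lagrangian omega2 \<Lambda>"
  shows "finite_morse_index T P Q R \<Lambda>" "finite_morse_index T P Q R Lambda_D"
    "int (morse_index T P Q R \<Lambda>) - int (morse_index T P Q R Lambda_D)
      = triple_index omega2 (Gr (Z 0 T)) \<Lambda> Lambda_D"
proof -
  have s: "vec.subspace \<Lambda>" "vec.subspace (Lambda_D :: (complex^(('n + 'n) + ('n + 'n))) set)"
    using assms lagrangian_Lambda_D by (auto simp: lagrangian_def)
  have ne: "negative_eigenvalues T P Q R \<Lambda>' = {l. l < 0 \<and> Gr (Z l T) \<inter> \<Lambda>' \<noteq> {0}}" if "vec.subspace \<Lambda>'" for \<Lambda>'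
    unfolding negative_eigenvalues_def eigenspace_dim(3)[OF that] ..
  note c = count[OF assms]
  show "finite_morse_index T P Q R \<Lambda>" "finite_morse_index T P Q R Lambda_D"
    unfolding finite_morse_index_def ne[OF s(1)] ne[OF s(2)]
    using c(1,2) eigenspace_dim(2)[OF s(1)] eigenspace_dim(2)[OF s(2)] by blast+
  show "int (morse_index T P Q R \<Lambda>) - int (morse_index T P Q R Lambda_D)
      = triple_index omega2 (Gr (Z 0 T)) \<Lambda> Lambda_D"
    unfolding morse_index_def ne[OF s(1)] ne[OF s(2)] eigenspace_dim(1)[OF s(1)] eigenspace_dim(1)[OF s(2)]
    using c(3) by simp
qed

text \<open>At l = 0 both matrix functions satisfy the same equation and start at the identity;
  uniqueness is applied vector by vector.\<close>

lemma fundamental_solution_eq: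
  assumes "fundamental_solution T (\<lambda>t. B_mat (P t) (Q t) (R t)) \<gamma>"
  shows "\<gamma> T = Z 0 T"
proof -
  have "(\<gamma> has_vector_derivative A 0 t ** \<gamma> t) (at t within {0..T})" if "t \<in> {0..T}" for t
    using assms that by (simp add: fundamental_solution_def A_def)
  then have "sol 0 (\<lambda>t. \<gamma> t *v v)" for v by (rule sol_matrix)
  then have "\<gamma> T *v v = Z 0 T *v (\<gamma> 0 *v v)" for v using sol_unique[of 0 "\<lambda>t. \<gamma> t *v v" T] T by simp
  then have "\<gamma> T *v v = Z 0 T *v v" for v using assms by (simp add: fundamental_solution_def)
  then show ?thesis by (simp add: matrix_eq)
qed

end

theorem theorem1p1:
  fixes L :: "real \<Rightarrow> real^'n \<Rightarrow> real^'n \<Rightarrow> real"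
    and x :: "real \<Rightarrow> real^'n"
    and T :: real
    and P Q R :: "real \<Rightarrow> real^'n^'n"
    and \<gamma> :: "real \<Rightarrow> complex^('n + 'n)^('n + 'n)"
    and \<Lambda>0 :: "(complex^(('n + 'n) + ('n + 'n))) set"
  assumes "T > 0"
    and "C2_on (\<lambda>(t, u, v). L t u v) ({0..T} \<times> UNIV)"
    and "legendre_convex T L"
    and "critical_point T L x"
    and "P = P_along T L x" and "Q = Q_along T L x" and "R = R_along T L x"
    and "fundamental_solution T (\<lambda>t. B_mat (P t) (Q t) (R t)) \<gamma>"
    and "lagrangian omega2 \<Lambda>0"
  shows "finite_morse_index T P Q R \<Lambda>0 \<and> finite_morse_index T P Q R Lambda_D \<and>
    int (morse_index T P Q R \<Lambda>0) - int (morse_index T P Q R Lambda_D)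
      = triple_index omega2 (Gr (\<gamma> T)) \<Lambda>0 Lambda_D"
proof -
  obtain f' f'' where "\<forall>p\<in>{0..T} \<times> UNIV. ((\<lambda>(t, u, v). L t u v) has_derivative blinfun_apply (f' p)) (at p within {0..T} \<times> UNIV)"
    "\<forall>p\<in>{0..T} \<times> UNIV. (f' has_derivative blinfun_apply (f'' p)) (at p within {0..T} \<times> UNIV)"
    "continuous_on ({0..T} \<times> UNIV) f''"
    using assms(2) unfolding C2_on_def by blast
  then interpret C2_slab T L f' f'' by unfold_locales auto
  have cx: "continuous_on {0..T} x" "continuous_on {0..T} (velocity T x)"
    using assms(4) differentiable_imp_continuous_on by (auto simp: critical_point_def)
  note c = coefficients[OF cx]
  \<comment> \<open>Symmetry of P and R is Schwarz's theorem for L in the directions of u and v,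
    positivity of P is the Legendre condition.\<close>
  interpret linear_system T P Q R
  proof
    show "(P t *v w) \<bullet> w > 0" if "t \<in> {0..T}" "w \<noteq> 0" for t w
      using assms(3) that unfolding assms(5) P_along_def legendre_convex_def by blast
    show "transpose (P t) = P t" if "t \<in> {0..T}" for t using c(4)[OF that] by (simp add: assms(5) P_along_def)
    show "transpose (R t) = R t" if "t \<in> {0..T}" for t using c(5)[OF that] by (simp add: assms(7) R_along_def)
    show "continuous_on {0..T} P" using c(1) by (simp add: assms(5) P_along_def[abs_def])
    show "continuous_on {0..T} Q" using c(2) by (simp add: assms(6) Q_along_def[abs_def])
    show "continuous_on {0..T} R" using c(3) by (simp add: assms(7) R_along_def[abs_def])
  qed fact
  show ?thesis
    unfolding fundamental_solution_eq[OF assms(8)] using morse_index_difference[OF assms(9)] by blast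
qed

end
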